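(* There exist generalized Thompson groups $V_{\mathrm{mock}}=\mathscr T(S^{\mathrm{mock}}_* )$, $V_{\mathrm{loop}}=\mathscr T(LB_* )$ and $F_{\mathrm{loop}}=\mathscr T(PLB_* )$, built (via the cloning systems specified in the context) from the mock symmetric groups, the loop braid groups and the pure loop braid groups, respectively. The group $V_{\mathrm{mock}}$ contains (a copy of) $S^{\mathrm{mock}}_n$ for every $n$, $V_{\mathrm{loop}}$ contains $LB_n$ for every $n$, and $F_{\mathrm{loop}}$ contains $PLB_n$ for every $n$. The groups $V_{\mathrm{mock}}$ and $V_{\mathrm{loop}}$ surject onto Thompson's group $V$, and $F_{\mathrm{loop}}$ surjects onto Thompson's group $F$.
   Context: Conventions: $\mathbb N=\{1,2,\dots\}$; $S_n$ is the symmetric group of $\{1,\dots,n\}$ acting on the left, $S_n\subseteq S_{n+1}$ and $S_\infty=\bigcup_n S_n$. Some maps are written on the right of their arguments and composed left to right. Cloning system. Let $(G_n)_{n\in\mathbb N}$ be groups with injective homomorphisms $\iota_{m,n}:G_m\to G_n$ ($m\le n$), $\iota_{m,m}=\mathrm{id}$, $((g)\iota_{m,n})\iota_{n,\ell}=(g)\iota_{m,\ell}$ (an injective directed system). A cloning system on it consists of homomorphisms $\rho_n:G_n\to S_n$ with $\rho_n((g)\iota_{m,n})=\rho_m(g)$ (viewed in $S_n$), and injective maps of sets (cloning maps) $\kappa^n_k:G_n\to G_{n+1}$, $1\le k\le n$, such that for $m,k\le n$ and $g\in G_m$: $((g)\iota_{m,n})\kappa^n_k=((g)\kappa^m_k)\iota_{m+1,n+1}$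 if $k\le m$ and $=(g)\iota_{m,n+1}$ if $m<k$; and such that for all $g,h\in G_n$, $1\le k\le n$ and $k<\ell\le n$: (1) $(gh)\kappa^n_k=(g)\kappa^n_{\rho_n(h)k}\cdot(h)\kappa^n_k$; (2) $((g)\kappa^n_\ell)\kappa^{n+1}_k=((g)\kappa^n_k)\kappa^{n+1}_{\ell+1}$; (3) $\rho_{n+1}((g)\kappa^n_k)(i)=((\rho_n(g))\varsigma_k)(i)$ for all $i\ne k,k+1$, where for $\sigma\in S_\infty$ the permutation $(\sigma)\varsigma_k$ sends $m$ to: $\sigma m$ if $m\le k,\ \sigma m\le\sigma k$; $\sigma m+1$ if $m<k,\ \sigma m>\sigma k$; $\sigma(m-1)$ if $m>k,\ \sigma(m-1)<\sigma k$; $\sigma(m-1)+1$ if $m>k,\ \sigma(m-1)\ge\sigma k$. Put $\kappa^n_k=\iota_{n,n+1}$ for $k>n$. On $G=\varinjlim G_n$ one gets induced $\rho:G\to S_\infty$ and $\kappa_k:G\to G$, $k\in\mathbb N$. Forests. $\mathscr F$ is the monoid generated by $\lambda_k$ ($k\in\mathbb N$) with defining relations $\lambda_j\lambda_i=\lambda_i\lambda_{j+1}$ for $i<j$. Its elements are forests: sequences $(T_i)_{i\in\mathbb N}$ of finite rooted full binary trees, almost all trivial (one leaf); $\lambda_k$ has $k$-th tree a single caret and all others trivial; $EE'$ is obtained by identifying the $i$-th leaf of $E$ with the $i$-th root of $E'$. A forest is semisimple with $n$ feet if $T_i$ is trivial for $i>1$ and $T_1$ has $n$ leaves. Generalized Thompson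 group. $\mathscr F\bowtie G$ is the monoid generated by $\mathscr F$ and $G$ subject to $g\lambda_k=\lambda_{\rho(g)k}\,(g)\kappa_k$; every element is uniquely $Eg$ with $E\in\mathscr F$, $g\in G$. It is cancellative with common right multiples, so embeds in its group of right fractions. $\mathscr T(G_* )$ is the subgroup of all $E_-gE_+^{-1}$ with $E_-,E_+$ semisimple forests both with $n$ feet and $g\in G_n$, for some $n$. Thompson's group $V$ is $\mathscr T(S_* )$ (with $\rho_n=\mathrm{id}$ and $\kappa^n_k$ the restriction of $\varsigma_k$), and $F=\mathscr T(\{1\})$. Mock symmetric groups. $S^{\mathrm{mock}}_n$ is generated by $s_{i,j}$, $1\le i<j\le n$, with relations $s_{i,j}^2=1$; $s_{i,j}s_{k,\ell}=s_{k,\ell}s_{i,j}$ for $i<j<k<\ell$; $s_{k,\ell}s_{i,j}=s_{k+\ell-j,k+\ell-i}s_{k,\ell}$ for $k\le i<j\le\ell$. The map $\iota_{n,n+1}$ sends $s_{i,j}\mapsto s_{i,j}$. The homomorphism $\rho_n$ sends $s_{i,j}$ to the permutation $m\mapsto i+j-m$ for $i\le m\le j$, fixing all other $m$. The cloning maps are determined by rule (1) and $(s_{i,j})\kappa^n_k=s_{i,j}$ if $j<k$; $s_{i,j+1}s_{k,k+1}$ if $i\le k\le j$; $s_{i+1,j+1}$ if $k<i$. Loop braid groups. $LB_n$ is the group of symmetric automorphisms of the free group on $x_1,\dots,x_n$ (each $x_i$ is sent to a conjugate of some $x_j$; products of automorphisms composed left to right). It is generated by $\beta_i,\sigma_i$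 ($1\le i\le n-1$), where $\beta_i:x_i\mapsto x_{i+1},\ x_{i+1}\mapsto x_{i+1}^{-1}x_ix_{i+1}$, $\sigma_i:x_i\mapsto x_{i+1},\ x_{i+1}\mapsto x_i$, the other generators being fixed. Its defining relations are: $\beta_i\beta_j=\beta_j\beta_i$, $\sigma_i\sigma_j=\sigma_j\sigma_i$, $\beta_i\sigma_j=\sigma_j\beta_i$ for $|i-j|>1$; $\beta_i\beta_{i+1}\beta_i=\beta_{i+1}\beta_i\beta_{i+1}$; $\sigma_i^2=1$; $\sigma_i\sigma_{i+1}\sigma_i=\sigma_{i+1}\sigma_i\sigma_{i+1}$; $\sigma_i\sigma_{i+1}\beta_i=\beta_{i+1}\sigma_i\sigma_{i+1}$; $\beta_i\beta_{i+1}\sigma_i=\sigma_{i+1}\beta_i\beta_{i+1}$. The map $\iota_{n,n+1}$ extends an automorphism by fixing $x_{n+1}$. The homomorphism $\rho_n$ sends both $\beta_i$ and $\sigma_i$ to the transposition $(i\ i+1)$. The cloning maps are determined by rule (1) and, for $\tau_i^{\varepsilon}$ equal to $\beta_i^{\pm1}$ or $\sigma_i$: $(\tau_i^{\varepsilon})\kappa_k=\tau_{i+1}^{\varepsilon}$ if $k<i$; $\tau_i^{\varepsilon}\tau_{i+1}^{\varepsilon}$ if $k=i$; $\tau_{i+1}^{\varepsilon}\tau_i^{\varepsilon}$ if $k=i+1$; $\tau_i^{\varepsilon}$ if $k>i+1$. $PLB_n=\ker\rho_n$ is the subgroup of automorphisms sending each $x_i$ to a conjugate of itself, with the restricted data.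 *)

theory Defs
  imports "HOL-Algebra.Bij" "HOL-Algebra.Elementary_Groups" "HOL-Algebra.Sym_Groups"
begin

(* Indices follow the convention that the natural numbers start at 1: families of groups
   are functions on nat of which only the values at n >= 1 matter, and S_n is the library's
   sym_group n, whose elements are functions nat => nat permuting {1..n} and fixing
   everything else.  In particular S_n is literally a subset of S_(n+1), and its
   multiplication is composition of functions (left action). *)


section \<open>Cloning systems\<close>

text \<open>The permutation \<open>(\<sigma>)\<varsigma>\<^sub>k\<close>.\<close>

definition perm_clone :: "nat \<Rightarrow> (nat \<Rightarrow> nat) \<Rightarrow> nat \<Rightarrow> nat" where
  "perm_clone k \<sigma> m =
     (if m \<le> k then (if \<sigma> m \<le> \<sigma> k then \<sigma> m else \<sigma> m + 1)
      else (if \<sigma> (m - 1) < \<sigma> k then \<sigma> (m - 1) else \<sigma> (m - 1) + 1))"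

text \<open>\<open>\<iota> m n\<close> is \<open>\<iota>\<^bsub>m,n\<^esub>\<close>, \<open>\<rho> n\<close> is \<open>\<rho>\<^sub>n\<close> and \<open>\<kappa> n k\<close> is \<open>\<kappa>\<^sup>n\<^sub>k\<close>, all written
  on the left of their arguments here.  The values \<open>\<kappa> n k\<close> matter only for \<open>1 \<le> k \<le> n\<close>;
  the convention for \<open>k > n\<close> is \<open>clone_ext\<close> below.\<close>

locale cloning_system =
  fixes G :: "nat \<Rightarrow> 'a monoid"
    and \<iota> :: "nat \<Rightarrow> nat \<Rightarrow> 'a \<Rightarrow> 'a"
    and \<rho> :: "nat \<Rightarrow> 'a \<Rightarrow> nat \<Rightarrow> nat"
    and \<kappa> :: "nat \<Rightarrow> nat \<Rightarrow> 'a \<Rightarrow> 'a"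
  assumes group: "1 \<le> n \<Longrightarrow> group (G n)"
    and incl_mon: "\<lbrakk>1 \<le> m; m \<le> n\<rbrakk> \<Longrightarrow> \<iota> m n \<in> mon (G m) (G n)"
    and incl_refl: "\<lbrakk>1 \<le> n; g \<in> carrier (G n)\<rbrakk> \<Longrightarrow> \<iota> n n g = g"
    and incl_trans: "\<lbrakk>1 \<le> m; m \<le> n; n \<le> l; g \<in> carrier (G m)\<rbrakk>
                       \<Longrightarrow> \<iota> n l (\<iota> m n g) = \<iota> m l g"
    and rho_hom: "1 \<le> n \<Longrightarrow> \<rho> n \<in> hom (G n) (sym_group n)"
    and rho_incl: "\<lbrakk>1 \<le> m; m \<le> n; g \<in> carrier (G m)\<rbrakk> \<Longrightarrow> \<rho> n (\<iota> m n g) = \<rho> m g"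
    and clone_closed: "\<lbrakk>1 \<le> k; k \<le> n\<rbrakk> \<Longrightarrow> \<kappa> n k \<in> carrier (G n) \<rightarrow> carrier (G (n + 1))"
    and clone_inj: "\<lbrakk>1 \<le> k; k \<le> n\<rbrakk> \<Longrightarrow> inj_on (\<kappa> n k) (carrier (G n))"
    and clone_incl: "\<lbrakk>1 \<le> m; m \<le> n; 1 \<le> k; k \<le> n; g \<in> carrier (G m)\<rbrakk>
                       \<Longrightarrow> \<kappa> n k (\<iota> m n g) =
                           (if k \<le> m then \<iota> (m + 1) (n + 1) (\<kappa> m k g) else \<iota> m (n + 1) g)"
    and clone_mult: "\<lbrakk>1 \<le> k; k \<le> n; g \<in> carrier (G n); h \<in> carrier (G n)\<rbrakk>
                       \<Longrightarrow> \<kappa> n k (g \<otimes>\<^bsub>G n\<^esub> h) = \<kappa> n (\<rho> n h k) g \<otimes>\<^bsub>G (n + 1)\<^esub> \<kappa> n k h"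
    and clone_clone: "\<lbrakk>1 \<le> k; k < l; l \<le> n; g \<in> carrier (G n)\<rbrakk>
                       \<Longrightarrow> \<kappa> (n + 1) k (\<kappa> n l g) = \<kappa> (n + 1) (l + 1) (\<kappa> n k g)"
    and rho_clone: "\<lbrakk>1 \<le> k; k \<le> n; g \<in> carrier (G n); 1 \<le> i; i \<noteq> k; i \<noteq> k + 1\<rbrakk>
                       \<Longrightarrow> \<rho> (n + 1) (\<kappa> n k g) i = perm_clone k (\<rho> n g) i"

definition clone_ext ::
  "(nat \<Rightarrow> nat \<Rightarrow> 'a \<Rightarrow> 'a) \<Rightarrow> (nat \<Rightarrow> nat \<Rightarrow> 'a \<Rightarrow> 'a) \<Rightarrow> nat \<Rightarrow> nat \<Rightarrow> 'a \<Rightarrow> 'a" where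
  "clone_ext \<iota> \<kappa> n k = (if k \<le> n then \<kappa> n k else \<iota> n (n + 1))"


section \<open>The direct limit and the induced maps\<close>

text \<open>The element of the direct limit represented by \<open>g \<in> G n\<close>, as the class of all pairs
  \<open>(m, h)\<close> with \<open>h \<in> G m\<close> that become equal to \<open>(n, g)\<close> at some later stage.\<close>

definition lim_class ::
  "(nat \<Rightarrow> 'a monoid) \<Rightarrow> (nat \<Rightarrow> nat \<Rightarrow> 'a \<Rightarrow> 'a) \<Rightarrow> nat \<Rightarrow> 'a \<Rightarrow> (nat \<times> 'a) set" where
  "lim_class G \<iota> n g =
     {(m, h). 1 \<le> m \<and> h \<in> carrier (G m) \<and> (\<exists>l. m \<le> l \<and> n \<le> l \<and> \<iota> m l h = \<iota> n l g)}"

definition direct_limit ::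
  "(nat \<Rightarrow> 'a monoid) \<Rightarrow> (nat \<Rightarrow> nat \<Rightarrow> 'a \<Rightarrow> 'a) \<Rightarrow> (nat \<times> 'a) set monoid" where
  "direct_limit G \<iota> =
     \<lparr>carrier = {lim_class G \<iota> n g |n g. 1 \<le> n \<and> g \<in> carrier (G n)},
      monoid.mult = (\<lambda>X Y. \<Union>{lim_class G \<iota> (max m n)
                         (\<iota> m (max m n) g \<otimes>\<^bsub>G (max m n)\<^esub> \<iota> n (max m n) h)
                       |m g n h. (m, g) \<in> X \<and> (n, h) \<in> Y}),
      one = lim_class G \<iota> 1 \<one>\<^bsub>G 1\<^esub>\<rparr>"

definition lim_rho :: "(nat \<Rightarrow> 'a \<Rightarrow> nat \<Rightarrow> nat) \<Rightarrow> (nat \<times> 'a) set \<Rightarrow> nat \<Rightarrow> nat" where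
  "lim_rho \<rho> X = the_elem ((\<lambda>(n, g). \<rho> n g) ` X)"

definition lim_clone ::
  "(nat \<Rightarrow> 'a monoid) \<Rightarrow> (nat \<Rightarrow> nat \<Rightarrow> 'a \<Rightarrow> 'a) \<Rightarrow> (nat \<Rightarrow> nat \<Rightarrow> 'a \<Rightarrow> 'a)
     \<Rightarrow> nat \<Rightarrow> (nat \<times> 'a) set \<Rightarrow> (nat \<times> 'a) set" where
  "lim_clone G \<iota> \<kappa> k X =
     the_elem ((\<lambda>(n, g). lim_class G \<iota> (n + 1) (clone_ext \<iota> \<kappa> n k g)) ` X)"


section \<open>Monoids given by generators and relations\<close>

inductive word_eq :: "'x set \<Rightarrow> ('x list \<times> 'x list) set \<Rightarrow> 'x list \<Rightarrow> 'x list \<Rightarrow> bool"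
  for A R where
    refl: "u \<in> lists A \<Longrightarrow> word_eq A R u u"
  | sym: "word_eq A R u v \<Longrightarrow> word_eq A R v u"
  | trans: "word_eq A R u v \<Longrightarrow> word_eq A R v w \<Longrightarrow> word_eq A R u w"
  | rel: "(u, v) \<in> R \<Longrightarrow> p \<in> lists A \<Longrightarrow> q \<in> lists A \<Longrightarrow> word_eq A R (p @ u @ q) (p @ v @ q)"

definition word_class :: "'x set \<Rightarrow> ('x list \<times> 'x list) set \<Rightarrow> 'x list \<Rightarrow> 'x list set" where
  "word_class A R w = {v. word_eq A R w v}"

definition monoid_presentation ::
  "'x set \<Rightarrow> ('x list \<times> 'x list) set \<Rightarrow> 'x list set monoid" where
  "monoid_presentation A R =
     \<lparr>carrier = word_class A R ` lists A,
      monoid.mult = (\<lambda>X Y. \<Union>u \<in> X. \<Union>v \<in> Y. word_class A R (u @ v)),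
      one = word_class A R []\<rparr>"


section \<open>Forests\<close>

datatype bintree = Leaf | Caret bintree bintree

primrec leaves :: "bintree \<Rightarrow> nat" where
  "leaves Leaf = 1"
| "leaves (Caret l r) = leaves l + leaves r"

text \<open>\<open>graft T E i\<close> attaches the trees \<open>E i\<close>, \<open>E (i + 1)\<close>, \<open>\<dots>\<close> to the leaves of \<open>T\<close>
  from left to right.\<close>

primrec graft :: "bintree \<Rightarrow> (nat \<Rightarrow> bintree) \<Rightarrow> nat \<Rightarrow> bintree" where
  "graft Leaf E i = E i"
| "graft (Caret l r) E i = Caret (graft l E i) (graft r E (i + leaves l))"

text \<open>Forests are indexed from 1, so the leaves of the \<open>i\<close>-th tree of \<open>E\<close> are preceded by
  the leaves of its trees with indices \<open>1, \<dots>, i - 1\<close>.\<close>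

definition forest_mult ::
  "(nat \<Rightarrow> bintree) \<Rightarrow> (nat \<Rightarrow> bintree) \<Rightarrow> nat \<Rightarrow> bintree" where
  "forest_mult E E' i = graft (E i) E' (1 + (\<Sum>j = 1..<i. leaves (E j)))"

definition caret_forest :: "nat \<Rightarrow> nat \<Rightarrow> bintree" where
  "caret_forest k = (\<lambda>i. if i = k then Caret Leaf Leaf else Leaf)"

text \<open>The forest that the word \<open>\<lambda>\<^bsub>k\<^sub>1\<^esub> \<dots> \<lambda>\<^bsub>k\<^sub>r\<^esub>\<close>, given as the list of its indices,
  represents.\<close>

definition forest_of :: "nat list \<Rightarrow> nat \<Rightarrow> bintree" where
  "forest_of ks = foldr (\<lambda>k. forest_mult (caret_forest k)) ks (\<lambda>_. Leaf)"

definition semisimple :: "nat \<Rightarrow> nat list \<Rightarrow> bool" where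
  "semisimple n ks \<longleftrightarrow> (\<forall>i > 1. forest_of ks i = Leaf) \<and> leaves (forest_of ks 1) = n"


section \<open>Generalized Thompson groups\<close>

datatype 'g generator = Lambda nat | Grp 'g

definition bzs_generators :: "('g, 'b) monoid_scheme \<Rightarrow> 'g generator set" where
  "bzs_generators L = Lambda ` {1..} \<union> Grp ` carrier L"

text \<open>The defining relations of the forest monoid, the multiplication table of the group \<open>L\<close>,
  and the relations \<open>g \<lambda>\<^sub>k = \<lambda>\<^bsub>\<rho>(g)k\<^esub> (g)\<kappa>\<^sub>k\<close>.\<close>

definition bzs_relations ::
  "('g, 'b) monoid_scheme \<Rightarrow> ('g \<Rightarrow> nat \<Rightarrow> nat) \<Rightarrow> (nat \<Rightarrow> 'g \<Rightarrow> 'g)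
     \<Rightarrow> ('g generator list \<times> 'g generator list) set" where
  "bzs_relations L r c =
     {([Lambda j, Lambda i], [Lambda i, Lambda (j + 1)]) |i j. 1 \<le> i \<and> i < j} \<union>
     {([Grp g, Grp h], [Grp (g \<otimes>\<^bsub>L\<^esub> h)]) |g h. g \<in> carrier L \<and> h \<in> carrier L} \<union>
     {([Grp \<one>\<^bsub>L\<^esub>], [])} \<union>
     {([Grp g, Lambda k], [Lambda (r g k), Grp (c k g)]) |g k. g \<in> carrier L \<and> 1 \<le> k}"

abbreviation bzs_class ::
  "(nat \<Rightarrow> 'a monoid) \<Rightarrow> (nat \<Rightarrow> nat \<Rightarrow> 'a \<Rightarrow> 'a) \<Rightarrow> (nat \<Rightarrow> 'a \<Rightarrow> nat \<Rightarrow> nat)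
     \<Rightarrow> (nat \<Rightarrow> nat \<Rightarrow> 'a \<Rightarrow> 'a) \<Rightarrow> (nat \<times> 'a) set generator list
     \<Rightarrow> (nat \<times> 'a) set generator list set" where
  "bzs_class G \<iota> \<rho> \<kappa> \<equiv>
     word_class (bzs_generators (direct_limit G \<iota>))
       (bzs_relations (direct_limit G \<iota>) (lim_rho \<rho>) (lim_clone G \<iota> \<kappa>))"

definition bzs_monoid ::
  "(nat \<Rightarrow> 'a monoid) \<Rightarrow> (nat \<Rightarrow> nat \<Rightarrow> 'a \<Rightarrow> 'a) \<Rightarrow> (nat \<Rightarrow> 'a \<Rightarrow> nat \<Rightarrow> nat)
     \<Rightarrow> (nat \<Rightarrow> nat \<Rightarrow> 'a \<Rightarrow> 'a) \<Rightarrow> (nat \<times> 'a) set generator list set monoid" where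
  "bzs_monoid G \<iota> \<rho> \<kappa> =
     monoid_presentation (bzs_generators (direct_limit G \<iota>))
       (bzs_relations (direct_limit G \<iota>) (lim_rho \<rho>) (lim_clone G \<iota> \<kappa>))"

text \<open>The group of right fractions of a cancellative monoid with common right multiples.
  The class \<open>right_fraction M a b\<close> stands for \<open>a b\<inverse>\<close>.  If \<open>b x = c y\<close>, then
  \<open>(a b\<inverse>) (c d\<inverse>) = (a x) (d y)\<inverse>\<close>.\<close>

definition right_fraction :: "('m, 'b) monoid_scheme \<Rightarrow> 'm \<Rightarrow> 'm \<Rightarrow> ('m \<times> 'm) set" where
  "right_fraction M a b =
     {(c, d). c \<in> carrier M \<and> d \<in> carrier M \<and>
        (\<exists>x \<in> carrier M. \<exists>y \<in> carrier M. a \<otimes>\<^bsub>M\<^esub> x = c \<otimes>\<^bsub>M\<^esub> y \<and> b \<otimes>\<^bsub>M\<^esub> x = d \<otimes>\<^bsub>M\<^esub> y)}"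

definition right_fractions :: "('m, 'b) monoid_scheme \<Rightarrow> ('m \<times> 'm) set monoid" where
  "right_fractions M =
     \<lparr>carrier = {right_fraction M a b |a b. a \<in> carrier M \<and> b \<in> carrier M},
      monoid.mult = (\<lambda>X Y. \<Union>{right_fraction M (a \<otimes>\<^bsub>M\<^esub> x) (d \<otimes>\<^bsub>M\<^esub> y)
                       |a b c d x y. (a, b) \<in> X \<and> (c, d) \<in> Y \<and>
                          x \<in> carrier M \<and> y \<in> carrier M \<and> b \<otimes>\<^bsub>M\<^esub> x = c \<otimes>\<^bsub>M\<^esub> y}),
      one = right_fraction M \<one>\<^bsub>M\<^esub> \<one>\<^bsub>M\<^esub>\<rparr>"

text \<open>The forests \<open>E\<^sub>-\<close> and \<open>E\<^sub>+\<close> are given by words \<open>ks\<close> and \<open>ls\<close> in the \<open>\<lambda>\<^sub>k\<close>.\<close>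

definition thompson_group ::
  "(nat \<Rightarrow> 'a monoid) \<Rightarrow> (nat \<Rightarrow> nat \<Rightarrow> 'a \<Rightarrow> 'a) \<Rightarrow> (nat \<Rightarrow> 'a \<Rightarrow> nat \<Rightarrow> nat)
     \<Rightarrow> (nat \<Rightarrow> nat \<Rightarrow> 'a \<Rightarrow> 'a)
     \<Rightarrow> ((nat \<times> 'a) set generator list set \<times> (nat \<times> 'a) set generator list set) set monoid" where
  "thompson_group G \<iota> \<rho> \<kappa> =
     right_fractions (bzs_monoid G \<iota> \<rho> \<kappa>)
       \<lparr>carrier :=
          {right_fraction (bzs_monoid G \<iota> \<rho> \<kappa>)
             (bzs_class G \<iota> \<rho> \<kappa> (map Lambda ks @ [Grp (lim_class G \<iota> n g)]))
             (bzs_class G \<iota> \<rho> \<kappa> (map Lambda ls))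
           |ks ls n g. 1 \<le> n \<and> ks \<in> lists {1..} \<and> ls \<in> lists {1..} \<and>
              semisimple n ks \<and> semisimple n ls \<and> g \<in> carrier (G n)}\<rparr>"

definition thompson_V where
  "thompson_V = thompson_group sym_group (\<lambda>m n \<sigma>. \<sigma>) (\<lambda>n \<sigma>. \<sigma>) (\<lambda>n k \<sigma>. perm_clone k \<sigma>)"

definition thompson_F where
  "thompson_F = thompson_group (\<lambda>n. singleton_group ()) (\<lambda>m n g. g) (\<lambda>n g. id) (\<lambda>n k g. g)"


section \<open>Free groups and group presentations\<close>

text \<open>The free group on \<open>X\<close> consists of the freely reduced words in the letters \<open>(x, True)\<close>,
  standing for \<open>x\<close>, and \<open>(x, False)\<close>, standing for \<open>x\<inverse>\<close>.\<close>

type_synonym 'x fword = "('x \<times> bool) list"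

fun push_letter :: "'x \<times> bool \<Rightarrow> 'x fword \<Rightarrow> 'x fword" where
  "push_letter a [] = [a]"
| "push_letter a (b # w) = (if fst a = fst b \<and> snd a \<noteq> snd b then w else a # b # w)"

definition freely_reduced :: "'x fword \<Rightarrow> bool" where
  "freely_reduced w \<longleftrightarrow> successively (\<lambda>a b. \<not> (fst a = fst b \<and> snd a \<noteq> snd b)) w"

definition free_group :: "'x set \<Rightarrow> 'x fword monoid" where
  "free_group X =
     \<lparr>carrier = {w. freely_reduced w \<and> fst ` set w \<subseteq> X},
      monoid.mult = foldr push_letter,
      one = []\<rparr>"

text \<open>The homomorphism from a free group to \<open>H\<close> that sends each free generator \<open>x\<close> to \<open>f x\<close>.\<close>

definition free_extension :: "('a, 'b) monoid_scheme \<Rightarrow> ('x \<Rightarrow> 'a) \<Rightarrow> 'x fword \<Rightarrow> 'a" where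
  "free_extension H f w =
     foldr (\<lambda>(x, b) h. (if b then f x else inv\<^bsub>H\<^esub> f x) \<otimes>\<^bsub>H\<^esub> h) w \<one>\<^bsub>H\<^esub>"

definition normal_closure :: "('a, 'b) monoid_scheme \<Rightarrow> 'a set \<Rightarrow> 'a set" where
  "normal_closure G R = generate G {g \<otimes>\<^bsub>G\<^esub> r \<otimes>\<^bsub>G\<^esub> inv\<^bsub>G\<^esub> g |g r. g \<in> carrier G \<and> r \<in> R}"

text \<open>A pair \<open>(u, v)\<close> in \<open>R\<close> is the relation \<open>u = v\<close>.\<close>

definition relators :: "'x set \<Rightarrow> ('x fword \<times> 'x fword) set \<Rightarrow> 'x fword set" where
  "relators X R = {u \<otimes>\<^bsub>free_group X\<^esub> inv\<^bsub>free_group X\<^esub> v |u v. (u, v) \<in> R}"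

definition group_presentation ::
  "'x set \<Rightarrow> ('x fword \<times> 'x fword) set \<Rightarrow> 'x fword set monoid" where
  "group_presentation X R = free_group X Mod normal_closure (free_group X) (relators X R)"


section \<open>Mock symmetric groups\<close>

definition mock_index :: "nat \<Rightarrow> (nat \<times> nat) set" where
  "mock_index n = {(i, j). 1 \<le> i \<and> i < j \<and> j \<le> n}"

definition mock_relations :: "nat \<Rightarrow> ((nat \<times> nat) fword \<times> (nat \<times> nat) fword) set" where
  "mock_relations n =
     {([((i, j), True), ((i, j), True)], []) |i j. (i, j) \<in> mock_index n} \<union>
     {([((i, j), True), ((k, l), True)], [((k, l), True), ((i, j), True)]) |i j k l.
        (i, j) \<in> mock_index n \<and> (k, l) \<in> mock_index n \<and> j < k} \<union>
     {([((k, l), True), ((i, j), True)], [((k + l - j, k + l - i), True), ((k, l), True)]) |i j k l.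
        (i, j) \<in> mock_index n \<and> (k, l) \<in> mock_index n \<and> k \<le> i \<and> j \<le> l}"

definition mock_group :: "nat \<Rightarrow> (nat \<times> nat) fword set monoid" where
  "mock_group n = group_presentation (mock_index n) (mock_relations n)"

definition mock_s :: "nat \<Rightarrow> nat \<Rightarrow> nat \<Rightarrow> (nat \<times> nat) fword set" where
  "mock_s n i j =
     normal_closure (free_group (mock_index n)) (relators (mock_index n) (mock_relations n))
       #>\<^bsub>free_group (mock_index n)\<^esub> [((i, j), True)]"

text \<open>The values on generators.  Together with the homomorphism conditions and rule (1), which
  are part of \<open>cloning_system\<close>, they determine all the maps on the groups.\<close>

definition mock_generator_values ::
  "(nat \<Rightarrow> nat \<Rightarrow> (nat \<times> nat) fword set \<Rightarrow> (nat \<times> nat) fword set)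
     \<Rightarrow> (nat \<Rightarrow> (nat \<times> nat) fword set \<Rightarrow> nat \<Rightarrow> nat)
     \<Rightarrow> (nat \<Rightarrow> nat \<Rightarrow> (nat \<times> nat) fword set \<Rightarrow> (nat \<times> nat) fword set) \<Rightarrow> bool" where
  "mock_generator_values \<iota> \<rho> \<kappa> \<longleftrightarrow>
     (\<forall>n i j. 1 \<le> i \<and> i < j \<and> j \<le> n \<longrightarrow>
        \<iota> n (n + 1) (mock_s n i j) = mock_s (n + 1) i j \<and>
        \<rho> n (mock_s n i j) = (\<lambda>m. if i \<le> m \<and> m \<le> j then i + j - m else m) \<and>
        (\<forall>k. 1 \<le> k \<and> k \<le> n \<longrightarrow>
           \<kappa> n k (mock_s n i j) =
             (if j < k then mock_s (n + 1) i j
              else if i \<le> k then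
                mock_s (n + 1) i (j + 1) \<otimes>\<^bsub>mock_group (n + 1)\<^esub> mock_s (n + 1) k (k + 1)
              else mock_s (n + 1) (i + 1) (j + 1))))"


section \<open>Loop braid groups\<close>

abbreviation free_gen :: "nat \<Rightarrow> nat fword" where
  "free_gen i \<equiv> [(i, True)]"

abbreviation free_rank :: "nat \<Rightarrow> nat fword monoid" where
  "free_rank n \<equiv> free_group {1..n}"

text \<open>The library's \<open>AutoGroup\<close> composes from right to left, whereas the product of loop
  braid groups is composition from left to right.  Its elements are functions that are
  \<^const>\<open>undefined\<close> outside the carrier of the free group.\<close>

definition LB :: "nat \<Rightarrow> (nat fword \<Rightarrow> nat fword) monoid" where
  "LB n =
     \<lparr>carrier = {g \<in> carrier (AutoGroup (free_rank n)).
        \<forall>i \<in> {1..n}. \<exists>j \<in> {1..n}. \<exists>w \<in> carrier (free_rank n).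
          g (free_gen i) = inv\<^bsub>free_rank n\<^esub> w \<otimes>\<^bsub>free_rank n\<^esub> free_gen j \<otimes>\<^bsub>free_rank n\<^esub> w},
      monoid.mult = (\<lambda>g h. h \<otimes>\<^bsub>AutoGroup (free_rank n)\<^esub> g),
      one = \<one>\<^bsub>AutoGroup (free_rank n)\<^esub>\<rparr>"

definition PLB :: "nat \<Rightarrow> (nat fword \<Rightarrow> nat fword) monoid" where
  "PLB n = LB n
     \<lparr>carrier := {g \<in> carrier (LB n).
        \<forall>i \<in> {1..n}. \<exists>w \<in> carrier (free_rank n).
          g (free_gen i) = inv\<^bsub>free_rank n\<^esub> w \<otimes>\<^bsub>free_rank n\<^esub> free_gen i \<otimes>\<^bsub>free_rank n\<^esub> w}\<rparr>"

definition free_endo :: "nat \<Rightarrow> (nat \<Rightarrow> nat fword) \<Rightarrow> nat fword \<Rightarrow> nat fword" where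
  "free_endo n f = restrict (free_extension (free_rank n) f) (carrier (free_rank n))"

definition loop_beta :: "nat \<Rightarrow> nat \<Rightarrow> nat fword \<Rightarrow> nat fword" where
  "loop_beta n i = free_endo n (\<lambda>j.
     if j = i then free_gen (i + 1)
     else if j = i + 1 then
       inv\<^bsub>free_rank n\<^esub> (free_gen (i + 1)) \<otimes>\<^bsub>free_rank n\<^esub> free_gen i \<otimes>\<^bsub>free_rank n\<^esub> free_gen (i + 1)
     else free_gen j)"

definition loop_sigma :: "nat \<Rightarrow> nat \<Rightarrow> nat fword \<Rightarrow> nat fword" where
  "loop_sigma n i = free_endo n (\<lambda>j.
     if j = i then free_gen (i + 1) else if j = i + 1 then free_gen i else free_gen j)"

definition loop_incl :: "nat \<Rightarrow> nat \<Rightarrow> (nat fword \<Rightarrow> nat fword) \<Rightarrow> nat fword \<Rightarrow> nat fword" where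
  "loop_incl m n g = free_endo n (\<lambda>j. if j \<le> m then g (free_gen j) else free_gen j)"

definition loop_generator_values ::
  "(nat \<Rightarrow> (nat fword \<Rightarrow> nat fword) \<Rightarrow> nat \<Rightarrow> nat)
     \<Rightarrow> (nat \<Rightarrow> nat \<Rightarrow> (nat fword \<Rightarrow> nat fword) \<Rightarrow> nat fword \<Rightarrow> nat fword) \<Rightarrow> bool" where
  "loop_generator_values \<rho> \<kappa> \<longleftrightarrow>
     (\<forall>n i. 1 \<le> i \<and> i + 1 \<le> n \<longrightarrow>
        \<rho> n (loop_beta n i) = transpose i (i + 1) \<and>
        \<rho> n (loop_sigma n i) = transpose i (i + 1)) \<and>
     (\<forall>\<tau> \<in> {loop_beta, \<lambda>n i. inv\<^bsub>LB n\<^esub> (loop_beta n i), loop_sigma}.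
        \<forall>n i k. 1 \<le> i \<and> i + 1 \<le> n \<and> 1 \<le> k \<and> k \<le> n \<longrightarrow>
          \<kappa> n k (\<tau> n i) =
            (if k < i then \<tau> (n + 1) (i + 1)
             else if k = i then \<tau> (n + 1) i \<otimes>\<^bsub>LB (n + 1)\<^esub> \<tau> (n + 1) (i + 1)
             else if k = i + 1 then \<tau> (n + 1) (i + 1) \<otimes>\<^bsub>LB (n + 1)\<^esub> \<tau> (n + 1) i
             else \<tau> (n + 1) i))"

end

theory Submission
  imports Defs
begin

text \<open>Why the theorem holds.

  All four families of groups that occur here (mock symmetric, loop braid, symmetric and trivial
  groups) carry cloning systems in which cloning an element \<open>g\<close> at \<open>k\<close> clones the permutation
  \<open>\<rho>(g)\<close> at \<open>k\<close> exactly, also on the two copies of the cloned strand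
  (\<^locale>\<open>cloning_system\<close> plus one equation).  For such a system everything about the Thompson
  group follows formally.  A group element acts on forests by permuting their trees, so the monoid
  \<open>\<F> \<bowtie> G\<close> is a Zappa-Szep product: an action of its generators on pairs of a forest in
  normal form and an element of \<open>G\<close> shows that \<open>E g\<close> determines \<open>E\<close> and \<open>g\<close>.  Forests are
  handled as words in the \<open>\<lambda>\<^sub>k\<close> with a sorted normal form, in which cancellation can be read off
  from the first letter and common multiples come from tiling a rectangle by the squares
  \<open>\<lambda>\<^sub>j\<lambda>\<^sub>i = \<lambda>\<^sub>i\<lambda>\<^bsub>j+1\<^esub>\<close>.  Hence the monoid satisfies Ore's conditions and its right fractions form
  a group.  In it the fractions \<open>E\<^sub>- g E\<^sub>+\<inverse>\<close> with semisimple forests and matching numbers of feet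
  form a subgroup, the fractions \<open>E g E\<inverse>\<close> with \<open>E\<close> fixed form a copy of \<open>G\<^sub>n\<close>, and a surjective
  morphism of cloning systems induces a surjection.  The maps \<open>\<rho>\<^sub>n\<close> are a morphism to the
  symmetric groups and yield \<open>V\<close>; if they are trivial, the map to the trivial groups yields \<open>F\<close>.

  It remains to construct the cloning systems.

  For the mock symmetric groups, maps with the product rule of cloning maps are homomorphisms to a
  wreath product, so they can be prescribed on generators after a check of the relations.  Besides
  cloning, deletion of a strand can be defined in this way; it is a left inverse of cloning and,
  for the last strand, of the inclusion, which gives all the injectivity required.

  Loop braids are treated as automorphisms, without generators.  Such an automorphism sends \<open>x\<^sub>i\<close> to
  \<open>w\<^sub>i\<inverse> x\<^bsub>p i\<^esub> w\<^sub>i\<close>, where \<open>w\<^sub>i\<close> is unique once the exponent sum of \<open>x\<^bsub>p i\<^esub>\<close> in it is required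
  to vanish, because the centraliser of a free generator consists of its powers.  Let \<open>d\<^sub>k\<close> be the
  homomorphism that replaces \<open>x\<^sub>k\<close> by \<open>x\<^sub>k x\<^bsub>k+1\<^esub>\<close> and shifts the later generators.  Cloning at \<open>k\<close>
  applies \<open>d\<^sub>k\<close> to the \<open>w\<^sub>i\<close> and sends the two copies of the generator that goes to a conjugate of
  \<open>x\<^sub>k\<close> to the conjugates of \<open>x\<^sub>k\<close> and \<open>x\<^bsub>k+1\<^esub>\<close> by the same element.  The normalisation is stable
  under composition and under \<open>d\<^sub>k\<close>, and all rules become identities between these data.  The
  pure loop braid groups are the kernels of the \<open>\<rho>\<^sub>n\<close> and form a subsystem.\<close>


section \<open>The maps \<open>\<varsigma>\<^sub>k\<close> on permutations\<close>

lemma perm_clone_id [simp]: "perm_clone k id = id"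
  by (rule ext) (auto simp: perm_clone_def)

lemma perm_clone_less:
  assumes "i < k"
  shows "perm_clone k \<sigma> i = (if \<sigma> i \<le> \<sigma> k then \<sigma> i else \<sigma> i + 1)"
    and "perm_clone i \<sigma> (k + 1) = (if \<sigma> k < \<sigma> i then \<sigma> k else \<sigma> k + 1)"
  using assms by (auto simp: perm_clone_def)

text \<open>Duplicating position \<open>k\<close> of a product duplicates position \<open>k\<close> of the right factor and the
  position to which the right factor moves it in the left factor.  This is rule (1) for symmetric groups.\<close>

lemma perm_clone_comp:
  assumes "inj \<sigma>"
  shows "perm_clone k (\<sigma> \<circ> \<tau>) = perm_clone (\<tau> k) \<sigma> \<circ> perm_clone k \<tau>"
proof
  fix m
  have inj: "\<sigma> a = \<sigma> b \<longleftrightarrow> a = b" for a b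
    using assms by (auto dest: injD)
  show "perm_clone k (\<sigma> \<circ> \<tau>) m = (perm_clone (\<tau> k) \<sigma> \<circ> perm_clone k \<tau>) m"
    using inj[of "\<tau> m" "\<tau> k"] inj[of "\<tau> (m - 1)" "\<tau> k"]
    by (auto simp: perm_clone_def)
qed

lemma perm_clone_perm_clone:
  assumes "k < l" "inj \<sigma>"
  shows "perm_clone k (perm_clone l \<sigma>) = perm_clone (l + 1) (perm_clone k \<sigma>)"
proof
  fix m
  have ne: "\<sigma> a \<noteq> \<sigma> b" if "a \<noteq> b" for a b
    using assms(2) that by (auto dest: injD)
  consider "m = k" | "m < k" | "m = k + 1" | "k + 1 < m" "m < l + 1" | "m = l + 1" "m \<noteq> k + 1" | "m = l + 2" | "l + 2 < m"
    by linarith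
  then show "perm_clone k (perm_clone l \<sigma>) m = perm_clone (l + 1) (perm_clone k \<sigma>) m"
  proof cases
    case 1 then show ?thesis using ne[of k l] assms(1) by (simp add: perm_clone_def)
  next
    case 2 then show ?thesis using ne[of k l] ne[of m k] ne[of m l] assms(1) by (simp add: perm_clone_def)
  next
    case 3 then show ?thesis using ne[of k l] assms(1) by (simp add: perm_clone_def)
  next
    case 4
    moreover from this have "m - 1 \<noteq> k" "m - 1 \<noteq> l" "m - 1 \<le> l" by auto
    ultimately show ?thesis using ne[of k l] ne[of "m - 1" k] ne[of "m - 1" l] assms(1) by (simp add: perm_clone_def)
  next
    case 5 then show ?thesis using ne[of k l] assms(1) by (simp add: perm_clone_def)
  next
    case 6 then show ?thesis using ne[of k l] assms(1) by (simp add: perm_clone_def)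
  next
    case 7
    then obtain j where j: "m = Suc (Suc j)" "l < j"
      by (intro that[of "m - 2"]) auto
    then show ?thesis
      using ne[of k l] ne[of j k] ne[of j l] assms(1) by (simp add: perm_clone_def)
  qed
qed

lemma inj_perm_clone:
  assumes "inj \<sigma>"
  shows "inj (perm_clone k \<sigma>)"
proof (rule linorder_injI)
  fix a b :: nat
  assume "a < b"
  have ne: "\<sigma> a \<noteq> \<sigma> b" if "a \<noteq> b" for a b
    using assms that by (auto dest: injD)
  from \<open>a < b\<close> consider "b \<le> k" | "a \<le> k" "k < b" "a = b - 1" | "a \<le> k" "k < b" "a \<noteq> b - 1" | "k < a"
    by linarith
  then show "perm_clone k \<sigma> a \<noteq> perm_clone k \<sigma> b"
  proof cases
    case 1 then show ?thesis using \<open>a < b\<close> ne[of a b] by (simp add: perm_clone_def)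
  next
    case 2
    then have "a = k" "b = k + 1" by auto
    then show ?thesis by (simp add: perm_clone_def)
  next
    case 3 then show ?thesis using ne[of a "b - 1"] by (simp add: perm_clone_def)
  next
    case 4 then show ?thesis using \<open>a < b\<close> ne[of "a - 1" "b - 1"] by (simp add: perm_clone_def)
  qed
qed

lemma perm_clone_permutes:
  assumes "\<sigma> permutes {1..n}" "1 \<le> k" "k \<le> n"
  shows "perm_clone k \<sigma> permutes {1..n + 1}"
proof -
  have inj: "inj (perm_clone k \<sigma>)"
    using inj_perm_clone permutes_inj[OF assms(1)] by blast
  have in_range: "perm_clone k \<sigma> m \<in> {1..n + 1}" if "m \<in> {1..n + 1}" for m
  proof -
    have k: "\<sigma> k \<in> {1..n}"
      using permutes_in_image[OF assms(1), of k] assms(2,3) by simp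
    show ?thesis
    proof (cases "m \<le> k")
      case True
      then show ?thesis
        using permutes_in_image[OF assms(1), of m] that assms k
        by (auto simp: perm_clone_def)
    next
      case False
      then show ?thesis
        using permutes_in_image[OF assms(1), of "m - 1"] that assms k
        by (auto simp: perm_clone_def)
    qed
  qed
  have inj_on: "inj_on (perm_clone k \<sigma>) {1..n + 1}"
    using inj by (rule inj_on_subset) simp
  have "perm_clone k \<sigma> ` {1..n + 1} = {1..n + 1}"
    by (rule endo_inj_surj[OF _ _ inj_on]) (use in_range in blast)+
  then have bij: "bij_betw (perm_clone k \<sigma>) {1..n + 1} {1..n + 1}"
    using inj_on by (simp add: bij_betw_def)
  show ?thesis
  proof (rule bij_imp_permutes[OF bij])
    fix m
    assume "m \<notin> {1..n + 1}"
    then consider "m = 0" | "m > n + 1" by fastforce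
    then show "perm_clone k \<sigma> m = m"
    proof cases
      case 1
      then show ?thesis
        using permutes_not_in[OF assms(1), of 0] by (simp add: perm_clone_def)
    next
      case 2
      then have "\<sigma> (m - 1) = m - 1"
        by (intro permutes_not_in[OF assms(1)]) auto
      moreover have "\<sigma> k \<in> {1..n}"
        using permutes_in_image[OF assms(1), of k] assms(2,3) by simp
      ultimately show ?thesis
        using 2 assms(3) by (auto simp: perm_clone_def)
    qed
  qed
qed

text \<open>Position \<open>k\<close> and all later ones are fixed, so duplicating it only inserts a fixed position.\<close>

lemma perm_clone_beyond:
  assumes "\<sigma> permutes {1..n}" "n < k"
  shows "perm_clone k \<sigma> = \<sigma>"
proof
  fix m
  have fix_k: "\<sigma> k = k" and fix_beyond: "\<And>m. n < m \<Longrightarrow> \<sigma> m = m"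
    using assms by (auto intro!: permutes_not_in[OF assms(1)])
  have "\<sigma> m \<le> n" if "m \<le> n"
  proof (cases "m = 0")
    case True
    then show ?thesis using permutes_not_in[OF assms(1), of 0] by simp
  next
    case False
    then show ?thesis using permutes_in_image[OF assms(1), of m] that by simp
  qed
  then show "perm_clone k \<sigma> m = \<sigma> m"
    using fix_k fix_beyond[of m] fix_beyond[of "m - 1"] assms(2)
    by (cases "m \<le> n") (auto simp: perm_clone_def)
qed

lemma perm_clone_eq_id:
  assumes "perm_clone k \<sigma> = id"
  shows "\<sigma> = id"
proof
  fix m
  have k: "\<sigma> k = k"
    using fun_cong[OF assms, of k] by (simp add: perm_clone_def)
  show "\<sigma> m = id m"
    using fun_cong[OF assms, of m] fun_cong[OF assms, of "m + 1"] k
    by (cases m k rule: linorder_cases) (simp_all add: perm_clone_def split: if_splits)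
qed


section \<open>Normal forms in the forest monoid\<close>

text \<open>Read from left to right, the relation \<open>\<lambda>\<^sub>j\<lambda>\<^sub>i = \<lambda>\<^sub>i\<lambda>\<^bsub>j+1\<^esub>\<close> for \<open>i < j\<close> sorts words: every
  element of the forest monoid has exactly one word with weakly increasing indices.  The
  function \<open>insert_caret j\<close> is multiplication by \<open>\<lambda>\<^sub>j\<close> on the left in terms of these words.\<close>

fun insert_caret :: "nat \<Rightarrow> nat list \<Rightarrow> nat list" where
  "insert_caret j [] = [j]"
| "insert_caret j (i # w) = (if i < j then i # insert_caret (j + 1) w else j # i # w)"

definition forest_nf :: "nat list \<Rightarrow> nat list" where
  "forest_nf u = foldr insert_caret u []"

text \<open>Multiplication by \<open>\<lambda>\<^sub>k\<close> on the right in terms of normal forms.\<close>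

fun append_caret :: "nat \<Rightarrow> nat list \<Rightarrow> nat list" where
  "append_caret k [] = [k]"
| "append_caret k (i # w) = (if k < i then k # map Suc (i # w) else i # append_caret k w)"

lemma forest_nf_simps [simp]:
  "forest_nf [] = []" "forest_nf (k # u) = insert_caret k (forest_nf u)"
  by (simp_all add: forest_nf_def)

lemma insert_caret_insert_caret:
  "i < j \<Longrightarrow> insert_caret j (insert_caret i w) = insert_caret i (insert_caret (j + 1) w)"
  by (induction w arbitrary: i j) auto

lemma sorted_insert_caret: "sorted w \<Longrightarrow> sorted (insert_caret k w)"
proof (induction w arbitrary: k)
  case (Cons i w)
  have set_insert: "x \<in> set (insert_caret j v) \<Longrightarrow> x \<in> set v \<or> x \<ge> j" for x j v
    by (induction v arbitrary: j) (auto split: if_splits dest: Suc_leD)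
  have "sorted (insert_caret (k + 1) w)"
    using Cons by auto
  moreover have "i \<le> x" if "x \<in> set (insert_caret (k + 1) w)" "i < k" for x
    using set_insert[OF that(1)] Cons.prems that(2) by auto
  ultimately show ?case
    using Cons.prems by auto
qed simp

lemma insert_caret_sorted: "sorted (k # w) \<Longrightarrow> insert_caret k w = k # w"
  by (cases w) auto

lemma forest_nf_forest_nf [simp]: "forest_nf (forest_nf u) = forest_nf u"
proof -
  have "sorted (forest_nf u)"
    by (induction u) (auto simp: sorted_insert_caret)
  moreover have "sorted w \<Longrightarrow> forest_nf w = w" for w
    by (induction w) (auto simp: insert_caret_sorted simp del: insert_caret.simps)
  ultimately show ?thesis by blast
qed

text \<open>Left cancellation: the first letter of \<open>insert_caret k u\<close> is smaller than \<open>k\<close> if it comes from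
  \<open>u\<close>, and otherwise it is the inserted letter \<open>k\<close>.\<close>

lemma insert_caret_inj: "insert_caret k u = insert_caret k v \<Longrightarrow> u = v"
proof (induction u arbitrary: k v)
  case Nil
  then show ?case by (cases v) (auto split: if_splits)
next
  case (Cons i u)
  then show ?case by (cases v) (auto split: if_splits)
qed

lemma insert_caret_map_Suc: "insert_caret (Suc j) (map Suc w) = map Suc (insert_caret j w)"
  by (induction w arbitrary: j) auto

text \<open>Multiplications on different sides commute.  Since both agree on the empty word, it follows that
  \<open>append_caret\<close> indeed is multiplication on the right.\<close>

lemma insert_append_caret:
  "insert_caret j (append_caret k w) = append_caret k (insert_caret j w)"
  by (induction w arbitrary: j) (auto simp: insert_caret_map_Suc)

lemma forest_nf_append_caret: "forest_nf (u @ [k]) = append_caret k (forest_nf u)"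
  by (induction u) (auto simp: insert_append_caret)

lemma append_caret_inj: "append_caret k u = append_caret k v \<Longrightarrow> u = v"
proof (induction u arbitrary: v)
  case Nil
  have "append_caret k w \<noteq> []" for w
    by (cases w) auto
  from this[of "tl v"] show ?case
    using Nil by (cases v) (auto split: if_splits)
next
  case (Cons i u)
  have hd: "append_caret k w \<noteq> [] \<and> hd (append_caret k w) \<le> k" for w
    by (cases w) auto
  show ?case
  proof (cases v)
    case Nil
    then show ?thesis using Cons.prems hd[of u] by (auto split: if_splits)
  next
    case (Cons i' v')
    then show ?thesis
      using Cons.prems Cons.IH[of v'] hd[of u] hd[of v'] 
      by (auto split: if_splits simp: inj_map_eq_map)
        (metis Suc_lessD hd leD lessI list.sel(1) order.strict_trans)+
  qed
qed

lemma forest_nf_append_cong: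
  assumes "forest_nf u = forest_nf u'" "forest_nf v = forest_nf v'"
  shows "forest_nf (u @ v) = forest_nf (u' @ v')"
proof -
  have left: "forest_nf (u @ v) = foldr insert_caret u (forest_nf v)" for u v
    by (simp add: forest_nf_def)
  have right: "forest_nf (u @ v) = fold append_caret v (forest_nf u)" for u v
    by (induction v rule: rev_induct)
      (auto simp: forest_nf_append_caret simp flip: append_assoc)
  show ?thesis
    using assms left[of u v] left[of u v'] right[of u v'] right[of u' v'] by simp
qed

lemma forest_nf_left_cancel: "forest_nf (u @ v) = forest_nf (u @ v') \<Longrightarrow> forest_nf v = forest_nf v'"
  by (induction u) (auto dest: insert_caret_inj)

lemma forest_nf_right_cancel: "forest_nf (u @ v) = forest_nf (u' @ v) \<Longrightarrow> forest_nf u = forest_nf u'"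
  by (induction v rule: rev_induct)
    (auto simp: forest_nf_append_caret simp flip: append_assoc dest: append_caret_inj)

lemma set_insert_caret: "0 < k \<Longrightarrow> set w \<subseteq> {0<..} \<Longrightarrow> set (insert_caret k w) \<subseteq> {0<..}"
  by (induction w arbitrary: k) auto

lemma set_forest_nf: "set u \<subseteq> {0<..} \<Longrightarrow> set (forest_nf u) \<subseteq> {0<..}"
  by (induction u) (use set_insert_caret in auto)

lemma length_forest_nf [simp]: "length (forest_nf u) = length u"
proof -
  have "length (insert_caret k w) = Suc (length w)" for k w
    by (induction w arbitrary: k) auto
  then show ?thesis by (induction u) auto
qed

text \<open>Reading a word as a sequence of splittings of leaves, \<open>m\<close> roots have become \<open>m + r\<close> leaves
  after \<open>r\<close> splittings; the word is rooted in \<open>m\<close> if every splitting affects one of these.\<close>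

fun rooted :: "nat \<Rightarrow> nat list \<Rightarrow> bool" where
  "rooted m [] \<longleftrightarrow> True"
| "rooted m (k # ks) \<longleftrightarrow> 0 < k \<and> k \<le> m \<and> rooted (m + 1) ks"

lemma rooted_append: "rooted m (u @ v) \<longleftrightarrow> rooted m u \<and> rooted (m + length u) v"
  by (induction u arbitrary: m) (auto simp del: rooted.simps(2) simp: rooted.simps)

lemma rooted_positive: "rooted m u \<Longrightarrow> set u \<subseteq> {0<..}"
  by (induction u arbitrary: m) auto

lemma rooted_mono: "rooted m u \<Longrightarrow> m \<le> n \<Longrightarrow> rooted n u"
  by (induction u arbitrary: m n) auto

lemma rooted_exists:
  assumes "set u \<subseteq> {0<..}"
  obtains m where "0 < m" "rooted m u"
proof -
  have "\<exists>m>0. rooted m u"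
    using assms
  proof (induction u)
    case (Cons k u)
    then obtain m where "rooted m u" by auto
    then show ?case
      using Cons.prems by (intro exI[of _ "max m k"]) (auto intro: rooted_mono)
  qed auto
  then show ?thesis using that by blast
qed

text \<open>Two letters \<open>\<lambda>\<^sub>i, \<lambda>\<^sub>j\<close> with \<open>i < j\<close> have the common right multiple
  \<open>\<lambda>\<^sub>j\<lambda>\<^sub>i = \<lambda>\<^sub>i\<lambda>\<^bsub>j+1\<^esub>\<close>, which is reached by one letter on either side; such squares tile a
  rectangle for any two words.\<close>

lemma rooted_common_multiple_letter:
  assumes "0 < k" "k \<le> m" "rooted m v"
  shows "\<exists>x y. rooted (m + 1) x \<and> rooted (m + length v) y \<and> forest_nf (k # x) = forest_nf (v @ y)"
  using assms
proof (induction v arbitrary: m k)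
  case Nil
  then show ?case by (intro exI[of _ "[]"] exI[of _ "[k]"]) auto
next
  case (Cons a v)
  consider "a = k" | "k < a" | "a < k" by linarith
  then show ?case
  proof cases
    case 1
    then show ?thesis
      using Cons.prems by (intro exI[of _ v] exI[of _ "[]"]) auto
  next
    case 2
    obtain x y where xy: "rooted (m + 2) x" "rooted (m + 1 + length v) y"
        "forest_nf (k # x) = forest_nf (v @ y)"
      using Cons.IH[of k "m + 1"] Cons.prems by auto
    have "forest_nf (k # (a + 1) # x) = forest_nf ((a # v) @ y)"
      using 2 xy(3) insert_caret_insert_caret[of k a "forest_nf x"] by simp
    then show ?thesis
      using Cons.prems xy by (intro exI[of _ "(a + 1) # x"] exI[of _ y]) auto
  next
    case 3
    obtain x y where xy: "rooted (m + 2) x" "rooted (m + 1 + length v) y"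
        "forest_nf ((k + 1) # x) = forest_nf (v @ y)"
      using Cons.IH[of "k + 1" "m + 1"] Cons.prems by auto
    have "forest_nf (k # a # x) = forest_nf ((a # v) @ y)"
      using 3 xy(3) insert_caret_insert_caret[of a k "forest_nf x"] by simp
    then show ?thesis
      using Cons.prems xy by (intro exI[of _ "a # x"] exI[of _ y]) auto
  qed
qed

lemma rooted_common_multiple:
  assumes "rooted m u" "rooted m v"
  shows "\<exists>x y. rooted (m + length u) x \<and> rooted (m + length v) y \<and> forest_nf (u @ x) = forest_nf (v @ y)"
  using assms
proof (induction u arbitrary: m v)
  case Nil
  then show ?case by (intro exI[of _ v] exI[of _ "[]"]) auto
next
  case (Cons k u)
  obtain x1 y1 where 1: "rooted (m + 1) x1" "rooted (m + length v) y1"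
      "forest_nf (k # x1) = forest_nf (v @ y1)"
    using rooted_common_multiple_letter[of k m v] Cons.prems by auto
  obtain x2 y2 where 2: "rooted (m + 1 + length u) x2" "rooted (m + 1 + length x1) y2"
      "forest_nf (u @ x2) = forest_nf (x1 @ y2)"
    using Cons.IH[of "m + 1" x1] Cons.prems 1 by auto
  have "length (forest_nf (k # x1)) = length (forest_nf (v @ y1))"
    using 1(3) by simp
  then have len: "1 + length x1 = length v + length y1"
    unfolding length_forest_nf by simp
  have "forest_nf ((k # u) @ x2) = forest_nf ((k # x1) @ y2)"
    using 2(3) by simp
  also have "\<dots> = forest_nf (v @ y1 @ y2)"
    using forest_nf_append_cong[OF 1(3), of y2 y2] by simp
  finally have eq: "forest_nf ((k # u) @ x2) = forest_nf (v @ y1 @ y2)" .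
  have "rooted (m + length v) (y1 @ y2)"
    using 1(2) 2(2) len by (simp add: rooted_append ac_simps flip: len)
  then show ?case
    using 2(1) eq by (intro exI[of _ x2] exI[of _ "y1 @ y2"]) auto
qed

text \<open>Rootedness is what the condition on the feet of a semisimple forest says about words.  For
  the induction it has to be stated for forests that are trivial beyond the first \<open>m\<close> trees.\<close>

lemma forest_of_Cons:
  "0 < i \<Longrightarrow> 0 < k \<Longrightarrow> forest_of (k # ks) i =
     (if i < k then forest_of ks i
      else if i = k then Caret (forest_of ks k) (forest_of ks (k + 1))
      else forest_of ks (i + 1))"
proof -
  assume i: "0 < i" "0 < k"
  have sum: "(\<Sum>j = 1..<i. leaves (caret_forest k j)) = (if k < i then i else i - 1)"
    using i(1)
  proof (induction i rule: nat_induct_non_zero)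
    case 1
    then show ?case using i(2) by simp
  next
    case (Suc i)
    then show ?case using i(2) by (auto simp: caret_forest_def)
  qed
  have caret: "caret_forest k i = (if i = k then Caret Leaf Leaf else Leaf)"
    by (simp add: caret_forest_def)
  show ?thesis
    using i by (auto simp: forest_of_def forest_mult_def sum[simplified] caret)
qed

lemma rooted_iff_forest:
  "set ks \<subseteq> {0<..} \<Longrightarrow>
     (\<forall>i > m. forest_of ks i = Leaf) \<longleftrightarrow> rooted m ks" (is "_ \<Longrightarrow> ?P m ks \<longleftrightarrow> _")
proof (induction ks arbitrary: m)
  case Nil
  then show ?case by (auto simp: forest_of_def)
next
  case (Cons k ks)
  have k: "0 < k" using Cons.prems by auto
  have IH: "?P (m + 1) ks \<longleftrightarrow> rooted (m + 1) ks"
    using Cons.IH[of "m + 1"] Cons.prems by simp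
  show ?case
  proof (cases "k \<le> m")
    case True
    have "?P m (k # ks) \<longleftrightarrow> ?P (m + 1) ks"
    proof
      assume *: "?P m (k # ks)"
      show "?P (m + 1) ks"
      proof (intro allI impI)
        fix i assume "m + 1 < i"
        then show "forest_of ks i = Leaf"
          using *[rule_format, of "i - 1"] k True by (auto simp: forest_of_Cons)
      qed
    next
      assume *: "?P (m + 1) ks"
      then show "?P m (k # ks)"
        using k True by (auto simp: forest_of_Cons)
    qed
    then show ?thesis using IH True k by simp
  next
    case False
    then have "forest_of (k # ks) k \<noteq> Leaf"
      using k by (auto simp: forest_of_Cons)
    then have "\<not> ?P m (k # ks)" using False by (meson not_le)
    then show ?thesis using False by auto
  qed
qed

lemma leaves_forest:
  "rooted m ks \<Longrightarrow> (\<Sum>i = 1..m. leaves (forest_of ks i)) = m + length ks"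
proof (induction ks arbitrary: m)
  case Nil
  then show ?case by (simp add: forest_of_def)
next
  case (Cons k ks)
  then have k: "0 < k" "k \<le> m" by auto
  let ?l = "\<lambda>i. leaves (forest_of ks i)"
  have split: "{1..m} = {1..<k} \<union> {k} \<union> {k + 1..m}" "{1..m + 1} = {1..<k} \<union> {k, k + 1} \<union> {k + 2..m + 1}"
    using k by auto
  have "(\<Sum>i = 1..m. leaves (forest_of (k # ks) i)) =
      (\<Sum>i = 1..<k. ?l i) + (?l k + ?l (k + 1)) + (\<Sum>i = k + 1..m. ?l (i + 1))"
    unfolding split using k
    by (subst sum.union_disjoint; (subst sum.union_disjoint)?) (auto simp: forest_of_Cons)
  also have "(\<Sum>i = k + 1..m. ?l (i + 1)) = (\<Sum>i = k + 2..m + 1. ?l i)"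
    using sum.shift_bounds_cl_nat_ivl[of ?l "k + 1" 1 m] by simp
  also have "(\<Sum>i = 1..<k. ?l i) + (?l k + ?l (k + 1)) + \<dots> = (\<Sum>i = 1..m + 1. ?l i)"
    unfolding split using k
    by (subst sum.union_disjoint; (subst sum.union_disjoint)?) auto
  also have "\<dots> = m + 1 + length ks"
    using Cons.prems by (intro Cons.IH) simp
  finally show ?case by simp
qed

lemma semisimple_iff_rooted:
  assumes "set ks \<subseteq> {0<..}"
  shows "semisimple n ks \<longleftrightarrow> rooted 1 ks \<and> n = length ks + 1"
  using rooted_iff_forest[OF assms, of 1] leaves_forest[of 1 ks]
  by (auto simp: semisimple_def)


section \<open>Monoids given by generators and relations\<close>

lemma word_eq_append:
  assumes "word_eq A R u v" "p \<in> lists A" "q \<in> lists A"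
  shows "word_eq A R (p @ u @ q) (p @ v @ q)"
  using assms(1)
proof induction
  case (refl u)
  then show ?case using assms by (intro word_eq.refl) auto
next
  case (sym u v)
  from sym.IH show ?case by (rule word_eq.sym)
next
  case (trans u v w)
  from trans.IH show ?case by (rule word_eq.trans)
next
  case (rel u v p' q')
  then show ?case
    using assms word_eq.rel[of u v R "p @ p'" A "q' @ q"] by auto
qed

lemma word_eq_append2:
  assumes "word_eq A R u u'" "word_eq A R v v'" "u \<in> lists A" "v' \<in> lists A"
  shows "word_eq A R (u @ v) (u' @ v')"
  using word_eq_append[OF assms(1), of "[]" v'] word_eq_append[OF assms(2), of u "[]"] assms
  by (auto intro: word_eq.trans)

lemma word_class_eq_iff:
  assumes "u \<in> lists A"
  shows "word_class A R u = word_class A R v \<longleftrightarrow> word_eq A R u v"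
  unfolding word_class_def
  using word_eq.refl[OF assms] by (auto intro: word_eq.sym word_eq.trans)

lemma word_eq_map:
  assumes "word_eq A R u v"
    and "\<And>a. a \<in> A \<Longrightarrow> f a \<in> B"
    and "\<And>u v. (u, v) \<in> R \<Longrightarrow> word_eq B S (map f u) (map f v)"
  shows "word_eq B S (map f u) (map f v)"
  using assms(1)
proof induction
  case (refl u)
  then show ?case using assms(2) by (intro word_eq.refl) auto
next
  case (sym u v)
  from sym.IH show ?case by (rule word_eq.sym)
next
  case (trans u v w)
  from trans.IH show ?case by (rule word_eq.trans)
next
  case (rel u v p q)
  then show ?case
    using word_eq_append[OF assms(3)[OF rel(1)], of "map f p" "map f q"] assms(2) by fastforce
qed

text \<open>As the relations only involve generators, a word that is equal to a word in the generators is
  one itself, and the product of classes is well defined.\<close>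

locale presented_monoid =
  fixes A :: "'x set" and R :: "('x list \<times> 'x list) set"
  assumes relations: "R \<subseteq> lists A \<times> lists A"
begin

lemma word_eq_lists: "word_eq A R u v \<Longrightarrow> u \<in> lists A \<and> v \<in> lists A"
  by (induction rule: word_eq.induct) (use relations in auto)

lemma word_class_mult:
  assumes "u \<in> lists A" "v \<in> lists A"
  shows "word_class A R u \<otimes>\<^bsub>monoid_presentation A R\<^esub> word_class A R v = word_class A R (u @ v)"
proof -
  have same: "word_class A R (u' @ v') = word_class A R (u @ v)"
    if "u' \<in> word_class A R u" "v' \<in> word_class A R v" for u' v'
  proof -
    have eq: "word_eq A R u u'" "word_eq A R v v'"
      using that by (auto simp: word_class_def)
    then show ?thesis
      using word_eq_append2[OF eq] word_eq_lists[OF eq(2)] assms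
      by (subst eq_commute) (auto simp: word_class_eq_iff)
  qed
  have "u \<in> word_class A R u" "v \<in> word_class A R v"
    using assms by (auto simp: word_class_def intro: word_eq.refl)
  then have "(\<Union>u' \<in> word_class A R u. \<Union>v' \<in> word_class A R v. word_class A R (u @ v)) = word_class A R (u @ v)"
    by blast
  moreover have "(\<Union>u' \<in> word_class A R u. \<Union>v' \<in> word_class A R v. word_class A R (u' @ v')) =
      (\<Union>u' \<in> word_class A R u. \<Union>v' \<in> word_class A R v. word_class A R (u @ v))"
    by (simp add: same cong: SUP_cong)
  ultimately show ?thesis
    unfolding monoid_presentation_def by simp
qed

lemma word_class_closed: "u \<in> lists A \<Longrightarrow> word_class A R u \<in> carrier (monoid_presentation A R)"
  by (auto simp: monoid_presentation_def)

lemma carrier_cases: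
  assumes "X \<in> carrier (monoid_presentation A R)"
  obtains u where "u \<in> lists A" "X = word_class A R u"
  using assms by (auto simp: monoid_presentation_def)

lemma one_word_class: "\<one>\<^bsub>monoid_presentation A R\<^esub> = word_class A R []"
  by (simp add: monoid_presentation_def)

lemma monoid_monoid_presentation: "monoid (monoid_presentation A R)"
proof (rule monoidI)
  show "X \<otimes>\<^bsub>monoid_presentation A R\<^esub> Y \<in> carrier (monoid_presentation A R)"
    if "X \<in> carrier (monoid_presentation A R)" "Y \<in> carrier (monoid_presentation A R)" for X Y
    using that by (elim carrier_cases) (auto simp: word_class_mult intro!: word_class_closed)
  show "\<one>\<^bsub>monoid_presentation A R\<^esub> \<in> carrier (monoid_presentation A R)"
    by (auto simp: one_word_class intro: word_class_closed)
  show "X \<otimes>\<^bsub>monoid_presentation A R\<^esub> Y \<otimes>\<^bsub>monoid_presentation A R\<^esub> Z =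
      X \<otimes>\<^bsub>monoid_presentation A R\<^esub> (Y \<otimes>\<^bsub>monoid_presentation A R\<^esub> Z)"
    if "X \<in> carrier (monoid_presentation A R)" "Y \<in> carrier (monoid_presentation A R)"
      "Z \<in> carrier (monoid_presentation A R)" for X Y Z
    using that by (elim carrier_cases) (auto simp: word_class_mult)
  show "\<one>\<^bsub>monoid_presentation A R\<^esub> \<otimes>\<^bsub>monoid_presentation A R\<^esub> X = X"
    if "X \<in> carrier (monoid_presentation A R)" for X
    using that by (elim carrier_cases) (auto simp: word_class_mult one_word_class)
  show "X \<otimes>\<^bsub>monoid_presentation A R\<^esub> \<one>\<^bsub>monoid_presentation A R\<^esub> = X"
    if "X \<in> carrier (monoid_presentation A R)" for X
    using that by (elim carrier_cases) (auto simp: word_class_mult one_word_class)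
qed

end


section \<open>Groups of right fractions\<close>

text \<open>Ore's conditions for the existence of a group of right fractions.\<close>

locale ore_monoid = monoid M for M :: "('m, 'b) monoid_scheme" (structure) +
  assumes left_cancel: "\<lbrakk>a \<in> carrier M; b \<in> carrier M; c \<in> carrier M; a \<otimes> b = a \<otimes> c\<rbrakk> \<Longrightarrow> b = c"
    and right_cancel: "\<lbrakk>a \<in> carrier M; b \<in> carrier M; c \<in> carrier M; b \<otimes> a = c \<otimes> a\<rbrakk> \<Longrightarrow> b = c"
    and common_multiple:
      "\<lbrakk>a \<in> carrier M; b \<in> carrier M\<rbrakk> \<Longrightarrow> \<exists>x \<in> carrier M. \<exists>y \<in> carrier M. a \<otimes> x = b \<otimes> y"
begin

definition frac_eq :: "'m \<Rightarrow> 'm \<Rightarrow> 'm \<Rightarrow> 'm \<Rightarrow> bool" where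
  "frac_eq a b c d \<longleftrightarrow> (\<exists>x \<in> carrier M. \<exists>y \<in> carrier M. a \<otimes> x = c \<otimes> y \<and> b \<otimes> x = d \<otimes> y)"

lemma frac_eqI:
  "\<lbrakk>x \<in> carrier M; y \<in> carrier M; a \<otimes> x = c \<otimes> y; b \<otimes> x = d \<otimes> y\<rbrakk> \<Longrightarrow> frac_eq a b c d"
  by (auto simp: frac_eq_def)

lemma frac_eq_refl: "frac_eq a b a b"
  by (auto simp: frac_eq_def)

lemma frac_eq_sym: "frac_eq a b c d \<Longrightarrow> frac_eq c d a b"
  by (auto simp: frac_eq_def) metis

lemma frac_eq_trans:
  assumes "frac_eq a b c d" "frac_eq c d e f"
    and [simp]: "a \<in> carrier M" "b \<in> carrier M" "c \<in> carrier M" "d \<in> carrier M" "e \<in> carrier M" "f \<in> carrier M"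
  shows "frac_eq a b e f"
proof -
  obtain x y where xy [simp]: "x \<in> carrier M" "y \<in> carrier M" "a \<otimes> x = c \<otimes> y" "b \<otimes> x = d \<otimes> y"
    using assms(1) by (auto simp: frac_eq_def)
  obtain u v where uv [simp]: "u \<in> carrier M" "v \<in> carrier M" "c \<otimes> u = e \<otimes> v" "d \<otimes> u = f \<otimes> v"
    using assms(2) by (auto simp: frac_eq_def)
  obtain s t where st [simp]: "s \<in> carrier M" "t \<in> carrier M" "y \<otimes> s = u \<otimes> t"
    using common_multiple[of y u] by auto
  have "a \<otimes> (x \<otimes> s) = c \<otimes> (u \<otimes> t)" "b \<otimes> (x \<otimes> s) = d \<otimes> (u \<otimes> t)"
    by (simp_all add: m_assoc flip: m_assoc[of a] m_assoc[of b] del: st(3)) (simp_all add: m_assoc)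
  then have "a \<otimes> (x \<otimes> s) = e \<otimes> (v \<otimes> t)" "b \<otimes> (x \<otimes> s) = f \<otimes> (v \<otimes> t)"
    by (simp_all flip: m_assoc[of c] m_assoc[of d] m_assoc[of e] m_assoc[of f])
  then show ?thesis by (intro frac_eqI[of "x \<otimes> s" "v \<otimes> t"]) auto
qed

abbreviation frac :: "'m \<Rightarrow> 'm \<Rightarrow> ('m \<times> 'm) set" where
  "frac \<equiv> right_fraction M"

abbreviation Q :: "('m \<times> 'm) set monoid" where
  "Q \<equiv> right_fractions M"

lemma mem_frac: "(c, d) \<in> frac a b \<longleftrightarrow> c \<in> carrier M \<and> d \<in> carrier M \<and> frac_eq a b c d"
  by (simp add: right_fraction_def frac_eq_def)

lemma frac_eq_iff:
  assumes "a \<in> carrier M" "b \<in> carrier M" "c \<in> carrier M" "d \<in> carrier M"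
  shows "frac a b = frac c d \<longleftrightarrow> frac_eq a b c d"
proof
  assume "frac a b = frac c d"
  moreover have "(c, d) \<in> frac c d"
    using assms by (auto simp: mem_frac frac_eq_refl)
  ultimately show "frac_eq a b c d"
    by (metis mem_frac)
next
  assume eq: "frac_eq a b c d"
  have "frac_eq a b e f \<longleftrightarrow> frac_eq c d e f" if "e \<in> carrier M" "f \<in> carrier M" for e f
    using frac_eq_trans[OF eq, of e f] frac_eq_trans[OF frac_eq_sym[OF eq], of e f] assms that by blast
  then show "frac a b = frac c d"
    by (auto simp: mem_frac)
qed

lemma frac_expand:
  assumes "a \<in> carrier M" "b \<in> carrier M" "x \<in> carrier M"
  shows "frac (a \<otimes> x) (b \<otimes> x) = frac a b"
  using assms by (auto simp: frac_eq_iff intro: frac_eqI[of \<one> x])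

text \<open>Independence of the product from representatives.  Both choices of \<open>x\<close> and \<open>y\<close> are
  compared inside a common multiple of all the denominators involved, where the cancellation
  of \<open>c'\<close> yields the equality of the remaining factors.\<close>

lemma frac_mult_well_defined:
  assumes "frac_eq a b a' b'" "frac_eq c d c' d'" "b \<otimes> x = c \<otimes> y" "b' \<otimes> x' = c' \<otimes> y'"
    and M [simp]: "a \<in> carrier M" "b \<in> carrier M" "c \<in> carrier M" "d \<in> carrier M" "x \<in> carrier M" "y \<in> carrier M"
     "a' \<in> carrier M" "b' \<in> carrier M" "c' \<in> carrier M" "d' \<in> carrier M" "x' \<in> carrier M" "y' \<in> carrier M"
  shows "frac_eq (a \<otimes> x) (d \<otimes> y) (a' \<otimes> x') (d' \<otimes> y')"
proof -
  obtain p q where pq: "p \<in> carrier M" "q \<in> carrier M" "a \<otimes> p = a' \<otimes> q" "b \<otimes> p = b' \<otimes> q"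
    using assms(1) by (auto simp: frac_eq_def)
  obtain s t where st: "s \<in> carrier M" "t \<in> carrier M" "c \<otimes> s = c' \<otimes> t" "d \<otimes> s = d' \<otimes> t"
    using assms(2) by (auto simp: frac_eq_def)
  obtain \<alpha> \<gamma> where 1: "\<alpha> \<in> carrier M" "\<gamma> \<in> carrier M" "x \<otimes> \<alpha> = p \<otimes> \<gamma>"
    using common_multiple[of x p] pq by auto
  obtain \<delta> \<beta> where 2: "\<delta> \<in> carrier M" "\<beta> \<in> carrier M" "(q \<otimes> \<gamma>) \<otimes> \<delta> = x' \<otimes> \<beta>"
    using common_multiple[of "q \<otimes> \<gamma>" x'] pq 1 by auto
  obtain \<epsilon> \<zeta> where 3: "\<epsilon> \<in> carrier M" "\<zeta> \<in> carrier M" "(y \<otimes> \<alpha> \<otimes> \<delta>) \<otimes> \<epsilon> = s \<otimes> \<zeta>"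
    using common_multiple[of "y \<otimes> \<alpha> \<otimes> \<delta>" s] st 1 2 by auto
  note [simp] = pq(1,2) st(1,2) 1(1,2) 2(1,2) 3(1,2)
  have x: "e \<otimes> (x \<otimes> \<alpha> \<otimes> \<delta>) = e' \<otimes> (x' \<otimes> \<beta>)"
    if [simp]: "e \<in> carrier M" "e' \<in> carrier M" and "e \<otimes> p = e' \<otimes> q" for e e'
  proof -
    have "e \<otimes> (x \<otimes> \<alpha> \<otimes> \<delta>) = (e \<otimes> p) \<otimes> (\<gamma> \<otimes> \<delta>)"
      using 1(3) by (simp add: m_assoc)
    also have "\<dots> = e' \<otimes> (q \<otimes> \<gamma> \<otimes> \<delta>)"
      unfolding that(3) by (simp add: m_assoc)
    finally show ?thesis unfolding 2(3) .
  qed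
  have "c' \<otimes> (y' \<otimes> \<beta> \<otimes> \<epsilon>) = (b' \<otimes> x') \<otimes> (\<beta> \<otimes> \<epsilon>)"
    unfolding assms(4) by (simp add: m_assoc)
  also have "\<dots> = (b \<otimes> (x \<otimes> \<alpha> \<otimes> \<delta>)) \<otimes> \<epsilon>"
    unfolding x[OF _ _ pq(4), simplified] by (simp add: m_assoc)
  also have "\<dots> = (b \<otimes> x) \<otimes> (\<alpha> \<otimes> \<delta> \<otimes> \<epsilon>)"
    by (simp add: m_assoc)
  also have "\<dots> = c \<otimes> ((y \<otimes> \<alpha> \<otimes> \<delta>) \<otimes> \<epsilon>)"
    unfolding assms(3) by (simp add: m_assoc)
  also have "\<dots> = (c \<otimes> s) \<otimes> \<zeta>"
    unfolding 3(3) by (simp add: m_assoc)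
  also have "\<dots> = c' \<otimes> (t \<otimes> \<zeta>)"
    unfolding st(3) by (simp add: m_assoc)
  finally have y: "y' \<otimes> \<beta> \<otimes> \<epsilon> = t \<otimes> \<zeta>"
    by (rule left_cancel[rotated 3]) auto
  have "d \<otimes> y \<otimes> (\<alpha> \<otimes> \<delta> \<otimes> \<epsilon>) = d \<otimes> ((y \<otimes> \<alpha> \<otimes> \<delta>) \<otimes> \<epsilon>)"
    by (simp add: m_assoc)
  also have "\<dots> = (d \<otimes> s) \<otimes> \<zeta>"
    unfolding 3(3) by (simp add: m_assoc)
  also have "\<dots> = d' \<otimes> (t \<otimes> \<zeta>)"
    unfolding st(4) by (simp add: m_assoc)
  also have "\<dots> = d' \<otimes> y' \<otimes> (\<beta> \<otimes> \<epsilon>)"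
    unfolding y[symmetric] by (simp add: m_assoc)
  finally have "d \<otimes> y \<otimes> (\<alpha> \<otimes> \<delta> \<otimes> \<epsilon>) = d' \<otimes> y' \<otimes> (\<beta> \<otimes> \<epsilon>)" .
  moreover have "a \<otimes> x \<otimes> (\<alpha> \<otimes> \<delta> \<otimes> \<epsilon>) = (a \<otimes> (x \<otimes> \<alpha> \<otimes> \<delta>)) \<otimes> \<epsilon>"
    by (simp add: m_assoc)
  then have "a \<otimes> x \<otimes> (\<alpha> \<otimes> \<delta> \<otimes> \<epsilon>) = a' \<otimes> x' \<otimes> (\<beta> \<otimes> \<epsilon>)"
    unfolding x[OF _ _ pq(3), simplified] by (simp add: m_assoc)
  ultimately show ?thesis
    by (intro frac_eqI[of "\<alpha> \<otimes> \<delta> \<otimes> \<epsilon>" "\<beta> \<otimes> \<epsilon>"]) auto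
qed

lemma frac_mult:
  assumes M: "a \<in> carrier M" "b \<in> carrier M" "c \<in> carrier M" "d \<in> carrier M" "x \<in> carrier M" "y \<in> carrier M"
    and "b \<otimes> x = c \<otimes> y"
  shows "frac a b \<otimes>\<^bsub>Q\<^esub> frac c d = frac (a \<otimes> x) (d \<otimes> y)"
proof -
  let ?S = "{frac (a' \<otimes> x') (d' \<otimes> y') |a' b' c' d' x' y'. (a', b') \<in> frac a b \<and> (c', d') \<in> frac c d \<and>
               x' \<in> carrier M \<and> y' \<in> carrier M \<and> b' \<otimes> x' = c' \<otimes> y'}"
  have "X = frac (a \<otimes> x) (d \<otimes> y)" if X_mem: "X \<in> ?S" for X
  proof -
    obtain a' b' c' d' x' y' where X: "X = frac (a' \<otimes> x') (d' \<otimes> y')" "(a', b') \<in> frac a b" "(c', d') \<in> frac c d"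
        "x' \<in> carrier M" "y' \<in> carrier M" "b' \<otimes> x' = c' \<otimes> y'"
      using X_mem by blast
    have "frac_eq (a \<otimes> x) (d \<otimes> y) (a' \<otimes> x') (d' \<otimes> y')"
      using X M assms(7) frac_mult_well_defined[of a b a' b' c d c' d' x y x' y'] by (auto simp: mem_frac)
    then show ?thesis
      using X M by (auto simp: frac_eq_iff mem_frac intro: frac_eq_sym)
  qed
  moreover have "frac (a \<otimes> x) (d \<otimes> y) \<in> ?S"
    using M assms(7) by (force simp: mem_frac frac_eq_refl)
  ultimately have "?S = {frac (a \<otimes> x) (d \<otimes> y)}" by blast
  then show ?thesis
    unfolding right_fractions_def by simp
qed

lemma frac_closed: "a \<in> carrier M \<Longrightarrow> b \<in> carrier M \<Longrightarrow> frac a b \<in> carrier Q"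
  by (auto simp: right_fractions_def)

lemma fraction_cases:
  assumes "X \<in> carrier Q"
  obtains a b where "a \<in> carrier M" "b \<in> carrier M" "X = frac a b"
  using assms by (auto simp: right_fractions_def)

lemma one_frac: "\<one>\<^bsub>Q\<^esub> = frac \<one> \<one>"
  by (simp add: right_fractions_def)

lemma frac_self: "a \<in> carrier M \<Longrightarrow> frac a a = \<one>\<^bsub>Q\<^esub>"
  using frac_expand[of \<one> \<one> a] by (simp add: one_frac)

theorem group_right_fractions: "group Q"
proof (rule groupI)
  fix X Y
  assume "X \<in> carrier Q" "Y \<in> carrier Q"
  then obtain a b c d where X: "X = frac a b" "Y = frac c d"
    and [simp]: "a \<in> carrier M" "b \<in> carrier M" "c \<in> carrier M" "d \<in> carrier M"
    by (metis fraction_cases)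
  obtain x y where xy: "x \<in> carrier M" "y \<in> carrier M" "b \<otimes> x = c \<otimes> y"
    using common_multiple[of b c] by auto
  then show "X \<otimes>\<^bsub>Q\<^esub> Y \<in> carrier Q"
    by (auto simp: X frac_mult[of _ _ _ _ x y] intro: frac_closed)
  fix Z
  assume "Z \<in> carrier Q"
  then obtain e f where Z: "Z = frac e f" and [simp]: "e \<in> carrier M" "f \<in> carrier M"
    by (metis fraction_cases)
  note [simp] = xy(1,2)
  obtain z w where zw: "z \<in> carrier M" "w \<in> carrier M" "(d \<otimes> y) \<otimes> z = e \<otimes> w"
    using common_multiple[of "d \<otimes> y" e] by auto
  note [simp] = zw(1,2)
  have "X \<otimes>\<^bsub>Q\<^esub> Y \<otimes>\<^bsub>Q\<^esub> Z = frac (a \<otimes> x \<otimes> z) (f \<otimes> w)"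
    using xy zw by (simp add: X Z frac_mult[of _ _ _ _ x y] frac_mult[of _ _ _ _ z w])
  moreover have "Y \<otimes>\<^bsub>Q\<^esub> Z = frac (c \<otimes> (y \<otimes> z)) (f \<otimes> w)"
    using zw unfolding X Z by (intro frac_mult) (auto simp: m_assoc)
  moreover have "X \<otimes>\<^bsub>Q\<^esub> frac (c \<otimes> (y \<otimes> z)) (f \<otimes> w) = frac (a \<otimes> (x \<otimes> z)) (f \<otimes> w \<otimes> \<one>)"
    unfolding X by (rule frac_mult) (use xy in \<open>auto simp flip: m_assoc\<close>)
  ultimately show "X \<otimes>\<^bsub>Q\<^esub> Y \<otimes>\<^bsub>Q\<^esub> Z = X \<otimes>\<^bsub>Q\<^esub> (Y \<otimes>\<^bsub>Q\<^esub> Z)"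
    by (simp add: m_assoc)
next
  show "\<one>\<^bsub>Q\<^esub> \<in> carrier Q"
    by (simp add: one_frac frac_closed)
next
  fix X
  assume "X \<in> carrier Q"
  then obtain a b where X: "X = frac a b" and [simp]: "a \<in> carrier M" "b \<in> carrier M"
    by (metis fraction_cases)
  show "\<one>\<^bsub>Q\<^esub> \<otimes>\<^bsub>Q\<^esub> X = X"
    unfolding one_frac X by (subst frac_mult[of _ _ _ _ a \<one>]) auto
  have "frac b a \<otimes>\<^bsub>Q\<^esub> X = \<one>\<^bsub>Q\<^esub>"
    unfolding X by (subst frac_mult[of _ _ _ _ \<one> \<one>]) (auto simp: frac_self)
  then show "\<exists>Y \<in> carrier Q. Y \<otimes>\<^bsub>Q\<^esub> X = \<one>\<^bsub>Q\<^esub>"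
    using frac_closed[of b a] by auto
qed

lemma inv_frac:
  assumes "a \<in> carrier M" "b \<in> carrier M"
  shows "inv\<^bsub>Q\<^esub> (frac a b) = frac b a"
proof -
  have "frac b a \<otimes>\<^bsub>Q\<^esub> frac a b = \<one>\<^bsub>Q\<^esub>"
    using assms by (subst frac_mult[of _ _ _ _ \<one> \<one>]) (auto simp: frac_self)
  then show ?thesis
    using assms group.inv_equality[OF group_right_fractions] by (auto intro: frac_closed)
qed

end

text \<open>A homomorphism between such monoids extends to fractions.\<close>

definition frac_map :: "('m, 'b) monoid_scheme \<Rightarrow> ('k \<Rightarrow> 'm) \<Rightarrow> ('k \<times> 'k) set \<Rightarrow> ('m \<times> 'm) set" where
  "frac_map M' f X = (\<Union>(a, b) \<in> X. right_fraction M' (f a) (f b))"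

lemma frac_map_frac:
  assumes "ore_monoid M" "ore_monoid M'" "f \<in> hom M M'" "a \<in> carrier M" "b \<in> carrier M"
  shows "frac_map M' f (right_fraction M a b) = right_fraction M' (f a) (f b)"
proof -
  interpret M: ore_monoid M by fact
  interpret M': ore_monoid M' by fact
  have same: "right_fraction M' (f c) (f d) = right_fraction M' (f a) (f b)"
    if cd: "(c, d) \<in> right_fraction M a b" for c d
  proof -
    from cd have c: "c \<in> carrier M" "d \<in> carrier M" "M.frac_eq a b c d"
      by (auto simp: M.mem_frac)
    then obtain x y where xy: "x \<in> carrier M" "y \<in> carrier M" "a \<otimes>\<^bsub>M\<^esub> x = c \<otimes>\<^bsub>M\<^esub> y" "b \<otimes>\<^bsub>M\<^esub> x = d \<otimes>\<^bsub>M\<^esub> y"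
      by (auto simp: M.frac_eq_def)
    have "f a \<otimes>\<^bsub>M'\<^esub> f x = f c \<otimes>\<^bsub>M'\<^esub> f y" "f b \<otimes>\<^bsub>M'\<^esub> f x = f d \<otimes>\<^bsub>M'\<^esub> f y"
      using arg_cong[OF xy(3), of f] arg_cong[OF xy(4), of f] assms c xy(1,2)
      by (simp_all add: hom_mult[OF assms(3)])
    then have "M'.frac_eq (f a) (f b) (f c) (f d)"
      using assms(3) xy by (intro M'.frac_eqI[of "f x" "f y"]) (auto dest: hom_in_carrier)
    then show ?thesis
      using assms c by (subst eq_commute, subst M'.frac_eq_iff) (auto dest: hom_in_carrier)
  qed
  have "(a, b) \<in> right_fraction M a b"
    using assms by (simp add: M.mem_frac M.frac_eq_refl)
  then have "(\<Union>(c, d) \<in> right_fraction M a b. right_fraction M' (f a) (f b)) = right_fraction M' (f a) (f b)"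
    by blast
  moreover have "frac_map M' f (right_fraction M a b) =
      (\<Union>(c, d) \<in> right_fraction M a b. right_fraction M' (f a) (f b))"
    unfolding frac_map_def by (intro SUP_cong refl) (auto simp: same)
  ultimately show ?thesis by simp
qed

lemma frac_map_hom:
  assumes "ore_monoid M" "ore_monoid M'" "f \<in> hom M M'"
  shows "frac_map M' f \<in> hom (right_fractions M) (right_fractions M')"
proof -
  interpret M: ore_monoid M by fact
  interpret M': ore_monoid M' by fact
  have f: "f a \<in> carrier M'" if "a \<in> carrier M" for a
    using assms(3) that by (auto dest: hom_in_carrier)
  show ?thesis
  proof (rule homI)
    fix X assume "X \<in> carrier (right_fractions M)"
    then show "frac_map M' f X \<in> carrier (right_fractions M')"
      by (elim M.fraction_cases) (auto simp: frac_map_frac[OF assms] f intro: M'.frac_closed)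
  next
    fix X Y assume "X \<in> carrier (right_fractions M)" "Y \<in> carrier (right_fractions M)"
    then obtain a b c d where X: "X = M.frac a b" "Y = M.frac c d"
      and c: "a \<in> carrier M" "b \<in> carrier M" "c \<in> carrier M" "d \<in> carrier M"
      by (metis M.fraction_cases)
    obtain x y where xy: "x \<in> carrier M" "y \<in> carrier M" "b \<otimes>\<^bsub>M\<^esub> x = c \<otimes>\<^bsub>M\<^esub> y"
      using M.common_multiple[of b c] c by auto
    then have "f b \<otimes>\<^bsub>M'\<^esub> f x = f c \<otimes>\<^bsub>M'\<^esub> f y"
      using c assms(3) by (metis hom_mult)
    then show "frac_map M' f (X \<otimes>\<^bsub>right_fractions M\<^esub> Y) =
        frac_map M' f X \<otimes>\<^bsub>right_fractions M'\<^esub> frac_map M' f Y"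
      using c xy assms(3)
      by (simp add: X M.frac_mult[of _ _ _ _ x y] frac_map_frac[OF assms] f hom_mult
          M'.frac_mult[of _ _ _ _ "f x" "f y"])
  qed
qed


section \<open>The monoid of forests and a group acting on them\<close>

text \<open>What remains of a cloning system after passing to the direct limit.  By the last assumption
  both positions of a cloned strand are mapped as \<open>\<varsigma>\<^sub>k\<close> prescribes, so that \<open>g\<close> acts on forests by
  permuting their trees and never exchanges the two sides of a caret.\<close>

locale bzs_product = group L for L :: "('g, 'b) monoid_scheme" (structure) +
  fixes r :: "'g \<Rightarrow> nat \<Rightarrow> nat" and c :: "nat \<Rightarrow> 'g \<Rightarrow> 'g"
  assumes r_positive: "\<lbrakk>g \<in> carrier L; 0 < k\<rbrakk> \<Longrightarrow> 0 < r g k"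
    and r_mult: "\<lbrakk>g \<in> carrier L; h \<in> carrier L; 0 < k\<rbrakk> \<Longrightarrow> r (g \<otimes> h) k = r g (r h k)"
    and r_one: "0 < k \<Longrightarrow> r \<one> k = k"
    and c_closed: "\<lbrakk>g \<in> carrier L; 0 < k\<rbrakk> \<Longrightarrow> c k g \<in> carrier L"
    and c_inj: "0 < k \<Longrightarrow> inj_on (c k) (carrier L)"
    and c_mult: "\<lbrakk>g \<in> carrier L; h \<in> carrier L; 0 < k\<rbrakk> \<Longrightarrow> c k (g \<otimes> h) = c (r h k) g \<otimes> c k h"
    and c_c: "\<lbrakk>g \<in> carrier L; 0 < k; k < l\<rbrakk> \<Longrightarrow> c k (c l g) = c (l + 1) (c k g)"
    and r_c: "\<lbrakk>g \<in> carrier L; 0 < k; 0 < i\<rbrakk> \<Longrightarrow> r (c k g) i = perm_clone k (r g) i"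
begin

abbreviation "gens \<equiv> bzs_generators L"
abbreviation "rels \<equiv> bzs_relations L r c"
abbreviation "M \<equiv> monoid_presentation gens rels"
abbreviation "cls \<equiv> word_class gens rels"

sublocale presented_monoid gens rels
  by unfold_locales (auto simp: bzs_relations_def bzs_generators_def Suc_le_eq r_positive c_closed)

sublocale M: monoid M
  by (rule monoid_monoid_presentation)

lemma r_inj:
  assumes "g \<in> carrier L" "0 < k" "0 < l" "r g k = r g l"
  shows "k = l"
proof -
  have "r (inv g) (r g i) = i" if "0 < i" for i
    using assms that r_mult[of "inv g" g i] by (simp add: r_one)
  then show ?thesis using assms by metis
qed

lemma c_one: "0 < k \<Longrightarrow> c k \<one> = \<one>"
  using c_mult[of \<one> \<one> k] by (simp add: r_one c_closed)

text \<open>Moving a group element to the right through a word in the \<open>\<lambda>\<^sub>k\<close> changes both of them: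
  \<open>g\<lambda>\<^sub>u = \<lambda>\<^bsub>act g u\<^esub> (clone g u)\<close>.\<close>

fun act :: "'g \<Rightarrow> nat list \<Rightarrow> nat list" where
  "act g [] = []"
| "act g (k # u) = r g k # act (c k g) u"

fun clone :: "'g \<Rightarrow> nat list \<Rightarrow> 'g" where
  "clone g [] = g"
| "clone g (k # u) = clone (c k g) u"

lemma length_act [simp]: "length (act g u) = length u"
  by (induction u arbitrary: g) auto

lemma clone_closed: "g \<in> carrier L \<Longrightarrow> set u \<subseteq> {0<..} \<Longrightarrow> clone g u \<in> carrier L"
  by (induction u arbitrary: g) (auto simp: c_closed)

lemma set_act: "g \<in> carrier L \<Longrightarrow> set u \<subseteq> {0<..} \<Longrightarrow> set (act g u) \<subseteq> {0<..}"
proof (induction u arbitrary: g)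
  case (Cons k u)
  then show ?case using r_positive[of g k] Cons.IH[of "c k g"] c_closed[of g k] by auto
qed simp

lemma act_clone_one: "set u \<subseteq> {0<..} \<Longrightarrow> act \<one> u = u \<and> clone \<one> u = \<one>"
  by (induction u) (auto simp: r_one c_one)

lemma act_clone_mult:
  "\<lbrakk>g \<in> carrier L; h \<in> carrier L; set u \<subseteq> {0<..}\<rbrakk> \<Longrightarrow>
     act (g \<otimes> h) u = act g (act h u) \<and> clone (g \<otimes> h) u = clone g (act h u) \<otimes> clone h u"
proof (induction u arbitrary: g h)
  case (Cons k u)
  then show ?case
    using Cons.IH[of "c (r h k) g" "c k h"] by (auto simp: r_mult c_mult c_closed r_positive)
qed simp

text \<open>The action and the cloning respect \<open>\<lambda>\<^sub>j\<lambda>\<^sub>i = \<lambda>\<^sub>i\<lambda>\<^bsub>j+1\<^esub>\<close>: if \<open>g\<close> preserves the order of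
  \<open>i < j\<close>, the two sides are mapped to the two sides of such a relation, and otherwise to these
  sides in the other order.\<close>

lemma act_clone_insert_caret:
  assumes "g \<in> carrier L" "0 < k" "set u \<subseteq> {0<..}"
  shows "forest_nf (act g (insert_caret k u)) = forest_nf (act g (k # u)) \<and>
         clone g (insert_caret k u) = clone g (k # u)"
  using assms
proof (induction u arbitrary: g k)
  case (Cons i u)
  then have i: "0 < i" by simp
  note [simp] = Cons.prems(1)
  show ?case
  proof (cases "i < k")
    case True
    have IH: "forest_nf (act (c i g) (insert_caret (k + 1) u)) = forest_nf (act (c i g) ((k + 1) # u))"
      "clone (c i g) (insert_caret (k + 1) u) = clone (c i g) ((k + 1) # u)"
      using Cons.IH[of "c i g" "k + 1"] Cons.prems i by (auto simp: c_closed)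
    have cc: "c i (c k g) = c (k + 1) (c i g)"
      using c_c[of g i k] i True by simp
    have r: "r (c i g) (k + 1) = (if r g k < r g i then r g k else r g k + 1)"
      "r (c k g) i = (if r g i \<le> r g k then r g i else r g i + 1)"
      using True i Cons.prems r_c[of g i "k + 1"] r_c[of g k i] perm_clone_less[OF True, of "r g"]
      by auto
    have "r g i \<noteq> r g k"
      using r_inj[of g i k] True i Cons.prems by auto
    then have "insert_caret (r g i) (insert_caret (r (c i g) (k + 1)) w) =
        insert_caret (r g k) (insert_caret (r (c k g) i) w)" for w
      using insert_caret_insert_caret[of "r g i" "r g k" w] insert_caret_insert_caret[of "r g k" "r g i" w]
      by (cases "r g i" "r g k" rule: linorder_cases) (auto simp: r[simplified])
    then show ?thesis
      using True IH cc by simp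
  next
    case False
    then show ?thesis by simp
  qed
qed simp

lemma act_clone_forest_nf:
  assumes "g \<in> carrier L" "set u \<subseteq> {0<..}"
  shows "forest_nf (act g (forest_nf u)) = forest_nf (act g u) \<and> clone g (forest_nf u) = clone g u"
  using assms
proof (induction u arbitrary: g)
  case (Cons k u)
  then show ?case
    using act_clone_insert_caret[of g k "forest_nf u"] Cons.IH[of "c k g"] set_forest_nf[of u]
    by (auto simp: c_closed)
qed simp

text \<open>The element \<open>\<lambda>\<^sub>u g\<close>.  Every element of the monoid has this form, and \<open>u\<close> is unique up to the
  relations between forests.\<close>

definition elt :: "nat list \<Rightarrow> 'g \<Rightarrow> 'g generator list set" where
  "elt u g = cls (map Lambda u @ [Grp g])"

lemma Grp_in_gens [simp]: "Grp g \<in> gens \<longleftrightarrow> g \<in> carrier L"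
  by (auto simp: bzs_generators_def)

lemma Lambda_in_gens [simp]: "Lambda k \<in> gens \<longleftrightarrow> 0 < k"
  by (auto simp: bzs_generators_def Suc_le_eq)

lemma map_Lambda_lists [simp]: "map Lambda u \<in> lists gens \<longleftrightarrow> set u \<subseteq> {0<..}"
  by (induction u) auto

lemma elt_closed: "set u \<subseteq> {0<..} \<Longrightarrow> g \<in> carrier L \<Longrightarrow> elt u g \<in> carrier M"
  unfolding elt_def by (intro word_class_closed) auto

lemma relation: "(u, v) \<in> rels \<Longrightarrow> word_eq gens rels u v"
  using word_eq.rel[of u v rels "[]" gens "[]"] by simp

lemma cls_Lambda: "set u \<subseteq> {0<..} \<Longrightarrow> cls (map Lambda u) = elt u \<one>"
proof -
  assume u: "set u \<subseteq> {0<..}"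
  have "word_eq gens rels [Grp \<one>] []"
    by (rule relation) (auto simp: bzs_relations_def)
  from word_eq_append[OF this, of "map Lambda u" "[]"] show ?thesis
    unfolding elt_def using u by (subst word_class_eq_iff) (auto intro: word_eq.sym)
qed

lemma Grp_Lambda:
  "g \<in> carrier L \<Longrightarrow> set u \<subseteq> {0<..} \<Longrightarrow>
     word_eq gens rels (Grp g # map Lambda u) (map Lambda (act g u) @ [Grp (clone g u)])"
proof (induction u arbitrary: g)
  case Nil
  then show ?case by (auto intro: word_eq.refl)
next
  case (Cons k u)
  have "word_eq gens rels [Grp g, Lambda k] [Lambda (r g k), Grp (c k g)]"
    using Cons.prems by (intro relation) (auto simp: bzs_relations_def)
  from word_eq_append[OF this, of "[]" "map Lambda u"]
  have "word_eq gens rels (Grp g # Lambda k # map Lambda u) (Lambda (r g k) # Grp (c k g) # map Lambda u)"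
    using Cons.prems by simp
  moreover from word_eq_append[OF Cons.IH[of "c k g"], of "[Lambda (r g k)]" "[]"]
  have "word_eq gens rels (Lambda (r g k) # Grp (c k g) # map Lambda u)
      (Lambda (r g k) # map Lambda (act (c k g) u) @ [Grp (clone (c k g) u)])"
    using Cons.prems r_positive[of g k] by (auto simp: c_closed)
  ultimately show ?case by (auto intro: word_eq.trans)
qed

lemma elt_mult:
  assumes "set u \<subseteq> {0<..}" "set v \<subseteq> {0<..}" "g \<in> carrier L" "h \<in> carrier L"
  shows "elt u g \<otimes>\<^bsub>M\<^esub> elt v h = elt (u @ act g v) (clone g v \<otimes> h)"
proof -
  have gv: "set (act g v) \<subseteq> {0<..}" "clone g v \<in> carrier L"
    using assms set_act clone_closed by auto
  have 1: "word_eq gens rels (map Lambda u @ (Grp g # map Lambda v) @ [Grp h])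
      (map Lambda u @ (map Lambda (act g v) @ [Grp (clone g v)]) @ [Grp h])"
    using assms by (intro word_eq_append Grp_Lambda) auto
  have "word_eq gens rels [Grp (clone g v), Grp h] [Grp (clone g v \<otimes> h)]"
    using assms gv by (intro relation) (auto simp: bzs_relations_def)
  from word_eq_append[OF this, of "map Lambda (u @ act g v)" "[]"]
  have "word_eq gens rels (map Lambda (u @ act g v) @ [Grp (clone g v), Grp h])
      (map Lambda (u @ act g v) @ [Grp (clone g v \<otimes> h)])"
    using assms gv by (auto simp del: map_append simp flip: append_assoc)
  with 1 have "word_eq gens rels ((map Lambda u @ [Grp g]) @ (map Lambda v @ [Grp h]))
      (map Lambda (u @ act g v) @ [Grp (clone g v \<otimes> h)])"
    by (auto intro: word_eq.trans)
  then show ?thesis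
    unfolding elt_def using assms by (subst word_class_mult) (auto simp: word_class_eq_iff)
qed

lemma elt_one: "\<one>\<^bsub>M\<^esub> = elt [] \<one>"
  using cls_Lambda[of "[]"] by (simp add: one_word_class)

lemma elt_split: "set u \<subseteq> {0<..} \<Longrightarrow> 0 < k \<Longrightarrow> g \<in> carrier L \<Longrightarrow> elt (k # u) g = elt [k] \<one> \<otimes>\<^bsub>M\<^esub> elt u g"
  by (subst elt_mult) (auto simp: act_clone_one)

lemma elt_cases:
  assumes "X \<in> carrier M"
  obtains u g where "set u \<subseteq> {0<..}" "g \<in> carrier L" "X = elt u g"
proof -
  have "\<exists>u g. set u \<subseteq> {0<..} \<and> g \<in> carrier L \<and> cls w = elt u g" if "w \<in> lists gens" for w
    using that
  proof induction
    case Nil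
    show ?case by (intro exI[of _ "[]"] exI[of _ \<one>]) (simp add: elt_one flip: one_word_class)
  next
    case (Cons a w)
    then obtain u g where IH: "set u \<subseteq> {0<..}" "g \<in> carrier L" "cls w = elt u g" by auto
    have "\<exists>v h. set v \<subseteq> {0<..} \<and> h \<in> carrier L \<and> cls [a] = elt v h"
    proof (cases a)
      case (Lambda k)
      then show ?thesis
        using Cons.hyps(1) cls_Lambda[of "[k]"] by (intro exI[of _ "[k]"] exI[of _ \<one>]) auto
    next
      case (Grp h)
      then show ?thesis
        using Cons.hyps(1) by (intro exI[of _ "[]"] exI[of _ h]) (auto simp: elt_def)
    qed
    then obtain v h where a: "set v \<subseteq> {0<..}" "h \<in> carrier L" "cls [a] = elt v h" by auto
    have "cls (a # w) = elt v h \<otimes>\<^bsub>M\<^esub> elt u g"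
      using Cons.hyps word_class_mult[of "[a]" w] IH a by simp
    then have "cls (a # w) = elt (v @ act h u) (clone h u \<otimes> g)"
      using IH a by (simp add: elt_mult)
    moreover have "set (v @ act h u) \<subseteq> {0<..}" "clone h u \<otimes> g \<in> carrier L"
      using IH a set_act[of h u] clone_closed[of h u] by auto
    ultimately show ?case by blast
  qed
  then show ?thesis
    using assms that by (metis carrier_cases)
qed

text \<open>Generators act on the pairs of a forest in normal form and a group element in the way they
  would multiply the element of \<open>M\<close> that the pair stands for.  All relations hold for this
  action, which shows that different pairs stand for different elements.\<close>

fun step :: "'g generator \<Rightarrow> nat list \<times> 'g \<Rightarrow> nat list \<times> 'g" where
  "step (Lambda k) (u, x) = (insert_caret k u, x)"
| "step (Grp g) (u, x) = (forest_nf (act g u), clone g u \<otimes> x)"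

definition states :: "(nat list \<times> 'g) set" where
  "states = {(u, x). forest_nf u = u \<and> set u \<subseteq> {0<..} \<and> x \<in> carrier L}"

lemma step_states: "a \<in> gens \<Longrightarrow> z \<in> states \<Longrightarrow> step a z \<in> states"
proof (cases a; cases z)
  fix k u x
  assume "a \<in> gens" "z \<in> states" "a = Lambda k" "z = (u, x)"
  then show "step a z \<in> states"
    using forest_nf_forest_nf[of "k # u"] set_insert_caret[of k u] by (auto simp: states_def)
next
  fix g u x
  assume "a \<in> gens" "z \<in> states" "a = Grp g" "z = (u, x)"
  then show "step a z \<in> states"
    using set_act[of g u] clone_closed[of g u] set_forest_nf[of "act g u"] by (auto simp: states_def)
qed

lemma foldr_step_states: "w \<in> lists gens \<Longrightarrow> z \<in> states \<Longrightarrow> foldr step w z \<in> states"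
  by (induction w) (auto simp: step_states)

lemma step_relation:
  assumes "(v, w) \<in> rels" "z \<in> states"
  shows "foldr step v z = foldr step w z"
proof -
  obtain u x where z: "z = (u, x)" "forest_nf u = u" "set u \<subseteq> {0<..}" "x \<in> carrier L"
    using assms(2) by (auto simp: states_def)
  from assms(1) consider
      (forest) i j where "v = [Lambda j, Lambda i]" "w = [Lambda i, Lambda (j + 1)]" "0 < i" "i < j"
    | (mult) g h where "v = [Grp g, Grp h]" "w = [Grp (g \<otimes> h)]" "g \<in> carrier L" "h \<in> carrier L"
    | (one) "v = [Grp \<one>]" "w = []"
    | (push) g k where "v = [Grp g, Lambda k]" "w = [Lambda (r g k), Grp (c k g)]" "g \<in> carrier L" "0 < k"
    unfolding bzs_relations_def One_nat_def Suc_le_eq by blast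
  then show ?thesis
  proof cases
    case forest
    then show ?thesis by (simp add: z insert_caret_insert_caret)
  next
    case mult
    have "set (act h u) \<subseteq> {0<..}"
      using set_act mult z by auto
    then show ?thesis
      using mult z act_clone_mult[of g h u] act_clone_forest_nf[of g "act h u"]
        clone_closed[of g "act h u"] clone_closed[of h u]
      by (auto simp: m_assoc)
  next
    case one
    then show ?thesis
      using z act_clone_one[of u] by simp
  next
    case push
    then show ?thesis
      using z act_clone_insert_caret[of g k u] by simp
  qed
qed

lemma word_eq_step: "word_eq gens rels v w \<Longrightarrow> z \<in> states \<Longrightarrow> foldr step v z = foldr step w z"
  by (induction rule: word_eq.induct) (auto simp: step_relation foldr_step_states)

lemma foldr_step_elt:
  "g \<in> carrier L \<Longrightarrow> foldr step (map Lambda u @ [Grp g]) ([], \<one>) = (forest_nf u, g)"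
  by (induction u) auto

text \<open>Sorting a word only uses relations between forests.\<close>

lemma elt_forest_nf:
  assumes "set u \<subseteq> {0<..}" "g \<in> carrier L"
  shows "elt (forest_nf u) g = elt u g"
proof -
  have swap: "elt [i, j + 1] \<one> = elt [j, i] \<one>" if "0 < i" "i < j" for i j
  proof -
    have "word_eq gens rels [Lambda j, Lambda i] [Lambda i, Lambda (j + 1)]"
      using that by (intro relation) (auto simp: bzs_relations_def)
    then have "cls (map Lambda [j, i]) = cls (map Lambda [i, j + 1])"
      using that by (subst word_class_eq_iff) auto
    then show ?thesis
      using that cls_Lambda[of "[j, i]"] cls_Lambda[of "[i, j + 1]"] by auto
  qed
  have insert: "elt (insert_caret k u) g = elt (k # u) g" if "0 < k" "set u \<subseteq> {0<..}" for k u
    using that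
  proof (induction u arbitrary: k)
    case (Cons i u)
    then have i: "0 < i" by simp
    show ?case
    proof (cases "i < k")
      case True
      have "elt (insert_caret k (i # u)) g = elt [i] \<one> \<otimes>\<^bsub>M\<^esub> elt (insert_caret (k + 1) u) g"
        using True Cons.prems assms set_insert_caret[of "k + 1" u] elt_split[of "insert_caret (k + 1) u" i g]
        by simp
      also have "elt (insert_caret (k + 1) u) g = elt ((k + 1) # u) g"
        using Cons by auto
      also have "elt [i] \<one> \<otimes>\<^bsub>M\<^esub> elt ((k + 1) # u) g = elt [i, k + 1] \<one> \<otimes>\<^bsub>M\<^esub> elt u g"
        using Cons.prems assms by (auto simp: elt_mult act_clone_one simp del: act.simps clone.simps)
      also have "\<dots> = elt (k # i # u) g"
        using Cons.prems assms unfolding swap[OF i True] by (simp add: elt_mult act_clone_one)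
      finally show ?thesis .
    qed simp
  qed simp
  show ?thesis
    using assms(1)
  proof (induction u)
    case (Cons k u)
    then have "elt (forest_nf (k # u)) g = elt [k] \<one> \<otimes>\<^bsub>M\<^esub> elt (forest_nf u) g"
      using set_forest_nf[of u] assms elt_split[of "forest_nf u" k g] by (simp add: insert)
    then show ?case
      using Cons assms elt_split[of u k g] by simp
  qed simp
qed

lemma elt_eq_iff:
  assumes "set u \<subseteq> {0<..}" "g \<in> carrier L" "set v \<subseteq> {0<..}" "h \<in> carrier L"
  shows "elt u g = elt v h \<longleftrightarrow> forest_nf u = forest_nf v \<and> g = h"
proof
  assume "elt u g = elt v h"
  then have "word_eq gens rels (map Lambda u @ [Grp g]) (map Lambda v @ [Grp h])"
    unfolding elt_def using assms by (subst (asm) word_class_eq_iff) auto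
  then have "foldr step (map Lambda u @ [Grp g]) ([], \<one>) = foldr step (map Lambda v @ [Grp h]) ([], \<one>)"
    by (rule word_eq_step) (simp add: states_def)
  then show "forest_nf u = forest_nf v \<and> g = h"
    using assms unfolding foldr_step_elt[OF assms(2)] foldr_step_elt[OF assms(4)] by simp
next
  assume "forest_nf u = forest_nf v \<and> g = h"
  then show "elt u g = elt v h"
    using assms elt_forest_nf[of u g] elt_forest_nf[of v h] by simp
qed

lemma act_left_cancel:
  assumes "g \<in> carrier L" "set v \<subseteq> {0<..}" "set v' \<subseteq> {0<..}"
    and "forest_nf (act g v) = forest_nf (act g v')"
  shows "forest_nf v = forest_nf v'"
proof -
  have *: "forest_nf (act (inv g) (forest_nf (act g w))) = forest_nf w" if "set w \<subseteq> {0<..}" for w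
    using act_clone_forest_nf[of "inv g" "act g w"] act_clone_mult[of "inv g" g w] that assms(1)
      set_act[of g w] act_clone_one[of w] by simp
  show ?thesis
    using *[of v] *[of v'] assms by simp
qed

lemma clone_inj:
  assumes "g \<in> carrier L" "h \<in> carrier L" "set u \<subseteq> {0<..}" "clone g u = clone h u"
  shows "g = h"
  using assms
proof (induction u arbitrary: g h)
  case (Cons k u)
  then have "c k g = c k h"
    using Cons.IH[of "c k g" "c k h"] by (auto simp: c_closed)
  then show ?case
    using Cons.prems c_inj[of k] by (auto dest: inj_onD)
qed simp

lemma elt_mult_inv:
  assumes "set w \<subseteq> {0<..}" "set z \<subseteq> {0<..}" "f \<in> carrier L"
  shows "elt w f \<otimes>\<^bsub>M\<^esub> (elt [] (inv f) \<otimes>\<^bsub>M\<^esub> elt z \<one>) = elt (w @ z) \<one>"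
proof -
  have "elt w f \<otimes>\<^bsub>M\<^esub> (elt [] (inv f) \<otimes>\<^bsub>M\<^esub> elt z \<one>) = (elt w f \<otimes>\<^bsub>M\<^esub> elt [] (inv f)) \<otimes>\<^bsub>M\<^esub> elt z \<one>"
    using assms by (intro M.m_assoc[symmetric]) (auto simp: elt_closed)
  then show ?thesis
    using assms by (simp add: elt_mult act_clone_one)
qed

text \<open>Cancellation is inherited from the forests and the group.  Common multiples exist because
  group elements can be removed on the right, which leaves two forests.\<close>

sublocale M: ore_monoid M
proof unfold_locales
  fix X Y Z
  assume "X \<in> carrier M" "Y \<in> carrier M" "Z \<in> carrier M"
  then obtain u g v h w f where X: "X = elt u g" "Y = elt v h" "Z = elt w f"
    and set [simp]: "set u \<subseteq> {0<..}" "set v \<subseteq> {0<..}" "set w \<subseteq> {0<..}"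
    and L [simp]: "g \<in> carrier L" "h \<in> carrier L" "f \<in> carrier L"
    by (metis elt_cases)
  note [simp] = set_act clone_closed
  show "Y = Z" if "X \<otimes>\<^bsub>M\<^esub> Y = X \<otimes>\<^bsub>M\<^esub> Z"
  proof -
    have eq: "forest_nf (u @ act g v) = forest_nf (u @ act g w)" "clone g v \<otimes> h = clone g w \<otimes> f"
      using that unfolding X by (simp_all add: elt_mult elt_eq_iff)
    have nf: "forest_nf v = forest_nf w"
      using forest_nf_left_cancel[OF eq(1)] by (rule act_left_cancel[rotated 3]) auto
    moreover have "clone g v = clone g w"
      using nf act_clone_forest_nf[of g v] act_clone_forest_nf[of g w] by simp
    ultimately show ?thesis
      using eq(2) unfolding X by (simp add: elt_eq_iff)
  qed
  show "Y = Z" if "Y \<otimes>\<^bsub>M\<^esub> X = Z \<otimes>\<^bsub>M\<^esub> X"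
  proof -
    have eq: "forest_nf (v @ act h u) = forest_nf (w @ act f u)" "clone h u \<otimes> g = clone f u \<otimes> g"
      using that unfolding X by (simp_all add: elt_mult elt_eq_iff)
    then have "h = f"
      using clone_inj[of h f u] by simp
    then show ?thesis
      using eq(1) unfolding X by (auto simp: elt_eq_iff dest: forest_nf_right_cancel)
  qed
next
  fix X Y
  assume "X \<in> carrier M" "Y \<in> carrier M"
  then obtain u g v h where X: "X = elt u g" "Y = elt v h"
    and set [simp]: "set u \<subseteq> {0<..}" "set v \<subseteq> {0<..}"
    and L [simp]: "g \<in> carrier L" "h \<in> carrier L"
    by (metis elt_cases)
  obtain m n where "rooted m u" "rooted n v"
    using rooted_exists[OF set(1)] rooted_exists[OF set(2)] by metis
  then have "rooted (max m n) u" "rooted (max m n) v"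
    by (auto intro: rooted_mono)
  then obtain x y where xy: "forest_nf (u @ x) = forest_nf (v @ y)" "set x \<subseteq> {0<..}" "set y \<subseteq> {0<..}"
    using rooted_common_multiple[of "max m n" u v] rooted_positive by blast
  have "X \<otimes>\<^bsub>M\<^esub> (elt [] (inv g) \<otimes>\<^bsub>M\<^esub> elt x \<one>) = Y \<otimes>\<^bsub>M\<^esub> (elt [] (inv h) \<otimes>\<^bsub>M\<^esub> elt y \<one>)"
    using xy unfolding X by (simp add: elt_mult_inv elt_eq_iff)
  moreover have "elt [] (inv g) \<otimes>\<^bsub>M\<^esub> elt x \<one> \<in> carrier M" "elt [] (inv h) \<otimes>\<^bsub>M\<^esub> elt y \<one> \<in> carrier M"
    using xy by (simp_all add: elt_closed)
  ultimately show "\<exists>x \<in> carrier M. \<exists>y \<in> carrier M. X \<otimes>\<^bsub>M\<^esub> x = Y \<otimes>\<^bsub>M\<^esub> y"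
    by blast
qed

end


section \<open>Thompson subgroups\<close>

text \<open>The subgroups \<open>H n\<close> stand for the images of the groups \<open>G\<^sub>n\<close> in their direct limit.\<close>

locale filtered_bzs_product = bzs_product +
  fixes H :: "nat \<Rightarrow> 'a set"
  assumes H_subgroup: "0 < n \<Longrightarrow> subgroup (H n) L"
    and r_le: "\<lbrakk>g \<in> H n; 0 < k; k \<le> n\<rbrakk> \<Longrightarrow> r g k \<le> n"
    and c_H: "\<lbrakk>g \<in> H n; 0 < k; k \<le> n\<rbrakk> \<Longrightarrow> c k g \<in> H (Suc n)"
begin

lemma H_carrier: "0 < n \<Longrightarrow> g \<in> H n \<Longrightarrow> g \<in> carrier L"
  using H_subgroup subgroup.mem_carrier by metis

lemma rooted_act_clone:
  "\<lbrakk>0 < n; g \<in> H n; rooted n u\<rbrakk> \<Longrightarrow> rooted n (act g u) \<and> clone g u \<in> H (n + length u)"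
proof (induction u arbitrary: n g)
  case (Cons k u)
  then show ?case
    using Cons.IH[of "Suc n" "c k g"] r_positive[OF H_carrier, of n g k] by (auto simp: r_le c_H)
qed simp

definition thompson_carrier where
  "thompson_carrier = {M.frac (elt u g) (elt v \<one>) |u v g.
     rooted 1 u \<and> rooted 1 v \<and> length u = length v \<and> g \<in> H (Suc (length u))}"

lemma thompson_carrierI:
  "\<lbrakk>rooted 1 u; rooted 1 v; length u = length v; g \<in> H (Suc (length u))\<rbrakk> \<Longrightarrow>
     M.frac (elt u g) (elt v \<one>) \<in> thompson_carrier"
  unfolding thompson_carrier_def by blast

text \<open>A product \<open>(E\<^sub>- g E\<^sub>+\<inverse>) (E'\<^sub>- h E'\<^sub>+\<inverse>)\<close> is computed from a common multiple
  \<open>E\<^sub>+ x = E'\<^sub>- y\<close> with forests \<open>x\<close> and \<open>y\<close> that have carets only on the feet of \<open>E\<^sub>+\<close> and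
  \<open>E'\<^sub>-\<close>; moving \<open>g\<close> through \<open>x\<close> and \<open>h\<inverse>\<close> through \<open>y\<close> keeps the numbers of feet.\<close>

lemma subgroup_thompson_carrier: "subgroup thompson_carrier M.Q"
proof (rule subgroup.intro)
  show "thompson_carrier \<subseteq> carrier M.Q"
  proof
    fix X
    assume "X \<in> thompson_carrier"
    then obtain u v g where X: "X = M.frac (elt u g) (elt v \<one>)" "rooted 1 u" "rooted 1 v" "g \<in> H (Suc (length u))"
      by (auto simp: thompson_carrier_def)
    then have "set u \<subseteq> {0<..}" "set v \<subseteq> {0<..}" "g \<in> carrier L"
      using rooted_positive[OF X(2)] rooted_positive[OF X(3)] H_carrier[of _ g] by auto
    then show "X \<in> carrier M.Q"
      unfolding X(1) by (intro M.frac_closed elt_closed) auto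
  qed
  show "\<one>\<^bsub>M.Q\<^esub> \<in> thompson_carrier"
    using subgroup.one_closed[OF H_subgroup[of 1]]
    by (auto simp: thompson_carrier_def M.one_frac elt_one intro!: exI[of _ "[]"])
next
  fix X Y
  assume "X \<in> thompson_carrier" "Y \<in> thompson_carrier"
  then obtain u v g u' v' h where X: "X = M.frac (elt u g) (elt v \<one>)" "Y = M.frac (elt u' h) (elt v' \<one>)"
    and rooted: "rooted 1 u" "rooted 1 v" "rooted 1 u'" "rooted 1 v'"
    and len: "length u = length v" "length u' = length v'"
    and H: "g \<in> H (Suc (length u))" "h \<in> H (Suc (length u'))"
    by (auto simp: thompson_carrier_def)
  have set [simp]: "set u \<subseteq> {0<..}" "set v \<subseteq> {0<..}" "set u' \<subseteq> {0<..}" "set v' \<subseteq> {0<..}"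
    using rooted rooted_positive by blast+
  have L [simp]: "g \<in> carrier L" "h \<in> carrier L"
    using H H_carrier by auto
  obtain x y where xy: "rooted (1 + length v) x" "rooted (1 + length u') y" "forest_nf (v @ x) = forest_nf (u' @ y)"
    using rooted_common_multiple[OF rooted(2,3)] by blast
  have [simp]: "set x \<subseteq> {0<..}" "set y \<subseteq> {0<..}"
    using xy rooted_positive by blast+
  note [simp] = set_act clone_closed elt_closed
  have "length (forest_nf (v @ x)) = length (forest_nf (u' @ y))"
    using xy by simp
  then have len': "length v + length x = length u' + length y"
    unfolding length_forest_nf by simp
  have h': "inv h \<in> H (Suc (length u'))"
    using subgroup.m_inv_closed[OF H_subgroup H(2)] by simp
  define f where "f = clone g x \<otimes> inv (clone (inv h) y)"
  have g_x: "rooted (1 + length u) (act g x)" "clone g x \<in> H (1 + length u + length x)"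
    using rooted_act_clone[of "1 + length u" g x] H xy len by auto
  have h_y: "rooted (1 + length u') (act (inv h) y)" "clone (inv h) y \<in> H (1 + length u' + length y)"
    using rooted_act_clone[of "1 + length u'" "inv h" y] h' xy len by auto
  have f: "f \<in> H (length u + length x + 1)"
    using g_x h_y len len' subgroup.m_closed[OF H_subgroup] subgroup.m_inv_closed[OF H_subgroup]
    by (simp add: f_def add.commute)
  have "X = M.frac (elt u g \<otimes>\<^bsub>M\<^esub> elt x \<one>) (elt v \<one> \<otimes>\<^bsub>M\<^esub> elt x \<one>)"
    unfolding X by (subst M.frac_expand) auto
  moreover have "Y = M.frac (elt u' h \<otimes>\<^bsub>M\<^esub> (elt [] (inv h) \<otimes>\<^bsub>M\<^esub> elt y \<one>)) (elt v' \<one> \<otimes>\<^bsub>M\<^esub> (elt [] (inv h) \<otimes>\<^bsub>M\<^esub> elt y \<one>))"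
    unfolding X by (subst M.frac_expand) auto
  moreover have "elt u' h \<otimes>\<^bsub>M\<^esub> (elt [] (inv h) \<otimes>\<^bsub>M\<^esub> elt y \<one>) = elt v \<one> \<otimes>\<^bsub>M\<^esub> elt x \<one>"
    using xy(3) by (subst elt_mult_inv) (simp_all add: elt_mult act_clone_one elt_eq_iff)
  ultimately have "X \<otimes>\<^bsub>M.Q\<^esub> Y =
      M.frac (elt u g \<otimes>\<^bsub>M\<^esub> elt x \<one>) (elt v' \<one> \<otimes>\<^bsub>M\<^esub> (elt [] (inv h) \<otimes>\<^bsub>M\<^esub> elt y \<one>))"
    by (simp add: M.frac_mult[of _ _ _ _ "\<one>\<^bsub>M\<^esub>" "\<one>\<^bsub>M\<^esub>"])
  also have "\<dots> = M.frac (elt (u @ act g x) (clone g x)) (elt (v' @ act (inv h) y) (clone (inv h) y))"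
    by (simp add: elt_mult act_clone_one)
  also have "\<dots> = M.frac (elt (u @ act g x) (clone g x) \<otimes>\<^bsub>M\<^esub> elt [] (inv (clone (inv h) y)))
      (elt (v' @ act (inv h) y) (clone (inv h) y) \<otimes>\<^bsub>M\<^esub> elt [] (inv (clone (inv h) y)))"
    by (subst M.frac_expand) auto
  also have "\<dots> = M.frac (elt (u @ act g x) f) (elt (v' @ act (inv h) y) \<one>)"
    by (simp add: elt_mult f_def)
  finally have prod: "X \<otimes>\<^bsub>M.Q\<^esub> Y = M.frac (elt (u @ act g x) f) (elt (v' @ act (inv h) y) \<one>)" .
  have "rooted 1 (u @ act g x)" "rooted 1 (v' @ act (inv h) y)"
    using rooted g_x h_y len by (simp_all add: rooted_append)
  then show "X \<otimes>\<^bsub>M.Q\<^esub> Y \<in> thompson_carrier"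
    unfolding prod using f len len' by (intro thompson_carrierI) auto
next
  fix X
  assume "X \<in> thompson_carrier"
  then obtain u v g where X: "X = M.frac (elt u g) (elt v \<one>)"
    and rooted: "rooted 1 u" "rooted 1 v" and len: "length u = length v" and H: "g \<in> H (Suc (length u))"
    by (auto simp: thompson_carrier_def)
  have [simp]: "set u \<subseteq> {0<..}" "set v \<subseteq> {0<..}" "g \<in> carrier L"
    using rooted_positive[OF rooted(1)] rooted_positive[OF rooted(2)] H_carrier[OF _ H] by auto
  have "inv\<^bsub>M.Q\<^esub> X = M.frac (elt v \<one> \<otimes>\<^bsub>M\<^esub> elt [] (inv g)) (elt u g \<otimes>\<^bsub>M\<^esub> elt [] (inv g))"
    unfolding X by (simp add: M.inv_frac M.frac_expand elt_closed)
  also have "\<dots> = M.frac (elt v (inv g)) (elt u \<one>)"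
    by (simp add: elt_mult)
  finally have inv: "inv\<^bsub>M.Q\<^esub> X = M.frac (elt v (inv g)) (elt u \<one>)" .
  show "inv\<^bsub>M.Q\<^esub> X \<in> thompson_carrier"
    unfolding inv using rooted len H subgroup.m_inv_closed[OF H_subgroup[of "Suc (length u)"] H]
    by (intro thompson_carrierI) auto
qed

text \<open>The elements \<open>E g E\<inverse>\<close> for a fixed semisimple forest \<open>E\<close> with \<open>n\<close> feet form a copy of
  \<open>H n\<close>.\<close>

definition embed :: "nat \<Rightarrow> 'a \<Rightarrow> _" where
  "embed n g = (let u = replicate (n - 1) (Suc 0) in M.frac (elt u g) (elt u \<one>))"

lemma rooted_replicate: "0 < m \<Longrightarrow> rooted m (replicate n (Suc 0))"
  by (induction n arbitrary: m) auto

lemma embed_thompson: "0 < n \<Longrightarrow> g \<in> H n \<Longrightarrow> embed n g \<in> thompson_carrier"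
  unfolding embed_def Let_def by (intro thompson_carrierI) (auto simp: rooted_replicate)

lemma embed_mult:
  assumes "g \<in> carrier L" "h \<in> carrier L"
  shows "embed n (g \<otimes> h) = embed n g \<otimes>\<^bsub>M.Q\<^esub> embed n h"
proof -
  define u where "u = replicate (n - 1) (Suc 0)"
  have u [simp]: "set u \<subseteq> {0<..}" by (auto simp: u_def)
  have "embed n g \<otimes>\<^bsub>M.Q\<^esub> embed n h = M.frac (elt u g \<otimes>\<^bsub>M\<^esub> elt [] h) (elt u \<one> \<otimes>\<^bsub>M\<^esub> elt [] \<one>)"
    unfolding embed_def Let_def u_def[symmetric] using assms
    by (intro M.frac_mult) (simp_all add: elt_closed elt_mult)
  then show ?thesis
    unfolding embed_def Let_def u_def[symmetric] using assms by (simp add: elt_mult)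
qed

lemma embed_inj:
  assumes "g \<in> carrier L" "h \<in> carrier L" "embed n g = embed n h"
  shows "g = h"
proof -
  define u :: "nat list" where "u = replicate (n - 1) (Suc 0)"
  have u [simp]: "set u \<subseteq> {0<..}" by (auto simp: u_def)
  have "M.frac_eq (elt u g) (elt u \<one>) (elt u h) (elt u \<one>)"
    using assms unfolding embed_def Let_def u_def[symmetric] by (simp add: elt_closed M.frac_eq_iff)
  then obtain x y where xy: "x \<in> carrier M" "y \<in> carrier M" "elt u g \<otimes>\<^bsub>M\<^esub> x = elt u h \<otimes>\<^bsub>M\<^esub> y" "elt u \<one> \<otimes>\<^bsub>M\<^esub> x = elt u \<one> \<otimes>\<^bsub>M\<^esub> y"
    by (auto simp: M.frac_eq_def)
  have "x = y"
    using M.left_cancel[OF _ xy(1,2,4)] by (simp add: elt_closed)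
  then have "elt u g = elt u h"
    using M.right_cancel[of x "elt u g" "elt u h"] xy assms by (simp add: elt_closed)
  then show ?thesis
    using assms by (simp add: elt_eq_iff)
qed

end

text \<open>A homomorphism of the groups that is compatible with permutations and cloning acts on words
  letter by letter.\<close>

locale bzs_morphism = source: bzs_product L r c + target: bzs_product L' r' c'
  for L :: "('g, 'b) monoid_scheme" and r c and L' :: "('h, 'd) monoid_scheme" and r' c' +
  fixes \<phi> :: "'g \<Rightarrow> 'h"
  assumes \<phi>_hom: "\<phi> \<in> hom L L'"
    and r_\<phi>: "\<lbrakk>g \<in> carrier L; 0 < k\<rbrakk> \<Longrightarrow> r' (\<phi> g) k = r g k"
    and c_\<phi>: "\<lbrakk>g \<in> carrier L; 0 < k\<rbrakk> \<Longrightarrow> c' k (\<phi> g) = \<phi> (c k g)"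
begin

definition monoid_map :: "'g generator list set \<Rightarrow> 'h generator list set" where
  "monoid_map X = (\<Union>w \<in> X. target.cls (map (map_generator \<phi>) w))"

lemma \<phi>_one: "\<phi> \<one>\<^bsub>L\<^esub> = \<one>\<^bsub>L'\<^esub>"
  using \<phi>_hom hom_one source.is_group target.is_group by blast

lemma map_generator_closed: "a \<in> source.gens \<Longrightarrow> map_generator \<phi> a \<in> target.gens"
  using \<phi>_hom by (cases a) (auto dest: hom_in_carrier)

lemma word_eq_map_generator:
  assumes "word_eq source.gens source.rels v w"
  shows "word_eq target.gens target.rels (map (map_generator \<phi>) v) (map (map_generator \<phi>) w)"
  using assms
proof (rule word_eq_map)
  show "map_generator \<phi> a \<in> target.gens" if "a \<in> source.gens" for a
    using that by (rule map_generator_closed)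
next
  fix v w
  assume "(v, w) \<in> source.rels"
  then have "(map (map_generator \<phi>) v, map (map_generator \<phi>) w) \<in> target.rels"
    unfolding bzs_relations_def
    using \<phi>_hom
    by (elim UnE) (auto simp: hom_mult \<phi>_one r_\<phi> c_\<phi> hom_in_carrier)
  then show "word_eq target.gens target.rels (map (map_generator \<phi>) v) (map (map_generator \<phi>) w)"
    by (rule target.relation)
qed

lemma monoid_map_cls:
  assumes "w \<in> lists source.gens"
  shows "monoid_map (source.cls w) = target.cls (map (map_generator \<phi>) w)"
proof -
  have lists: "map (map_generator \<phi>) v \<in> lists target.gens" if "v \<in> lists source.gens" for v
    using that map_generator_closed by auto
  have "target.cls (map (map_generator \<phi>) v) = target.cls (map (map_generator \<phi>) w)"
    if "v \<in> source.cls w" for v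
    using that word_eq_map_generator[of w v] lists[OF assms]
    by (subst eq_commute) (simp add: word_class_def[of source.gens] word_class_eq_iff)
  moreover have "w \<in> source.cls w"
    using assms by (simp add: word_class_def word_eq.refl)
  ultimately show ?thesis
    unfolding monoid_map_def by blast
qed

lemma monoid_map_elt:
  assumes "set u \<subseteq> {0<..}" "g \<in> carrier L"
  shows "monoid_map (source.elt u g) = target.elt u (\<phi> g)"
  unfolding source.elt_def target.elt_def
  using assms by (subst monoid_map_cls) (auto simp: comp_def)

lemma monoid_map_hom: "monoid_map \<in> hom source.M target.M"
proof (rule homI)
  have lists: "map (map_generator \<phi>) v \<in> lists target.gens" if "v \<in> lists source.gens" for v
    using that map_generator_closed by auto
  show "monoid_map X \<in> carrier target.M" if X: "X \<in> carrier source.M" for X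
    using X by (elim source.carrier_cases) (simp add: monoid_map_cls lists target.word_class_closed)
  show "monoid_map (X \<otimes>\<^bsub>source.M\<^esub> Y) = monoid_map X \<otimes>\<^bsub>target.M\<^esub> monoid_map Y"
    if X: "X \<in> carrier source.M" and Y: "Y \<in> carrier source.M" for X Y
  proof -
    obtain u v where "u \<in> lists source.gens" "v \<in> lists source.gens" "X = source.cls u" "Y = source.cls v"
      using X Y source.carrier_cases by metis
    then show ?thesis
      using lists[of u] lists[of v]
      by (simp add: source.word_class_mult target.word_class_mult monoid_map_cls)
  qed
qed

abbreviation fraction_map where
  "fraction_map \<equiv> frac_map target.M monoid_map"

lemma fraction_map_hom: "fraction_map \<in> hom source.M.Q target.M.Q"
  by (intro frac_map_hom monoid_map_hom source.M.ore_monoid_axioms target.M.ore_monoid_axioms)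

lemma fraction_map_frac:
  assumes "set u \<subseteq> {0<..}" "set v \<subseteq> {0<..}" "g \<in> carrier L"
  shows "fraction_map (source.M.frac (source.elt u g) (source.elt v \<one>\<^bsub>L\<^esub>)) =
         target.M.frac (target.elt u (\<phi> g)) (target.elt v \<one>\<^bsub>L'\<^esub>)"
  using assms
  by (subst frac_map_frac[OF source.M.ore_monoid_axioms target.M.ore_monoid_axioms monoid_map_hom])
    (auto simp: source.elt_closed monoid_map_elt \<phi>_one)

end


section \<open>Direct limits of cloning systems\<close>

lemma the_elem_image_case_prod:
  assumes "p \<in> A" "\<And>m h. (m, h) \<in> A \<Longrightarrow> f m h = b"
  shows "the_elem ((\<lambda>(m, h). f m h) ` A) = b"
proof (rule the_elem_image_unique)
  show "(case q of (m, h) \<Rightarrow> f m h) = b" if "q \<in> A" for q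
    using that by (cases q) (simp only: case_prod_conv, rule assms(2))
qed (use assms(1) in blast)

text \<open>Rule (3) is required at the positions of the cloned strand as well.  This makes the maps
  \<open>\<rho>\<^sub>n\<close> a morphism to the cloning system of the symmetric groups.\<close>

locale exact_cloning_system = cloning_system +
  assumes rho_clone_exact:
    "\<lbrakk>1 \<le> k; k \<le> n; g \<in> carrier (G n)\<rbrakk> \<Longrightarrow> \<rho> (n + 1) (\<kappa> n k g) = perm_clone k (\<rho> n g)"
begin

lemma incl_closed: "1 \<le> m \<Longrightarrow> m \<le> n \<Longrightarrow> g \<in> carrier (G m) \<Longrightarrow> \<iota> m n g \<in> carrier (G n)"
  using incl_mon[of m n] by (auto simp: mon_def hom_def)

lemma incl_eq_iff:
  "1 \<le> m \<Longrightarrow> m \<le> n \<Longrightarrow> g \<in> carrier (G m) \<Longrightarrow> h \<in> carrier (G m) \<Longrightarrow> \<iota> m n g = \<iota> m n h \<longleftrightarrow> g = h"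
  using incl_mon[of m n] by (auto simp: mon_def dest: inj_onD)

lemma incl_mult:
  "1 \<le> m \<Longrightarrow> m \<le> n \<Longrightarrow> g \<in> carrier (G m) \<Longrightarrow> h \<in> carrier (G m) \<Longrightarrow>
     \<iota> m n (g \<otimes>\<^bsub>G m\<^esub> h) = \<iota> m n g \<otimes>\<^bsub>G n\<^esub> \<iota> m n h"
  using incl_mon[of m n] by (auto simp: mon_def hom_mult)

lemma group_mult_closed:
  "1 \<le> n \<Longrightarrow> g \<in> carrier (G n) \<Longrightarrow> h \<in> carrier (G n) \<Longrightarrow> g \<otimes>\<^bsub>G n\<^esub> h \<in> carrier (G n)"
  using group[of n] group.is_monoid monoid.m_closed by metis

lemma group_one_closed: "1 \<le> n \<Longrightarrow> \<one>\<^bsub>G n\<^esub> \<in> carrier (G n)"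
  using group[of n] group.is_monoid monoid.one_closed by metis

lemma incl_one: "1 \<le> m \<Longrightarrow> m \<le> n \<Longrightarrow> \<iota> m n \<one>\<^bsub>G m\<^esub> = \<one>\<^bsub>G n\<^esub>"
  using incl_mon[of m n] group[of m] group[of n] by (auto simp: mon_def intro: hom_one)

definition lim :: "nat \<Rightarrow> 'a \<Rightarrow> (nat \<times> 'a) set" where
  "lim = lim_class G \<iota>"

abbreviation L :: "(nat \<times> 'a) set monoid" where
  "L \<equiv> direct_limit G \<iota>"

text \<open>As the maps \<open>\<iota>\<close> are injective, elements that agree at a late stage agree as soon as both are
  defined.\<close>

lemma mem_lim:
  assumes "1 \<le> n" "g \<in> carrier (G n)"
  shows "(m, h) \<in> lim n g \<longleftrightarrow> 1 \<le> m \<and> h \<in> carrier (G m) \<and> \<iota> m (max m n) h = \<iota> n (max m n) g"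
proof -
  have "\<iota> m (max m n) h = \<iota> n (max m n) g"
    if "1 \<le> m" "h \<in> carrier (G m)" "m \<le> l" "n \<le> l" "\<iota> m l h = \<iota> n l g" for l
    using that assms incl_eq_iff[of "max m n" l "\<iota> m (max m n) h" "\<iota> n (max m n) g"]
    by (simp add: incl_trans incl_closed)
  moreover have "m \<le> max m n" "n \<le> max m n" by auto
  ultimately show ?thesis
    unfolding lim_def lim_class_def mem_Collect_eq case_prod_conv by blast
qed

lemma lim_self: "1 \<le> n \<Longrightarrow> g \<in> carrier (G n) \<Longrightarrow> (n, g) \<in> lim n g"
  by (simp add: mem_lim)

lemma lim_incl:
  assumes "1 \<le> n" "n \<le> N" "g \<in> carrier (G n)"
  shows "lim N (\<iota> n N g) = lim n g"
proof -
  have "(m, h) \<in> lim N (\<iota> n N g) \<longleftrightarrow> (m, h) \<in> lim n g" for m h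
  proof (cases "1 \<le> m \<and> h \<in> carrier (G m)")
    case True
    have "\<iota> m (max m N) h = \<iota> n (max m N) g \<longleftrightarrow> \<iota> m (max m n) h = \<iota> n (max m n) g"
      using assms True incl_eq_iff[of "max m n" "max m N" "\<iota> m (max m n) h" "\<iota> n (max m n) g"]
      by (auto simp: incl_trans incl_closed)
    then show ?thesis
      using assms True by (simp add: mem_lim incl_closed incl_trans)
  next
    case False
    then show ?thesis using assms by (auto simp: mem_lim incl_closed)
  qed
  then show ?thesis by auto
qed

lemma lim_eq_iff:
  assumes "1 \<le> n" "g \<in> carrier (G n)" "h \<in> carrier (G n)"
  shows "lim n g = lim n h \<longleftrightarrow> g = h"
proof
  assume "lim n g = lim n h"
  then have "(n, g) \<in> lim n h"
    using lim_self[OF assms(1,2)] by simp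
  then show "g = h"
    using assms by (simp add: mem_lim incl_refl)
qed simp

lemma lim_closed: "1 \<le> n \<Longrightarrow> g \<in> carrier (G n) \<Longrightarrow> lim n g \<in> carrier L"
  by (auto simp: direct_limit_def lim_def)

lemma lim_cases:
  assumes "X \<in> carrier L"
  obtains n g where "1 \<le> n" "g \<in> carrier (G n)" "X = lim n g"
  using assms by (auto simp: direct_limit_def lim_def)

lemma lim_cases2:
  assumes "X \<in> carrier L" "Y \<in> carrier L"
  obtains n g h where "1 \<le> n" "g \<in> carrier (G n)" "h \<in> carrier (G n)" "X = lim n g" "Y = lim n h"
proof -
  obtain m g n h where *: "1 \<le> m" "g \<in> carrier (G m)" "X = lim m g" "1 \<le> n" "h \<in> carrier (G n)" "Y = lim n h"
    using assms by (metis lim_cases)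
  then show ?thesis
    using lim_incl[of m "max m n" g] lim_incl[of n "max m n" h]
    by (intro that[of "max m n" "\<iota> m (max m n) g" "\<iota> n (max m n) h"]) (auto simp: incl_closed)
qed

lemma lim_mult:
  assumes "1 \<le> n" "g \<in> carrier (G n)" "h \<in> carrier (G n)"
  shows "lim n g \<otimes>\<^bsub>L\<^esub> lim n h = lim n (g \<otimes>\<^bsub>G n\<^esub> h)"
proof -
  let ?S = "{lim (max m m') (\<iota> m (max m m') a \<otimes>\<^bsub>G (max m m')\<^esub> \<iota> m' (max m m') b)
                       |m a m' b. (m, a) \<in> lim n g \<and> (m', b) \<in> lim n h}"
  have "lim (max m m') (\<iota> m (max m m') a \<otimes>\<^bsub>G (max m m')\<^esub> \<iota> m' (max m m') b) = lim n (g \<otimes>\<^bsub>G n\<^esub> h)"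
    if a: "(m, a) \<in> lim n g" and b: "(m', b) \<in> lim n h" for m a m' b
  proof -
    define l N where "l = max m m'" and "N = max l n"
    have le: "m \<le> l" "m' \<le> l" "l \<le> N" "n \<le> N" "m \<le> N" "m' \<le> N" "max m n \<le> N" "max m' n \<le> N"
      by (auto simp: l_def N_def)
    have a: "1 \<le> m" "a \<in> carrier (G m)" "\<iota> m (max m n) a = \<iota> n (max m n) g"
      and b: "1 \<le> m'" "b \<in> carrier (G m')" "\<iota> m' (max m' n) b = \<iota> n (max m' n) h"
      using a b assms by (auto simp: mem_lim)
    have "\<iota> m N a = \<iota> n N g" "\<iota> m' N b = \<iota> n N h"
      using incl_trans[of m "max m n" N a] incl_trans[of n "max m n" N g]
        incl_trans[of m' "max m' n" N b] incl_trans[of n "max m' n" N h] a b assms le by auto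
    moreover have "1 \<le> l" using a le by simp
    ultimately have "\<iota> l N (\<iota> m l a \<otimes>\<^bsub>G l\<^esub> \<iota> m' l b) = \<iota> n N (g \<otimes>\<^bsub>G n\<^esub> h)"
      using a b assms le by (simp add: incl_mult incl_closed incl_trans)
    then show ?thesis
      using lim_incl[of l N "\<iota> m l a \<otimes>\<^bsub>G l\<^esub> \<iota> m' l b"] lim_incl[of n N "g \<otimes>\<^bsub>G n\<^esub> h"] \<open>1 \<le> l\<close> a b assms le
      unfolding l_def[symmetric] by (simp add: group_mult_closed incl_closed)
  qed
  then have sub: "?S \<subseteq> {lim n (g \<otimes>\<^bsub>G n\<^esub> h)}"
    by auto
  have "?S \<noteq> {}"
    using lim_self[OF assms(1,2)] lim_self[OF assms(1,3)] by blast
  then have "?S = {lim n (g \<otimes>\<^bsub>G n\<^esub> h)}"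
    by (metis subset_singletonD[OF sub])
  then show ?thesis
    unfolding direct_limit_def lim_def by simp
qed

lemma lim_one:
  assumes "1 \<le> n"
  shows "lim n \<one>\<^bsub>G n\<^esub> = \<one>\<^bsub>L\<^esub>"
  using lim_incl[of 1 n "\<one>\<^bsub>G 1\<^esub>"] assms incl_one[of 1 n] group_one_closed[of 1]
  by (simp add: direct_limit_def lim_def)

lemma lim_rho:
  assumes "1 \<le> n" "g \<in> carrier (G n)"
  shows "lim_rho \<rho> (lim n g) = \<rho> n g"
proof -
  have "\<rho> m h = \<rho> n g" if "(m, h) \<in> lim n g" for m h
    using that assms rho_incl[of m "max m n" h] rho_incl[of n "max m n" g] by (simp add: mem_lim)
  then show ?thesis
    unfolding lim_rho_def by (rule the_elem_image_case_prod[OF lim_self[OF assms]])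
qed

text \<open>With the convention \<open>\<kappa>\<^sup>n\<^sub>k = \<iota>\<^bsub>n,n+1\<^esub>\<close> for \<open>k > n\<close> all rules extend to arbitrary \<open>k\<close>.\<close>

abbreviation \<kappa>' where "\<kappa>' \<equiv> clone_ext \<iota> \<kappa>"

lemma rho_permutes: "1 \<le> n \<Longrightarrow> g \<in> carrier (G n) \<Longrightarrow> \<rho> n g permutes {1..n}"
  using rho_hom[of n] hom_in_carrier sym_group_carrier by metis

lemma rho_beyond: "1 \<le> n \<Longrightarrow> g \<in> carrier (G n) \<Longrightarrow> n < k \<Longrightarrow> \<rho> n g k = k"
  using rho_permutes[of n g] by (auto intro: permutes_not_in)

lemma rho_range: "1 \<le> n \<Longrightarrow> g \<in> carrier (G n) \<Longrightarrow> 1 \<le> k \<Longrightarrow> k \<le> n \<Longrightarrow> 1 \<le> \<rho> n g k \<and> \<rho> n g k \<le> n"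
  using permutes_in_image[OF rho_permutes, of n g k] by auto

lemma clone_ext_closed:
  "1 \<le> n \<Longrightarrow> 1 \<le> k \<Longrightarrow> g \<in> carrier (G n) \<Longrightarrow> \<kappa>' n k g \<in> carrier (G (n + 1))"
  using clone_closed[of k n] incl_closed[of n "n + 1"] by (auto simp: clone_ext_def)

lemma clone_ext_incl:
  assumes "1 \<le> m" "m \<le> n" "1 \<le> k" "g \<in> carrier (G m)"
  shows "\<kappa>' n k (\<iota> m n g) = \<iota> (m + 1) (n + 1) (\<kappa>' m k g)"
  using assms clone_incl[of m n k g]
  by (auto simp: clone_ext_def incl_trans)

lemma clone_ext_mult:
  assumes "1 \<le> n" "1 \<le> k" "g \<in> carrier (G n)" "h \<in> carrier (G n)"
  shows "\<kappa>' n k (g \<otimes>\<^bsub>G n\<^esub> h) = \<kappa>' n (\<rho> n h k) g \<otimes>\<^bsub>G (n + 1)\<^esub> \<kappa>' n k h"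
  using assms clone_mult[of k n g h] rho_range[of n h k] rho_beyond[of n h k] incl_mult[of n "n + 1" g h]
  by (auto simp: clone_ext_def)

lemma clone_ext_clone_ext:
  assumes "1 \<le> n" "1 \<le> k" "k < l" "g \<in> carrier (G n)"
  shows "\<kappa>' (n + 1) k (\<kappa>' n l g) = \<kappa>' (n + 1) (l + 1) (\<kappa>' n k g)"
proof (cases "l \<le> n")
  case True
  then show ?thesis
    using assms clone_clone[of k l n g] by (simp add: clone_ext_def)
next
  case False
  then have "\<kappa>' (n + 1) k (\<kappa>' n l g) = \<iota> (n + 1) (n + 2) (\<kappa>' n k g)"
    using clone_ext_incl[of n "n + 1" k g] assms by (simp add: clone_ext_def[of _ _ n l])
  then show ?thesis
    using False by (simp add: clone_ext_def[of _ _ _ "l + 1"] clone_ext_def[of _ _ _ "Suc l"])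
qed

lemma rho_clone_ext:
  assumes "1 \<le> n" "1 \<le> k" "g \<in> carrier (G n)"
  shows "\<rho> (n + 1) (\<kappa>' n k g) = perm_clone k (\<rho> n g)"
  using assms rho_clone_exact[of k n g] rho_incl[of n "n + 1" g] perm_clone_beyond[OF rho_permutes, of n g k]
  by (auto simp: clone_ext_def)

lemma inj_on_clone_ext: "1 \<le> n \<Longrightarrow> 1 \<le> k \<Longrightarrow> inj_on (\<kappa>' n k) (carrier (G n))"
  using clone_inj[of k n] incl_mon[of n "n + 1"] by (auto simp: clone_ext_def mon_def)

lemma lim_clone:
  assumes "1 \<le> n" "1 \<le> k" "g \<in> carrier (G n)"
  shows "lim_clone G \<iota> \<kappa> k (lim n g) = lim (n + 1) (\<kappa>' n k g)"
proof -
  have "lim (m + 1) (\<kappa>' m k h) = lim (n + 1) (\<kappa>' n k g)" if "(m, h) \<in> lim n g" for m h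
  proof -
    have "1 \<le> m" "h \<in> carrier (G m)" "\<iota> m (max m n) h = \<iota> n (max m n) g"
      using that assms by (auto simp: mem_lim)
    then show ?thesis
      using lim_incl[of "m + 1" "max m n + 1" "\<kappa>' m k h"] lim_incl[of "n + 1" "max m n + 1" "\<kappa>' n k g"]
        clone_ext_incl[of m "max m n" k h] clone_ext_incl[of n "max m n" k g]
        clone_ext_closed[of m k h] clone_ext_closed[of n k g] assms
      by simp
  qed
  then show ?thesis
    unfolding lim_clone_def lim_def[symmetric]
    by (rule the_elem_image_case_prod[OF lim_self[OF assms(1,3)]])
qed

definition H :: "nat \<Rightarrow> (nat \<times> 'a) set set" where
  "H n = lim n ` carrier (G n)"

lemma group_direct_limit: "group L"
proof (rule groupI)
  fix X Y
  assume XY: "X \<in> carrier L" "Y \<in> carrier L"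
  then show "X \<otimes>\<^bsub>L\<^esub> Y \<in> carrier L"
    by (rule lim_cases2) (auto simp: lim_mult lim_closed group_mult_closed)
  fix Z
  assume "Z \<in> carrier L"
  then obtain m f where Z: "1 \<le> m" "f \<in> carrier (G m)" "Z = lim m f"
    by (rule lim_cases)
  obtain n g h where X: "1 \<le> n" "g \<in> carrier (G n)" "h \<in> carrier (G n)" "X = lim n g" "Y = lim n h"
    using XY by (rule lim_cases2)
  define N where "N = max m n"
  have N: "1 \<le> N" "m \<le> N" "n \<le> N" using X by (auto simp: N_def)
  have "X = lim N (\<iota> n N g)" "Y = lim N (\<iota> n N h)" "Z = lim N (\<iota> m N f)"
    using lim_incl[of n N g] lim_incl[of n N h] lim_incl[of m N f] X Z N by auto
  then show "X \<otimes>\<^bsub>L\<^esub> Y \<otimes>\<^bsub>L\<^esub> Z = X \<otimes>\<^bsub>L\<^esub> (Y \<otimes>\<^bsub>L\<^esub> Z)"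
    using X Z N group[of N]
    by (simp add: lim_mult incl_closed group_mult_closed group.is_monoid monoid.m_assoc)
next
  show "\<one>\<^bsub>L\<^esub> \<in> carrier L"
    using lim_one[of 1] lim_closed[of 1 "\<one>\<^bsub>G 1\<^esub>"] group_one_closed[of 1] by simp
next
  fix X
  assume "X \<in> carrier L"
  then obtain n g where X: "1 \<le> n" "g \<in> carrier (G n)" "X = lim n g"
    by (rule lim_cases)
  interpret Gn: group "G n" using X by (intro group)
  show "\<one>\<^bsub>L\<^esub> \<otimes>\<^bsub>L\<^esub> X = X"
    using X lim_one[of n] lim_mult[of n "\<one>\<^bsub>G n\<^esub>" g] by simp
  have "lim n (inv\<^bsub>G n\<^esub> g) \<otimes>\<^bsub>L\<^esub> X = \<one>\<^bsub>L\<^esub>"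
    using X lim_one[of n] by (simp add: lim_mult)
  then show "\<exists>Y \<in> carrier L. Y \<otimes>\<^bsub>L\<^esub> X = \<one>\<^bsub>L\<^esub>"
    using X lim_closed[of n "inv\<^bsub>G n\<^esub> g"] by auto
qed

lemma bzs_product_direct_limit: "bzs_product L (lim_rho \<rho>) (lim_clone G \<iota> \<kappa>)"
proof (intro bzs_product.intro group_direct_limit bzs_product_axioms.intro)
  fix X k
  assume "X \<in> carrier L"
  then obtain n g where X: "1 \<le> n" "g \<in> carrier (G n)" "X = lim n g"
    by (rule lim_cases)
  show "0 < lim_rho \<rho> X k" if k: "0 < k"
    using X k rho_range[of n g k] rho_beyond[of n g k] by (cases "k \<le> n") (auto simp: lim_rho)
  show "lim_clone G \<iota> \<kappa> k X \<in> carrier L" if k: "0 < k"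
    using X k lim_closed[of "n + 1" "\<kappa>' n k g"] clone_ext_closed[of n k g] by (simp add: lim_clone Suc_leI)
  show "lim_clone G \<iota> \<kappa> k (lim_clone G \<iota> \<kappa> l X) = lim_clone G \<iota> \<kappa> (l + 1) (lim_clone G \<iota> \<kappa> k X)"
    if k: "0 < k" "k < l" for l
    using X k clone_ext_clone_ext[of n k l g] clone_ext_closed[of n k g] clone_ext_closed[of n l g]
      lim_clone[of n k g] lim_clone[of n l g] lim_clone[of "n + 1" k "\<kappa>' n l g"] lim_clone[of "n + 1" "l + 1" "\<kappa>' n k g"]
    by simp
  show "lim_rho \<rho> (lim_clone G \<iota> \<kappa> k X) i = perm_clone k (lim_rho \<rho> X) i" if k: "0 < k" "0 < i" for i
    using X k rho_clone_ext[of n k g] lim_rho[of "n + 1" "\<kappa>' n k g"] clone_ext_closed[of n k g]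
    by (simp add: lim_rho lim_clone Suc_leI)
  fix Y
  assume "Y \<in> carrier L"
  then obtain n g h where X: "1 \<le> n" "g \<in> carrier (G n)" "h \<in> carrier (G n)" "X = lim n g" "Y = lim n h"
    using \<open>X \<in> carrier L\<close> by (metis lim_cases2)
  show "lim_rho \<rho> (X \<otimes>\<^bsub>L\<^esub> Y) k = lim_rho \<rho> X (lim_rho \<rho> Y k)"
    using X rho_hom[of n] by (simp add: lim_mult lim_rho group_mult_closed hom_mult sym_group_mult)
  show "lim_clone G \<iota> \<kappa> k (X \<otimes>\<^bsub>L\<^esub> Y) = lim_clone G \<iota> \<kappa> (lim_rho \<rho> Y k) X \<otimes>\<^bsub>L\<^esub> lim_clone G \<iota> \<kappa> k Y"
    if k: "0 < k"
  proof -
    have "1 \<le> \<rho> n h k"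
      using X k rho_range[of n h k] rho_beyond[of n h k] by (cases "k \<le> n") auto
    then show ?thesis
      using X k clone_ext_mult[of n k g h] clone_ext_closed[of n k h] clone_ext_closed[of n "\<rho> n h k" g]
        lim_mult[of "n + 1" "\<kappa>' n (\<rho> n h k) g" "\<kappa>' n k h"]
        lim_clone[of n k "g \<otimes>\<^bsub>G n\<^esub> h"] lim_clone[of n k h] lim_clone[of n "\<rho> n h k" g]
      by (simp add: lim_mult lim_rho group_mult_closed Suc_leI)
  qed
next
  fix k :: nat
  assume k: "0 < k"
  have "lim_rho \<rho> (lim 1 \<one>\<^bsub>G 1\<^esub>) = id"
    using lim_rho[of 1 "\<one>\<^bsub>G 1\<^esub>"] group_one_closed[of 1] hom_one[OF rho_hom[of 1] group[of 1] sym_group_is_group]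
    by (simp add: sym_group_one)
  then show "lim_rho \<rho> \<one>\<^bsub>L\<^esub> k = k"
    by (simp add: lim_one)
  show "inj_on (lim_clone G \<iota> \<kappa> k) (carrier L)"
  proof (rule inj_onI)
    fix X Y
    assume XY: "X \<in> carrier L" "Y \<in> carrier L" "lim_clone G \<iota> \<kappa> k X = lim_clone G \<iota> \<kappa> k Y"
    then obtain n g h where X: "1 \<le> n" "g \<in> carrier (G n)" "h \<in> carrier (G n)" "X = lim n g" "Y = lim n h"
      by (metis lim_cases2)
    have "\<kappa>' n k g = \<kappa>' n k h"
      using XY(3) X k lim_clone[of n k g] lim_clone[of n k h] lim_eq_iff[of "n + 1" "\<kappa>' n k g" "\<kappa>' n k h"]
        clone_ext_closed[of n k g] clone_ext_closed[of n k h]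
      by simp
    then show "X = Y"
      using X k inj_on_clone_ext[of n k] by (auto dest: inj_onD)
  qed
qed

lemma filtered_bzs_product_direct_limit:
  "filtered_bzs_product L (lim_rho \<rho>) (lim_clone G \<iota> \<kappa>) H"
proof (intro filtered_bzs_product.intro bzs_product_direct_limit filtered_bzs_product_axioms.intro)
  fix n :: nat
  assume n: "0 < n"
  interpret Gn: group "G n" using n by (intro group) simp
  interpret L: group L by (rule group_direct_limit)
  have "lim n \<in> hom (G n) L"
    using n by (intro homI) (auto simp: lim_mult lim_closed)
  then interpret lim: group_hom "G n" L "lim n"
    by unfold_locales
  show "subgroup (H n) L"
    unfolding H_def by (rule lim.img_is_subgroup)
next
  fix n k X
  assume "X \<in> H n" "0 < k" "k \<le> n"
  then obtain g where X: "X = lim n g" "g \<in> carrier (G n)" "1 \<le> n" by (auto simp: H_def)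
  show "lim_rho \<rho> X k \<le> n"
    using X \<open>0 < k\<close> \<open>k \<le> n\<close> rho_range[of n g k] by (simp add: lim_rho)
  show "lim_clone G \<iota> \<kappa> k X \<in> H (Suc n)"
    using X \<open>0 < k\<close> \<open>k \<le> n\<close> clone_ext_closed[of n k g] by (simp add: lim_clone H_def Suc_leI)
qed

sublocale filtered_bzs_product L "lim_rho \<rho>" "lim_clone G \<iota> \<kappa>" H
  by (rule filtered_bzs_product_direct_limit)


section \<open>Generalized Thompson groups of exact cloning systems\<close>

lemma bzs_monoid_eq: "bzs_monoid G \<iota> \<rho> \<kappa> = M"
  by (simp add: bzs_monoid_def)

lemma thompson_group_eq: "thompson_group G \<iota> \<rho> \<kappa> = M.Q\<lparr>carrier := thompson_carrier\<rparr>"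
proof -
  have lists: "ks \<in> lists {1..} \<longleftrightarrow> set ks \<subseteq> {0<..}" for ks :: "nat list"
    by (auto simp: in_lists_conv_set Suc_le_eq)
  have "{right_fraction M (cls (map Lambda ks @ [Grp (lim_class G \<iota> n g)])) (cls (map Lambda ls)) |ks ls n g.
      1 \<le> n \<and> ks \<in> lists {1..} \<and> ls \<in> lists {1..} \<and> semisimple n ks \<and> semisimple n ls \<and> g \<in> carrier (G n)} =
      {M.frac (elt ks (lim n g)) (elt ls \<one>\<^bsub>L\<^esub>) |ks ls n g. 1 \<le> n \<and> set ks \<subseteq> {0<..} \<and> set ls \<subseteq> {0<..} \<and> semisimple n ks \<and> semisimple n ls \<and> g \<in> carrier (G n)}"
    unfolding lists elt_def[of _ "lim _ _", symmetric] lim_def[symmetric]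
    by (rule Collect_cong, intro ex_cong1) (auto simp: cls_Lambda simp flip: elt_def)
  also have "\<dots> = thompson_carrier" (is "?A = _")
  proof (intro equalityI subsetI)
    fix X
    assume "X \<in> ?A"
    then show "X \<in> thompson_carrier"
      by (auto simp: semisimple_iff_rooted H_def intro!: thompson_carrierI)
  next
    fix X
    assume "X \<in> thompson_carrier"
    then obtain u v g where X: "X = M.frac (elt u (lim (Suc (length u)) g)) (elt v \<one>\<^bsub>L\<^esub>)"
        "rooted 1 u" "rooted 1 v" "length u = length v" "g \<in> carrier (G (Suc (length u)))"
      by (auto simp: thompson_carrier_def H_def)
    have "set u \<subseteq> {0<..}" "set v \<subseteq> {0<..}"
      using X rooted_positive by blast+
    then show "X \<in> ?A"
      using X by (intro CollectI exI[of _ u] exI[of _ v] exI[of _ "Suc (length u)"] exI[of _ g])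
        (auto simp: semisimple_iff_rooted)
  qed
  finally show ?thesis
    unfolding thompson_group_def bzs_monoid_eq by simp
qed

theorem group_fractions: "group (right_fractions (bzs_monoid G \<iota> \<rho> \<kappa>))"
  unfolding bzs_monoid_eq by (rule M.group_right_fractions)

theorem subgroup_thompson:
  "subgroup (carrier (thompson_group G \<iota> \<rho> \<kappa>)) (right_fractions (bzs_monoid G \<iota> \<rho> \<kappa>))"
  unfolding bzs_monoid_eq thompson_group_eq using subgroup_thompson_carrier by simp

theorem mon_thompson:
  assumes "1 \<le> n"
  shows "(\<lambda>g. embed n (lim n g)) \<in> mon (G n) (thompson_group G \<iota> \<rho> \<kappa>)"
proof -
  have "embed n (lim n g) \<in> thompson_carrier" if "g \<in> carrier (G n)" for g
    using assms that by (intro embed_thompson) (auto simp: H_def)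
  moreover have "embed n (lim n (g \<otimes>\<^bsub>G n\<^esub> h)) = embed n (lim n g) \<otimes>\<^bsub>M.Q\<^esub> embed n (lim n h)"
    if "g \<in> carrier (G n)" "h \<in> carrier (G n)" for g h
    using assms that embed_mult[of "lim n g" "lim n h" n] by (simp add: lim_mult lim_closed)
  moreover have "g = h"
    if "g \<in> carrier (G n)" "h \<in> carrier (G n)" "embed n (lim n g) = embed n (lim n h)" for g h
    using assms that embed_inj[of "lim n g" "lim n h" n] by (simp add: lim_closed lim_eq_iff)
  ultimately show ?thesis
    unfolding thompson_group_eq mon_def by (auto intro!: homI inj_onI)
qed

end

text \<open>A family of epimorphisms compatible with all the structure.  It induces a homomorphism of the
  monoids, of their groups of fractions and, as forests are not changed and every \<open>g \<in> G' n\<close>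
  has a preimage, an epimorphism of Thompson groups.\<close>

locale cloning_epimorphism = source: exact_cloning_system G \<iota> \<rho> \<kappa> + target: exact_cloning_system G' \<iota>' \<rho>' \<kappa>'
  for G :: "nat \<Rightarrow> 'a monoid" and \<iota> \<rho> \<kappa> and G' :: "nat \<Rightarrow> 'b monoid" and \<iota>' \<rho>' \<kappa>' +
  fixes \<phi> :: "nat \<Rightarrow> 'a \<Rightarrow> 'b"
  assumes \<phi>_epi: "1 \<le> n \<Longrightarrow> \<phi> n \<in> epi (G n) (G' n)"
    and \<phi>_incl: "\<lbrakk>1 \<le> m; m \<le> n; g \<in> carrier (G m)\<rbrakk> \<Longrightarrow> \<iota>' m n (\<phi> m g) = \<phi> n (\<iota> m n g)"
    and \<phi>_rho: "\<lbrakk>1 \<le> n; g \<in> carrier (G n)\<rbrakk> \<Longrightarrow> \<rho>' n (\<phi> n g) = \<rho> n g"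
    and \<phi>_clone: "\<lbrakk>1 \<le> k; k \<le> n; g \<in> carrier (G n)\<rbrakk> \<Longrightarrow> \<kappa>' n k (\<phi> n g) = \<phi> (n + 1) (\<kappa> n k g)"
begin

definition lim_map :: "(nat \<times> 'a) set \<Rightarrow> (nat \<times> 'b) set" where
  "lim_map X = the_elem ((\<lambda>(n, g). target.lim n (\<phi> n g)) ` X)"

lemma \<phi>_closed: "1 \<le> n \<Longrightarrow> g \<in> carrier (G n) \<Longrightarrow> \<phi> n g \<in> carrier (G' n)"
  using \<phi>_epi[of n] by (auto simp: epi_def)

lemma lim_map_lim:
  assumes "1 \<le> n" "g \<in> carrier (G n)"
  shows "lim_map (source.lim n g) = target.lim n (\<phi> n g)"
proof -
  have "target.lim m (\<phi> m h) = target.lim n (\<phi> n g)" if "(m, h) \<in> source.lim n g" for m h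
  proof -
    have "1 \<le> m" "h \<in> carrier (G m)" "\<iota> m (max m n) h = \<iota> n (max m n) g"
      using that assms by (auto simp: source.mem_lim)
    then show ?thesis
      using target.lim_incl[of m "max m n" "\<phi> m h"] target.lim_incl[of n "max m n" "\<phi> n g"]
        \<phi>_incl[of m "max m n" h] \<phi>_incl[of n "max m n" g] \<phi>_closed[of m h] \<phi>_closed[of n g] assms
      by simp
  qed
  then show ?thesis
    unfolding lim_map_def by (rule the_elem_image_case_prod[OF source.lim_self[OF assms]])
qed

lemma bzs_morphism_lim_map:
  "bzs_morphism source.L (lim_rho \<rho>) (lim_clone G \<iota> \<kappa>) target.L (lim_rho \<rho>') (lim_clone G' \<iota>' \<kappa>') lim_map"
proof (intro bzs_morphism.intro source.bzs_product_direct_limit target.bzs_product_direct_limit bzs_morphism_axioms.intro)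
  show "lim_map \<in> hom source.L target.L"
  proof (rule homI)
    fix X
    assume "X \<in> carrier source.L"
    then show "lim_map X \<in> carrier target.L"
      by (rule source.lim_cases) (simp add: lim_map_lim target.lim_closed \<phi>_closed)
  next
    fix X Y
    assume "X \<in> carrier source.L" "Y \<in> carrier source.L"
    then obtain n g h where X: "1 \<le> n" "g \<in> carrier (G n)" "h \<in> carrier (G n)" "X = source.lim n g" "Y = source.lim n h"
      by (rule source.lim_cases2)
    then have "\<phi> n (g \<otimes>\<^bsub>G n\<^esub> h) = \<phi> n g \<otimes>\<^bsub>G' n\<^esub> \<phi> n h"
      using \<phi>_epi[of n] by (auto simp: epi_def hom_mult)
    then show "lim_map (X \<otimes>\<^bsub>source.L\<^esub> Y) = lim_map X \<otimes>\<^bsub>target.L\<^esub> lim_map Y"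
      using X by (simp add: source.lim_mult lim_map_lim target.lim_mult source.group_mult_closed \<phi>_closed)
  qed
next
  fix X and k :: nat
  assume "X \<in> carrier source.L" and k: "0 < k"
  then obtain n g where X: "1 \<le> n" "g \<in> carrier (G n)" "X = source.lim n g"
    by (metis source.lim_cases)
  then show "lim_rho \<rho>' (lim_map X) k = lim_rho \<rho> X k"
    by (simp add: lim_map_lim source.lim_rho target.lim_rho \<phi>_closed \<phi>_rho)
  have "clone_ext \<iota>' \<kappa>' n k (\<phi> n g) = \<phi> (n + 1) (clone_ext \<iota> \<kappa> n k g)"
    using X k \<phi>_clone[of k n g] \<phi>_incl[of n "n + 1" g] by (auto simp: clone_ext_def)
  then show "lim_clone G' \<iota>' \<kappa>' k (lim_map X) = lim_map (lim_clone G \<iota> \<kappa> k X)"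
    using X k source.clone_ext_closed[of n k g] source.lim_clone[of n k g] target.lim_clone[of n k "\<phi> n g"]
      lim_map_lim[of "n + 1" "clone_ext \<iota> \<kappa> n k g"]
    by (simp add: lim_map_lim \<phi>_closed)
qed

theorem thompson_epi:
  "\<exists>f. f \<in> epi (thompson_group G \<iota> \<rho> \<kappa>) (thompson_group G' \<iota>' \<rho>' \<kappa>')"
proof -
  interpret bzs_morphism source.L "lim_rho \<rho>" "lim_clone G \<iota> \<kappa>" target.L "lim_rho \<rho>'" "lim_clone G' \<iota>' \<kappa>'" lim_map
    by (rule bzs_morphism_lim_map)
  have lim_map_H: "lim_map ` source.H n = target.H n" if "1 \<le> n" for n
  proof -
    have "lim_map ` source.H n = target.lim n ` \<phi> n ` carrier (G n)"
      using that by (force simp: source.H_def lim_map_lim)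
    also have "\<phi> n ` carrier (G n) = carrier (G' n)"
      using \<phi>_epi[OF that] by (simp add: epi_def)
    finally show ?thesis by (simp add: target.H_def)
  qed
  have image: "fraction_map (source.M.frac (source.elt u g) (source.elt v \<one>\<^bsub>source.L\<^esub>)) =
      target.M.frac (target.elt u (lim_map g)) (target.elt v \<one>\<^bsub>target.L\<^esub>)"
    if "rooted 1 u" "rooted 1 v" "g \<in> source.H (Suc (length u))" for u v g
    using that rooted_positive source.H_carrier[of _ g] by (intro fraction_map_frac) blast+
  have "fraction_map ` source.thompson_carrier = target.thompson_carrier"
  proof (intro equalityI subsetI)
    fix X
    assume "X \<in> fraction_map ` source.thompson_carrier"
    then obtain u v g where X: "X = fraction_map (source.M.frac (source.elt u g) (source.elt v \<one>\<^bsub>source.L\<^esub>))"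
        "rooted 1 u" "rooted 1 v" "length u = length v" "g \<in> source.H (Suc (length u))"
      by (auto simp: source.thompson_carrier_def)
    moreover have "lim_map g \<in> target.H (Suc (length u))"
      using X(5) lim_map_H[of "Suc (length u)"] by auto
    ultimately show "X \<in> target.thompson_carrier"
      by (simp add: image target.thompson_carrierI)
  next
    fix X
    assume "X \<in> target.thompson_carrier"
    then obtain u v h where X: "X = target.M.frac (target.elt u h) (target.elt v \<one>\<^bsub>target.L\<^esub>)"
        "rooted 1 u" "rooted 1 v" "length u = length v" "h \<in> target.H (Suc (length u))"
      by (auto simp: target.thompson_carrier_def)
    then obtain g where g: "g \<in> source.H (Suc (length u))" "h = lim_map g"
      using lim_map_H[of "Suc (length u)"] by auto
    then show "X \<in> fraction_map ` source.thompson_carrier"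
      using X image[of u v g] source.thompson_carrierI[of u v g] by auto
  qed
  moreover have "fraction_map \<in> hom (source.M.Q\<lparr>carrier := source.thompson_carrier\<rparr>)
      (target.M.Q\<lparr>carrier := target.thompson_carrier\<rparr>)"
    using fraction_map_hom calculation subgroup.subset[OF source.subgroup_thompson_carrier]
    by (intro homI) (auto intro!: hom_mult[OF fraction_map_hom])
  ultimately show ?thesis
    unfolding source.thompson_group_eq target.thompson_group_eq
    by (auto simp: epi_def intro!: exI[of _ fraction_map])
qed

end


section \<open>The cloning systems of Thompson's groups \<open>V\<close> and \<open>F\<close>\<close>

text \<open>By the product rule, injectivity of a cloning map follows from its values being trivial
  only at the identity.\<close>

lemma inj_on_crossed_hom:
  fixes G (structure) and H (structure)
  assumes "group G" "group H"
    and mult: "\<And>k g h. \<lbrakk>k \<in> K; g \<in> carrier G; h \<in> carrier G\<rbrakk> \<Longrightarrow>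
      \<kappa> k (g \<otimes>\<^bsub>G\<^esub> h) = \<kappa> (r h k) g \<otimes>\<^bsub>H\<^esub> \<kappa> k h"
    and closed: "\<And>k g. \<lbrakk>k \<in> K; g \<in> carrier G\<rbrakk> \<Longrightarrow> \<kappa> k g \<in> carrier H"
    and range: "\<And>k h. \<lbrakk>k \<in> K; h \<in> carrier G\<rbrakk> \<Longrightarrow> r h k \<in> K"
    and ker: "\<And>k g. \<lbrakk>k \<in> K; g \<in> carrier G; \<kappa> k g = \<one>\<^bsub>H\<^esub>\<rbrakk> \<Longrightarrow> g = \<one>\<^bsub>G\<^esub>"
    and k: "k \<in> K"
  shows "inj_on (\<kappa> k) (carrier G)"
proof (rule inj_onI)
  fix g h
  assume g: "g \<in> carrier G" and h: "h \<in> carrier G" and eq: "\<kappa> k g = \<kappa> k h"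
  interpret G: group G by fact
  interpret H: group H by fact
  have "\<kappa> k ((g \<otimes>\<^bsub>G\<^esub> inv\<^bsub>G\<^esub> h) \<otimes>\<^bsub>G\<^esub> h) = \<kappa> (r h k) (g \<otimes>\<^bsub>G\<^esub> inv\<^bsub>G\<^esub> h) \<otimes>\<^bsub>H\<^esub> \<kappa> k h"
    using k g h by (intro mult) auto
  then have "\<kappa> k h = \<kappa> (r h k) (g \<otimes>\<^bsub>G\<^esub> inv\<^bsub>G\<^esub> h) \<otimes>\<^bsub>H\<^esub> \<kappa> k h"
    using g h eq by (simp add: G.m_assoc)
  then have "\<kappa> (r h k) (g \<otimes>\<^bsub>G\<^esub> inv\<^bsub>G\<^esub> h) = \<one>\<^bsub>H\<^esub>"
    using closed[OF k h] closed[OF range[OF k h], of "g \<otimes>\<^bsub>G\<^esub> inv\<^bsub>G\<^esub> h"] g h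
    by (metis G.inv_closed G.m_closed H.l_cancel_one H.r_cancel_one')
  then have "g \<otimes>\<^bsub>G\<^esub> inv\<^bsub>G\<^esub> h = \<one>\<^bsub>G\<^esub>"
    using ker[OF range[OF k h]] g h by auto
  then show "g = h"
    using g h by (metis G.inv_closed G.inv_equality G.inv_inv)
qed

lemma sym_group_exact_cloning_system:
  "exact_cloning_system sym_group (\<lambda>m n \<sigma>. \<sigma>) (\<lambda>n \<sigma>. \<sigma>) (\<lambda>n k \<sigma>. perm_clone k \<sigma>)"
proof (intro exact_cloning_system.intro cloning_system.intro exact_cloning_system_axioms.intro)
  show "group (sym_group n)" for n
    by (rule sym_group_is_group)
  show "(\<lambda>\<sigma>. \<sigma>) \<in> mon (sym_group m) (sym_group n)" if "1 \<le> m" "m \<le> n" for m n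
    using that permutes_subset[of _ "{1..m}" "{1..n}"]
    by (auto simp: mon_def sym_group_carrier sym_group_mult intro!: homI)
  show "(\<lambda>\<sigma>. \<sigma>) \<in> hom (sym_group n) (sym_group n)" for n
    by (auto intro!: homI)
  show "perm_clone k \<in> carrier (sym_group n) \<rightarrow> carrier (sym_group (n + 1))" if "1 \<le> k" "k \<le> n" for k n
    using that perm_clone_permutes[of _ n k] by (auto simp: sym_group_carrier)
  have comp: "perm_clone k (\<sigma> \<circ> \<tau>) = perm_clone (\<tau> k) \<sigma> \<circ> perm_clone k \<tau>"
    if "\<sigma> permutes {1..n}" for k n :: nat and \<sigma> \<tau> :: "nat \<Rightarrow> nat"
    using perm_clone_comp permutes_inj[OF that] by blast
  show "perm_clone k (\<sigma> \<otimes>\<^bsub>sym_group n\<^esub> \<tau>) = perm_clone (\<tau> k) \<sigma> \<otimes>\<^bsub>sym_group (n + 1)\<^esub> perm_clone k \<tau>"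
    if "\<sigma> \<in> carrier (sym_group n)" for \<sigma> \<tau> n k
    using that comp by (auto simp: sym_group_carrier sym_group_mult)
  show "inj_on (perm_clone k) (carrier (sym_group n))" if "1 \<le> k" "k \<le> n" for k n
  proof (rule inj_on_crossed_hom[where K = "{1..n}" and r = "\<lambda>\<sigma>. \<sigma>" and H = "sym_group (n + 1)"])
    show "\<sigma> = \<one>\<^bsub>sym_group n\<^esub>" if "perm_clone k \<sigma> = \<one>\<^bsub>sym_group (n + 1)\<^esub>" for k \<sigma>
      using that perm_clone_eq_id by (auto simp: sym_group_one)
    show "\<tau> k \<in> {1..n}" if "k \<in> {1..n}" "\<tau> \<in> carrier (sym_group n)" for k \<tau>
      using that permutes_in_image[of \<tau> "{1..n}" k] by (simp add: sym_group_carrier)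
    show "perm_clone k \<sigma> \<in> carrier (sym_group (n + 1))" if "k \<in> {1..n}" "\<sigma> \<in> carrier (sym_group n)" for k \<sigma>
      using that perm_clone_permutes[of \<sigma> n k] by (auto simp: sym_group_carrier)
    show "perm_clone k (\<sigma> \<otimes>\<^bsub>sym_group n\<^esub> \<tau>) = perm_clone (\<tau> k) \<sigma> \<otimes>\<^bsub>sym_group (n + 1)\<^esub> perm_clone k \<tau>"
      if "\<sigma> \<in> carrier (sym_group n)" for \<sigma> \<tau> k
      using that unfolding sym_group_mult sym_group_carrier by (rule comp)
  qed (use that in \<open>auto simp: sym_group_is_group\<close>)
  show "perm_clone k \<sigma> = (if k \<le> m then perm_clone k \<sigma> else \<sigma>)" if "\<sigma> \<in> carrier (sym_group m)" for k m \<sigma>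
    using that perm_clone_beyond[of \<sigma> m k] by (auto simp: sym_group_carrier)
  show "perm_clone k (perm_clone l \<sigma>) = perm_clone (l + 1) (perm_clone k \<sigma>)"
    if "k < l" "\<sigma> \<in> carrier (sym_group n)" for k l \<sigma> n
    using that perm_clone_perm_clone[of k l \<sigma>] permutes_inj[of \<sigma>] by (simp add: sym_group_carrier)
qed (auto simp: sym_group_carrier)

lemma trivial_exact_cloning_system:
  "exact_cloning_system (\<lambda>n. singleton_group ()) (\<lambda>m n g. g) (\<lambda>n g. id) (\<lambda>n k g. g)"
proof (intro exact_cloning_system.intro cloning_system.intro exact_cloning_system_axioms.intro)
  show "(\<lambda>g. id) \<in> hom (singleton_group ()) (sym_group n)" for n
    by (intro homI) (auto simp: sym_group_carrier sym_group_mult permutes_id)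
qed (auto simp: mon_def intro!: homI)

text \<open>Every exact cloning system with surjective permutation maps yields a quotient \<open>V\<close>, because
  these maps are then a morphism to the symmetric groups.\<close>

lemma (in exact_cloning_system) thompson_epi_V:
  assumes "\<And>n. 1 \<le> n \<Longrightarrow> \<rho> n ` carrier (G n) = carrier (sym_group n)"
  shows "\<exists>f. f \<in> epi (thompson_group G \<iota> \<rho> \<kappa>) thompson_V"
proof -
  interpret cloning_epimorphism G \<iota> \<rho> \<kappa> sym_group "\<lambda>m n \<sigma>. \<sigma>" "\<lambda>n \<sigma>. \<sigma>" "\<lambda>n k \<sigma>. perm_clone k \<sigma>" \<rho>
  proof (intro cloning_epimorphism.intro exact_cloning_system_axioms sym_group_exact_cloning_system
      cloning_epimorphism_axioms.intro)
    show "\<rho> n \<in> epi (G n) (sym_group n)" if "1 \<le> n" for n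
      using that assms rho_hom by (simp add: epi_def)
  qed (use rho_clone_exact rho_incl in auto)
  show ?thesis
    unfolding thompson_V_def by (rule thompson_epi)
qed

text \<open>If all permutations are trivial, the only map to the trivial groups is compatible with \<open>\<rho>\<close>.\<close>

lemma (in exact_cloning_system) thompson_epi_F:
  assumes "\<And>n g. 1 \<le> n \<Longrightarrow> g \<in> carrier (G n) \<Longrightarrow> \<rho> n g = id"
  shows "\<exists>f. f \<in> epi (thompson_group G \<iota> \<rho> \<kappa>) thompson_F"
proof -
  interpret cloning_epimorphism G \<iota> \<rho> \<kappa> "\<lambda>n. singleton_group ()" "\<lambda>m n g. g" "\<lambda>n g. id" "\<lambda>n k g. g" "\<lambda>n g. ()"
  proof (intro cloning_epimorphism.intro exact_cloning_system_axioms trivial_exact_cloning_system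
      cloning_epimorphism_axioms.intro)
    show "(\<lambda>g. ()) \<in> epi (G n) (singleton_group ())" if "1 \<le> n" for n
      using group_one_closed[OF that] by (auto simp: epi_def singleton_group_def intro!: homI)
  qed (use assms in auto)
  show ?thesis
    unfolding thompson_F_def by (rule thompson_epi)
qed


section \<open>Free groups\<close>

definition flip :: "'x \<times> bool \<Rightarrow> 'x \<times> bool" where
  "flip a = (fst a, \<not> snd a)"

lemma flip_flip [simp]: "flip (flip a) = a" "fst (flip a) = fst a"
  by (simp_all add: flip_def)

lemma push_letter_Cons: "push_letter a (b # w) = (if b = flip a then w else a # b # w)"
  by (auto simp: flip_def prod_eq_iff)

declare push_letter.simps(2) [simp del]

lemma freely_reduced_Cons: "freely_reduced (a # w) \<longleftrightarrow> freely_reduced w \<and> (w = [] \<or> hd w \<noteq> flip a)"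
  by (auto simp: freely_reduced_def successively_Cons flip_def prod_eq_iff)

lemma freely_reduced_Nil [simp]: "freely_reduced []"
  by (simp add: freely_reduced_def)

lemma push_letter_reduced: "freely_reduced (a # w) \<Longrightarrow> push_letter a w = a # w"
  by (cases w) (auto simp: push_letter_Cons freely_reduced_Cons)

lemma freely_reduced_push: "freely_reduced w \<Longrightarrow> freely_reduced (push_letter a w)"
  by (cases w) (auto simp: push_letter_Cons freely_reduced_Cons)

text \<open>A letter acts on reduced words by a permutation whose inverse is the action of the inverse
  letter.  Associativity of the product follows from this.\<close>

lemma push_push_flip: "freely_reduced w \<Longrightarrow> push_letter a (push_letter (flip a) w) = w"
proof (cases w)
  case (Cons b v)
  then show "freely_reduced w \<Longrightarrow> ?thesis"
    by (cases v) (auto simp: push_letter_Cons freely_reduced_Cons)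
qed (simp add: push_letter_Cons)

lemma freely_reduced_foldr_push: "freely_reduced w \<Longrightarrow> freely_reduced (foldr push_letter u w)"
  by (induction u) (auto simp: freely_reduced_push)

lemma set_push_letter: "set (push_letter a w) \<subseteq> insert a (set w)"
  by (cases w) (auto simp: push_letter_Cons)

lemma set_foldr_push: "set (foldr push_letter u w) \<subseteq> set u \<union> set w"
  by (induction u) (use set_push_letter in fastforce)+

lemma foldr_push_push:
  "freely_reduced w \<Longrightarrow> foldr push_letter (push_letter a v) w = push_letter a (foldr push_letter v w)"
  by (cases v) (auto simp: push_letter_Cons push_push_flip freely_reduced_foldr_push)

lemma foldr_push_foldr_push:
  "freely_reduced w \<Longrightarrow>
     foldr push_letter (foldr push_letter u v) w = foldr push_letter u (foldr push_letter v w)"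
  by (induction u) (auto simp: foldr_push_push)

lemma carrier_free_group: "w \<in> carrier (free_group X) \<longleftrightarrow> freely_reduced w \<and> fst ` set w \<subseteq> X"
  by (simp add: free_group_def)

lemma mult_free_group: "u \<otimes>\<^bsub>free_group X\<^esub> v = foldr push_letter u v"
  by (simp add: free_group_def)

lemma one_free_group: "\<one>\<^bsub>free_group X\<^esub> = []"
  by (simp add: free_group_def)

lemma group_free_group: "group (free_group X)"
proof (rule groupI)
  fix u v w
  assume u: "u \<in> carrier (free_group X)" and v: "v \<in> carrier (free_group X)"
  then show "u \<otimes>\<^bsub>free_group X\<^esub> v \<in> carrier (free_group X)"
    using set_foldr_push[of u v]
    by (fastforce simp: carrier_free_group mult_free_group freely_reduced_foldr_push)
  assume "w \<in> carrier (free_group X)"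
  then show "u \<otimes>\<^bsub>free_group X\<^esub> v \<otimes>\<^bsub>free_group X\<^esub> w = u \<otimes>\<^bsub>free_group X\<^esub> (v \<otimes>\<^bsub>free_group X\<^esub> w)"
    by (simp add: carrier_free_group mult_free_group foldr_push_foldr_push)
next
  show "\<one>\<^bsub>free_group X\<^esub> \<in> carrier (free_group X)"
    by (simp add: carrier_free_group one_free_group)
next
  fix w
  assume w: "w \<in> carrier (free_group X)"
  then show "\<one>\<^bsub>free_group X\<^esub> \<otimes>\<^bsub>free_group X\<^esub> w = w"
    by (simp add: mult_free_group one_free_group)
  define v where "v = foldr push_letter (rev (map flip w)) []"
  have "set v \<subseteq> flip ` set w"
    using set_foldr_push[of "rev (map flip w)" "[]"] by (simp add: v_def)
  then have "v \<in> carrier (free_group X)"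
    using w by (fastforce simp: carrier_free_group v_def freely_reduced_foldr_push)
  moreover have "foldr push_letter (rev (map flip w)) w = []" if "freely_reduced w" for w :: "'a fword"
    using that by (induction w) (auto simp: push_letter_Cons freely_reduced_Cons)
  then have "v \<otimes>\<^bsub>free_group X\<^esub> w = \<one>\<^bsub>free_group X\<^esub>"
    using w by (simp add: carrier_free_group mult_free_group one_free_group v_def foldr_push_foldr_push)
  ultimately show "\<exists>v \<in> carrier (free_group X). v \<otimes>\<^bsub>free_group X\<^esub> w = \<one>\<^bsub>free_group X\<^esub>"
    by blast
qed

lemma letter_closed: "x \<in> X \<Longrightarrow> [(x, b)] \<in> carrier (free_group X)"
  by (simp add: carrier_free_group freely_reduced_Cons)

lemma inv_letter: "x \<in> X \<Longrightarrow> inv\<^bsub>free_group X\<^esub> [(x, b)] = [(x, \<not> b)]"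
  by (rule group.inv_equality[OF group_free_group])
    (auto simp: letter_closed mult_free_group one_free_group push_letter_Cons flip_def)

lemma free_group_Cons:
  assumes "(x, b) # w \<in> carrier (free_group X)"
  shows "x \<in> X" "w \<in> carrier (free_group X)" "(x, b) # w = [(x, b)] \<otimes>\<^bsub>free_group X\<^esub> w"
  using assms by (auto simp: carrier_free_group mult_free_group push_letter_reduced freely_reduced_Cons)

lemma free_group_induct [consumes 1, case_names one mult inv_mult]:
  assumes "w \<in> carrier (free_group X)"
    and "P \<one>\<^bsub>free_group X\<^esub>"
    and "\<And>x w. \<lbrakk>x \<in> X; w \<in> carrier (free_group X); P w\<rbrakk> \<Longrightarrow> P ([(x, True)] \<otimes>\<^bsub>free_group X\<^esub> w)"
    and "\<And>x w. \<lbrakk>x \<in> X; w \<in> carrier (free_group X); P w\<rbrakk> \<Longrightarrow>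
      P (inv\<^bsub>free_group X\<^esub> [(x, True)] \<otimes>\<^bsub>free_group X\<^esub> w)"
  shows "P w"
  using assms(1)
proof (induction w)
  case Nil
  then show ?case using assms(2) by (simp add: one_free_group)
next
  case (Cons a w)
  obtain x b where a: "a = (x, b)" by fastforce
  note * = free_group_Cons[OF Cons.prems[unfolded a]]
  show ?case
    using assms(3)[OF *(1,2)] assms(4)[OF *(1,2)] Cons.IH[OF *(2)] *(1)
    unfolding a *(3) by (cases b) (simp_all add: inv_letter)
qed

lemma hom_free_group_eq:
  assumes "group H" "f \<in> hom (free_group X) H" "f' \<in> hom (free_group X) H"
    and "\<And>x. x \<in> X \<Longrightarrow> f [(x, True)] = f' [(x, True)]"
    and "w \<in> carrier (free_group X)"
  shows "f w = f' w"
proof -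
  interpret f: group_hom "free_group X" H f
    using assms(1,2) group_free_group by (simp add: group_hom_def group_hom_axioms_def)
  interpret f': group_hom "free_group X" H f'
    using assms(1,3) group_free_group by (simp add: group_hom_def group_hom_axioms_def)
  show ?thesis
    using assms(5) by (induction rule: free_group_induct) (simp_all add: letter_closed assms(4))
qed

lemma free_extension_hom:
  assumes "group H" "\<And>x. x \<in> X \<Longrightarrow> f x \<in> carrier H"
  shows "free_extension H f \<in> hom (free_group X) H"
    and "x \<in> X \<Longrightarrow> free_extension H f [(x, True)] = f x"
proof -
  interpret group H by fact
  let ?e = "free_extension H f"
  define l where "l = (\<lambda>(x, b). if b then f x else inv\<^bsub>H\<^esub> f x)"
  have e_Cons: "?e (a # w) = l a \<otimes>\<^bsub>H\<^esub> ?e w" and e_Nil: "?e [] = \<one>\<^bsub>H\<^esub>" for a w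
    by (cases a; simp add: free_extension_def l_def)+
  have l: "l a \<in> carrier H" if "fst a \<in> X" for a
    using that assms(2) by (cases a) (auto simp: l_def)
  have l_flip: "l a \<otimes>\<^bsub>H\<^esub> l (flip a) = \<one>\<^bsub>H\<^esub>" if "fst a \<in> X" for a
    using that assms(2) by (cases a) (auto simp: l_def flip_def)
  have closed: "?e w \<in> carrier H" if "fst ` set w \<subseteq> X" for w
    using that by (induction w) (auto simp: e_Cons e_Nil l)
  have push: "?e (push_letter a w) = l a \<otimes>\<^bsub>H\<^esub> ?e w" if "fst a \<in> X" "fst ` set w \<subseteq> X" for a w
  proof (cases w)
    case (Cons b v)
    have "l a \<otimes>\<^bsub>H\<^esub> (l (flip a) \<otimes>\<^bsub>H\<^esub> ?e v) = ?e v"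
      using that Cons l[of a] l[of "flip a"] closed[of v] l_flip[of a] by (simp flip: m_assoc)
    then show ?thesis
      by (simp add: Cons push_letter_Cons e_Cons)
  qed (simp add: e_Cons)
  have "?e (foldr push_letter u v) = ?e u \<otimes>\<^bsub>H\<^esub> ?e v" if "fst ` set u \<subseteq> X" "fst ` set v \<subseteq> X" for u v
    using that(1)
  proof (induction u)
    case (Cons a u)
    have "fst ` set (foldr push_letter u v) \<subseteq> X"
      using set_foldr_push[of u v] Cons.prems that(2) by fastforce
    then show ?case
      using Cons closed that(2) by (simp add: push e_Cons l m_assoc)
  qed (use closed that(2) in \<open>simp add: e_Nil\<close>)
  then show "?e \<in> hom (free_group X) H"
    by (intro homI) (auto simp: carrier_free_group mult_free_group closed)
  show "?e [(x, True)] = f x" if "x \<in> X"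
    using that assms(2) by (simp add: free_extension_def)
qed


section \<open>Groups given by generators and relations\<close>

locale presented_group =
  fixes X :: "'x set" and R :: "('x fword \<times> 'x fword) set"
  assumes relations: "R \<subseteq> carrier (free_group X) \<times> carrier (free_group X)"
begin

abbreviation "N \<equiv> normal_closure (free_group X) (relators X R)"

sublocale FX: group "free_group X"
  by (rule group_free_group)

lemma relators_closed: "r \<in> relators X R \<Longrightarrow> r \<in> carrier (free_group X)"
  using relations by (auto simp: relators_def)

sublocale N: normal N "free_group X"
  unfolding normal_closure_def
proof (rule FX.normal_generateI)
  let ?C = "{g \<otimes>\<^bsub>free_group X\<^esub> r \<otimes>\<^bsub>free_group X\<^esub> inv\<^bsub>free_group X\<^esub> g |g r.
    g \<in> carrier (free_group X) \<and> r \<in> relators X R}"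
  show "?C \<subseteq> carrier (free_group X)"
    using relators_closed by auto
  fix h g
  assume "h \<in> ?C" and g: "g \<in> carrier (free_group X)"
  then obtain f r where h: "h = f \<otimes>\<^bsub>free_group X\<^esub> r \<otimes>\<^bsub>free_group X\<^esub> inv\<^bsub>free_group X\<^esub> f"
      and f: "f \<in> carrier (free_group X)" and r: "r \<in> relators X R"
    by blast
  have "g \<otimes>\<^bsub>free_group X\<^esub> h \<otimes>\<^bsub>free_group X\<^esub> inv\<^bsub>free_group X\<^esub> g =
      (g \<otimes>\<^bsub>free_group X\<^esub> f) \<otimes>\<^bsub>free_group X\<^esub> r \<otimes>\<^bsub>free_group X\<^esub> inv\<^bsub>free_group X\<^esub> (g \<otimes>\<^bsub>free_group X\<^esub> f)"
    using f g relators_closed[OF r] unfolding h by (simp add: FX.m_assoc FX.inv_mult_group)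
  then show "g \<otimes>\<^bsub>free_group X\<^esub> h \<otimes>\<^bsub>free_group X\<^esub> inv\<^bsub>free_group X\<^esub> g \<in> ?C"
    using f g r FX.m_closed by blast
qed

abbreviation "P \<equiv> group_presentation X R"

definition gen :: "'x \<Rightarrow> 'x fword set" where
  "gen x = N #>\<^bsub>free_group X\<^esub> [(x, True)]"

sublocale P: group P
  unfolding group_presentation_def by (rule N.factorgroup_is_group)

lemma proj_hom: "(\<lambda>w. N #>\<^bsub>free_group X\<^esub> w) \<in> hom (free_group X) P"
  unfolding group_presentation_def by (rule N.r_coset_hom_Mod)

sublocale proj: group_hom "free_group X" P "\<lambda>w. N #>\<^bsub>free_group X\<^esub> w"
  using proj_hom by unfold_locales

lemma proj_surj: "g \<in> carrier P \<Longrightarrow> \<exists>w \<in> carrier (free_group X). g = N #>\<^bsub>free_group X\<^esub> w"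
  by (auto simp: group_presentation_def carrier_FactGroup)

lemma gen_closed: "x \<in> X \<Longrightarrow> gen x \<in> carrier P"
  unfolding gen_def by (intro proj.hom_closed letter_closed)

lemma relation:
  assumes "(u, v) \<in> R"
  shows "N #>\<^bsub>free_group X\<^esub> u = N #>\<^bsub>free_group X\<^esub> v"
proof -
  have uv: "u \<in> carrier (free_group X)" "v \<in> carrier (free_group X)"
    using assms relations by auto
  have "u \<otimes>\<^bsub>free_group X\<^esub> inv\<^bsub>free_group X\<^esub> v \<in> relators X R"
    using assms by (auto simp: relators_def)
  then have "\<one>\<^bsub>free_group X\<^esub> \<otimes>\<^bsub>free_group X\<^esub> (u \<otimes>\<^bsub>free_group X\<^esub> inv\<^bsub>free_group X\<^esub> v) \<otimes>\<^bsub>free_group X\<^esub> inv\<^bsub>free_group X\<^esub> \<one>\<^bsub>free_group X\<^esub> \<in> N"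
    unfolding normal_closure_def by (intro generate.incl) blast
  then have "u \<otimes>\<^bsub>free_group X\<^esub> inv\<^bsub>free_group X\<^esub> v \<in> N"
    using uv by simp
  then have "N #>\<^bsub>free_group X\<^esub> (u \<otimes>\<^bsub>free_group X\<^esub> inv\<^bsub>free_group X\<^esub> v) = N"
    by (intro FX.coset_join2) (auto simp: N.is_subgroup uv)
  then show ?thesis
    using uv N.subset by (intro FX.coset_mult_inv1) auto
qed

text \<open>A homomorphism from the free group that respects the relations is trivial on all conjugates of
  relators, hence on the normal closure, and factors through the quotient.\<close>

lemma universal_property:
  assumes "group H" "\<And>x. x \<in> X \<Longrightarrow> f x \<in> carrier H"
    and "\<And>u v. (u, v) \<in> R \<Longrightarrow> free_extension H f u = free_extension H f v"
  obtains \<phi> where "\<phi> \<in> hom P H" "\<And>x. x \<in> X \<Longrightarrow> \<phi> (gen x) = f x"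
proof -
  interpret H: group H by fact
  let ?e = "free_extension H f"
  have e: "?e \<in> hom (free_group X) H" "\<And>x. x \<in> X \<Longrightarrow> ?e [(x, True)] = f x"
    using free_extension_hom[OF assms(1), of X f] assms(2) by auto
  interpret e: group_hom "free_group X" H ?e
    using e by unfold_locales
  have ker: "?e r = \<one>\<^bsub>H\<^esub>" if "r \<in> relators X R" for r
    using that assms(3) relations by (force simp: relators_def)
  have N: "?e w = \<one>\<^bsub>H\<^esub>" if "w \<in> N" for w
    using that unfolding normal_closure_def
  proof (induction rule: generate.induct)
    case (eng h1 h2)
    then have "h1 \<in> carrier (free_group X)" "h2 \<in> carrier (free_group X)"
      using N.subset unfolding normal_closure_def by auto
    then show ?case using eng by simp
  qed (use relators_closed ker in auto)
  have "?e u = ?e v" if "u \<in> carrier (free_group X)" "v \<in> carrier (free_group X)"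
    "N #>\<^bsub>free_group X\<^esub> u = N #>\<^bsub>free_group X\<^esub> v" for u v
  proof -
    have "u \<in> N #>\<^bsub>free_group X\<^esub> v"
      using FX.rcos_self[OF that(1) N.is_subgroup] that(3) by simp
    then obtain w where "w \<in> N" "u = w \<otimes>\<^bsub>free_group X\<^esub> v"
      by (auto simp: r_coset_def)
    then show ?thesis
      using N that N.mem_carrier by simp
  qed
  from FactGroup_universal[OF e(1) N.normal_axioms this]
  obtain \<phi> where "\<phi> \<in> hom (free_group X Mod N) H" "\<And>w. w \<in> carrier (free_group X) \<Longrightarrow> \<phi> (N #>\<^bsub>free_group X\<^esub> w) = ?e w"
    by blast
  then show ?thesis
    using e(2) by (intro that[of \<phi>]) (auto simp: group_presentation_def gen_def letter_closed)
qed

lemma presentation_induct [consumes 1, case_names one mult inv_mult]: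
  assumes "g \<in> carrier P"
    and "Q \<one>\<^bsub>P\<^esub>"
    and "\<And>x g. \<lbrakk>x \<in> X; g \<in> carrier P; Q g\<rbrakk> \<Longrightarrow> Q (gen x \<otimes>\<^bsub>P\<^esub> g)"
    and "\<And>x g. \<lbrakk>x \<in> X; g \<in> carrier P; Q g\<rbrakk> \<Longrightarrow> Q (inv\<^bsub>P\<^esub> gen x \<otimes>\<^bsub>P\<^esub> g)"
  shows "Q g"
proof -
  obtain w where w: "w \<in> carrier (free_group X)" "g = N #>\<^bsub>free_group X\<^esub> w"
    using proj_surj[OF assms(1)] by blast
  have "Q (N #>\<^bsub>free_group X\<^esub> w)"
    using w(1)
  proof (induction rule: free_group_induct)
    case one
    then show ?case using assms(2) proj.hom_one by simp
  next
    case (mult x w)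
    have "N #>\<^bsub>free_group X\<^esub> ([(x, True)] \<otimes>\<^bsub>free_group X\<^esub> w) = gen x \<otimes>\<^bsub>P\<^esub> (N #>\<^bsub>free_group X\<^esub> w)"
      unfolding gen_def by (rule proj.hom_mult) (use mult letter_closed in auto)
    then show ?case using mult assms(3)[of x "N #>\<^bsub>free_group X\<^esub> w"] by simp
  next
    case (inv_mult x w)
    have "N #>\<^bsub>free_group X\<^esub> (inv\<^bsub>free_group X\<^esub> [(x, True)] \<otimes>\<^bsub>free_group X\<^esub> w) = inv\<^bsub>P\<^esub> gen x \<otimes>\<^bsub>P\<^esub> (N #>\<^bsub>free_group X\<^esub> w)"
      unfolding gen_def using inv_mult letter_closed[of x X True]
      by (metis FX.inv_closed proj.hom_inv proj.hom_mult)
    then show ?case using inv_mult assms(4)[of x "N #>\<^bsub>free_group X\<^esub> w"] by simp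
  qed
  then show ?thesis using w(2) by simp
qed

end


section \<open>The cloning system of the mock symmetric groups\<close>

text \<open>A map satisfying the product rule of a cloning map is the same as a homomorphism to the
  following wreath product whose permutation part is \<open>\<rho>\<^sub>n\<close>; this allows such maps to be defined
  on generators.\<close>

definition wreath :: "('a, 'b) monoid_scheme \<Rightarrow> nat \<Rightarrow> ((nat \<Rightarrow> 'a) \<times> (nat \<Rightarrow> nat)) monoid" where
  "wreath H n =
     \<lparr>carrier = {(f, \<sigma>). (\<forall>k. f k \<in> carrier H) \<and> \<sigma> permutes {1..n}},
      monoid.mult = (\<lambda>(f, \<sigma>) (f', \<sigma>'). (\<lambda>k. f (\<sigma>' k) \<otimes>\<^bsub>H\<^esub> f' k, \<sigma> \<circ> \<sigma>')),
      one = (\<lambda>k. \<one>\<^bsub>H\<^esub>, id)\<rparr>"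

lemma wreath_simps:
  "(f, \<sigma>) \<in> carrier (wreath H n) \<longleftrightarrow> (\<forall>k. f k \<in> carrier H) \<and> \<sigma> permutes {1..n}"
  "(f, \<sigma>) \<otimes>\<^bsub>wreath H n\<^esub> (f', \<sigma>') = (\<lambda>k. f (\<sigma>' k) \<otimes>\<^bsub>H\<^esub> f' k, \<sigma> \<circ> \<sigma>')"
  "\<one>\<^bsub>wreath H n\<^esub> = (\<lambda>k. \<one>\<^bsub>H\<^esub>, id)"
  by (simp_all add: wreath_def)

lemma group_wreath:
  assumes "group H"
  shows "group (wreath H n)"
proof (rule groupI)
  interpret group H by fact
  show "x \<otimes>\<^bsub>wreath H n\<^esub> y \<in> carrier (wreath H n)"
    if "x \<in> carrier (wreath H n)" "y \<in> carrier (wreath H n)" for x y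
    using that by (cases x; cases y) (auto simp: wreath_simps permutes_compose)
  show "\<one>\<^bsub>wreath H n\<^esub> \<in> carrier (wreath H n)"
    by (simp add: wreath_simps permutes_id)
  show "x \<otimes>\<^bsub>wreath H n\<^esub> y \<otimes>\<^bsub>wreath H n\<^esub> z = x \<otimes>\<^bsub>wreath H n\<^esub> (y \<otimes>\<^bsub>wreath H n\<^esub> z)"
    if "x \<in> carrier (wreath H n)" "y \<in> carrier (wreath H n)" "z \<in> carrier (wreath H n)" for x y z
    using that by (cases x; cases y; cases z) (auto simp: wreath_simps m_assoc)
  show "\<one>\<^bsub>wreath H n\<^esub> \<otimes>\<^bsub>wreath H n\<^esub> x = x" if "x \<in> carrier (wreath H n)" for x
    using that by (cases x) (simp add: wreath_simps)
  show "\<exists>y \<in> carrier (wreath H n). y \<otimes>\<^bsub>wreath H n\<^esub> x = \<one>\<^bsub>wreath H n\<^esub>"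
    if "x \<in> carrier (wreath H n)" for x
  proof -
    obtain f \<sigma> where x: "x = (f, \<sigma>)" by fastforce
    then have f: "f k \<in> carrier H" and \<sigma>: "\<sigma> permutes {1..n}" for k
      using that by (auto simp: wreath_simps)
    let ?y = "(\<lambda>k. inv\<^bsub>H\<^esub> f (inv' \<sigma> k), inv' \<sigma>)"
    have "?y \<in> carrier (wreath H n)" "?y \<otimes>\<^bsub>wreath H n\<^esub> x = \<one>\<^bsub>wreath H n\<^esub>"
      using f \<sigma> by (simp_all add: x wreath_simps permutes_inv permutes_inverses permutes_inv_o)
    then show ?thesis by blast
  qed
qed

text \<open>The permutation reversing the interval from \<open>i\<close> to \<open>j\<close>.\<close>

definition reflect :: "nat \<Rightarrow> nat \<Rightarrow> nat \<Rightarrow> nat" where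
  "reflect i j m = (if i \<le> m \<and> m \<le> j then i + j - m else m)"

lemma reflect_permutes: "1 \<le> i \<Longrightarrow> j \<le> n \<Longrightarrow> reflect i j permutes {1..n}"
proof (rule bij_imp_permutes)
  assume "1 \<le> i" "j \<le> n"
  show "bij_betw (reflect i j) {1..n} {1..n}"
    by (rule bij_betw_byWitness[where f' = "reflect i j"])
      (use \<open>1 \<le> i\<close> \<open>j \<le> n\<close> in \<open>auto simp: reflect_def\<close>)
qed (auto simp: reflect_def)

lemma reflect_reflect: "reflect i j \<circ> reflect i j = id"
  by (rule ext) (auto simp: reflect_def)

lemma reflect_commute: "j < k \<Longrightarrow> reflect i j \<circ> reflect k l = reflect k l \<circ> reflect i j"
  by (rule ext) (auto simp: reflect_def)

lemma reflect_nested: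
  "k \<le> i \<Longrightarrow> j \<le> l \<Longrightarrow> reflect k l \<circ> reflect i j = reflect (k + l - j) (k + l - i) \<circ> reflect k l"
  by (rule ext) (auto simp: reflect_def)

text \<open>The cloned generators have the permutations that rule (3) requires.  If the cloned position lies in
  the reflected interval, a reflection of the longer interval alone would exchange the two copies,
  and the transposition of these corrects this.\<close>

lemma perm_clone_reflect:
  assumes "i < j"
  shows "perm_clone k (reflect i j) =
     (if j < k then reflect i j
      else if i \<le> k then reflect i (j + 1) \<circ> reflect k (k + 1)
      else reflect (i + 1) (j + 1))"
proof
  fix m
  consider "j < k" | "k < i" | "i \<le> k" "k \<le> j" "m < i" | "i \<le> k" "k \<le> j" "i \<le> m" "m < k" | "i \<le> k" "k \<le> j" "m = k"
    | "i \<le> k" "k \<le> j" "m = k + 1" | "i \<le> k" "k \<le> j" "k + 1 < m" "m \<le> j + 1" | "i \<le> k" "k \<le> j" "j + 1 < m"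
    by linarith
  then show "perm_clone k (reflect i j) m = (if j < k then reflect i j
      else if i \<le> k then reflect i (j + 1) \<circ> reflect k (k + 1) else reflect (i + 1) (j + 1)) m"
  proof cases
    case 1 then show ?thesis by (simp add: perm_clone_def reflect_def) arith
  next
    case 2 then show ?thesis using assms by (simp add: perm_clone_def reflect_def) arith
  next
    case 3 then show ?thesis by (simp add: perm_clone_def reflect_def)
  next
    case 4 then show ?thesis by (simp add: perm_clone_def reflect_def) arith
  next
    case 5 then show ?thesis by (simp add: perm_clone_def reflect_def)
  next
    case 6 then show ?thesis by (simp add: perm_clone_def reflect_def)
  next
    case 7
    then obtain m' where "m = Suc m'" by (cases m) auto
    with 7 show ?thesis by (simp add: perm_clone_def reflect_def)
  next
    case 8
    then obtain m' where "m = Suc m'" by (cases m) auto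
    with 8 show ?thesis by (simp add: perm_clone_def reflect_def)
  qed
qed


text \<open>The relations of the mock symmetric groups, including the degenerate intervals with
  \<open>i = j\<close>, to which the deletion of strands leads.\<close>

locale mock_identities = group H for H :: "('a, 'b) monoid_scheme" (structure) +
  fixes n :: nat and s :: "nat \<Rightarrow> nat \<Rightarrow> 'a"
  assumes s_closed: "\<lbrakk>1 \<le> i; i \<le> j; j \<le> n\<rbrakk> \<Longrightarrow> s i j \<in> carrier H"
    and s_trivial: "s i i = \<one>"
    and s_square: "\<lbrakk>1 \<le> i; i \<le> j; j \<le> n\<rbrakk> \<Longrightarrow> s i j \<otimes> s i j = \<one>"
    and s_commute: "\<lbrakk>1 \<le> i; i \<le> j; j < k; k \<le> l; l \<le> n\<rbrakk> \<Longrightarrow> s i j \<otimes> s k l = s k l \<otimes> s i j"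
    and s_nested: "\<lbrakk>1 \<le> k; k \<le> i; i \<le> j; j \<le> l; l \<le> n\<rbrakk> \<Longrightarrow>
      s k l \<otimes> s i j = s (k + l - j) (k + l - i) \<otimes> s k l"

text \<open>The generators of the mock symmetric groups, extended to degenerate intervals.\<close>

definition mock_gen :: "nat \<Rightarrow> nat \<Rightarrow> nat \<Rightarrow> (nat \<times> nat) fword set" where
  "mock_gen n i j = (if i < j then mock_s n i j else \<one>\<^bsub>mock_group n\<^esub>)"

lemma presented_group_mock: "presented_group (mock_index n) (mock_relations n)"
proof
  show "mock_relations n \<subseteq> carrier (free_group (mock_index n)) \<times> carrier (free_group (mock_index n))"
    by (auto simp: mock_relations_def carrier_free_group freely_reduced_Cons flip_def mock_index_def)
qed

interpretation mock: presented_group "mock_index n" "mock_relations n"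
  rewrites "group_presentation (mock_index n) (mock_relations n) = mock_group n" for n
  by (rule presented_group_mock) (simp add: mock_group_def)

lemma mock_s_gen: "mock_s n i j = mock.gen n (i, j)"
  by (simp add: mock_s_def mock.gen_def)

lemma mock_proj2:
  assumes "(i, j) \<in> mock_index n" "(k, l) \<in> mock_index n"
  shows "mock.N n #>\<^bsub>free_group (mock_index n)\<^esub> [((i, j), True), ((k, l), True)] =
         mock_s n i j \<otimes>\<^bsub>mock_group n\<^esub> mock_s n k l"
proof -
  have "[((i, j), True)] \<otimes>\<^bsub>free_group (mock_index n)\<^esub> [((k, l), True)] = [((i, j), True), ((k, l), True)]"
    by (simp add: mult_free_group push_letter_Cons flip_def)
  then show ?thesis
    unfolding mock_s_def using assms by (metis mock.proj.hom_mult letter_closed)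
qed

lemma mock_identities_mock_gen: "mock_identities (mock_group n) n (mock_gen n)"
proof (intro mock_identities.intro mock.P.is_group mock_identities_axioms.intro)
  interpret group "mock_group n" by (rule mock.P.is_group)
  have closed: "mock_s n i j \<in> carrier (mock_group n)" if "(i, j) \<in> mock_index n" for i j
    unfolding mock_s_gen using that by (rule mock.gen_closed)
  show gen_closed: "mock_gen n i j \<in> carrier (mock_group n)" if "1 \<le> i" "i \<le> j" "j \<le> n" for i j
    using that closed by (auto simp: mock_gen_def mock_index_def)
  show "mock_gen n i i = \<one>\<^bsub>mock_group n\<^esub>" for i
    by (simp add: mock_gen_def)
  have one: "mock.N n #>\<^bsub>free_group (mock_index n)\<^esub> [] = \<one>\<^bsub>mock_group n\<^esub>"
    using mock.proj.hom_one[of n] by (simp add: one_free_group)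
  show "mock_gen n i j \<otimes>\<^bsub>mock_group n\<^esub> mock_gen n i j = \<one>\<^bsub>mock_group n\<^esub>"
    if "1 \<le> i" "i \<le> j" "j \<le> n" for i j
  proof (cases "i < j")
    case True
    then have idx: "(i, j) \<in> mock_index n" using that by (simp add: mock_index_def)
    then have "([((i, j), True), ((i, j), True)], []) \<in> mock_relations n"
      unfolding mock_relations_def by blast
    from mock.relation[OF this] show ?thesis
      using True idx by (simp add: mock_gen_def mock_proj2 one)
  qed (simp add: mock_gen_def)
  show "mock_gen n i j \<otimes>\<^bsub>mock_group n\<^esub> mock_gen n k l = mock_gen n k l \<otimes>\<^bsub>mock_group n\<^esub> mock_gen n i j"
    if "1 \<le> i" "i \<le> j" "j < k" "k \<le> l" "l \<le> n" for i j k l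
  proof (cases "i < j \<and> k < l")
    case True
    then have idx: "(i, j) \<in> mock_index n" "(k, l) \<in> mock_index n"
      using that by (auto simp: mock_index_def)
    then have "([((i, j), True), ((k, l), True)], [((k, l), True), ((i, j), True)]) \<in> mock_relations n"
      using that unfolding mock_relations_def by blast
    from mock.relation[OF this] show ?thesis
      using True idx by (simp add: mock_gen_def mock_proj2)
  qed (use that gen_closed[of i j] gen_closed[of k l] in \<open>auto simp: mock_gen_def\<close>)
  show "mock_gen n k l \<otimes>\<^bsub>mock_group n\<^esub> mock_gen n i j =
      mock_gen n (k + l - j) (k + l - i) \<otimes>\<^bsub>mock_group n\<^esub> mock_gen n k l"
    if "1 \<le> k" "k \<le> i" "i \<le> j" "j \<le> l" "l \<le> n" for i j k l
  proof (cases "i < j")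
    case True
    then have idx: "(i, j) \<in> mock_index n" "(k, l) \<in> mock_index n" "(k + l - j, k + l - i) \<in> mock_index n"
      using that by (auto simp: mock_index_def)
    then have "([((k, l), True), ((i, j), True)], [((k + l - j, k + l - i), True), ((k, l), True)])
        \<in> mock_relations n"
      using that unfolding mock_relations_def by blast
    from mock.relation[OF this] show ?thesis
      using True idx that by (auto simp: mock_gen_def mock_proj2)
  next
    case False
    then have "i = j" using that by simp
    then show ?thesis
      using that gen_closed[of k l] by (auto simp: mock_gen_def)
  qed
qed

interpretation mock: mock_identities "mock_group n" n "mock_gen n" for n
  by (rule mock_identities_mock_gen)

lemma mock_s_mock_gen: "i < j \<Longrightarrow> mock_s n i j = mock_gen n i j"
  by (simp add: mock_gen_def)

lemma mock_induct [consumes 1, case_names one mult]: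
  assumes "g \<in> carrier (mock_group n)"
    and "Q \<one>\<^bsub>mock_group n\<^esub>"
    and "\<And>i j g. \<lbrakk>1 \<le> i; i < j; j \<le> n; g \<in> carrier (mock_group n); Q g\<rbrakk> \<Longrightarrow>
      Q (mock_gen n i j \<otimes>\<^bsub>mock_group n\<^esub> g)"
  shows "Q g"
proof -
  have step: "Q (mock.gen n x \<otimes>\<^bsub>mock_group n\<^esub> g) \<and> Q (inv\<^bsub>mock_group n\<^esub> mock.gen n x \<otimes>\<^bsub>mock_group n\<^esub> g)"
    if x: "x \<in> mock_index n" "g \<in> carrier (mock_group n)" "Q g" for x g
  proof -
    obtain i j where ij: "x = (i, j)" "1 \<le> i" "i < j" "j \<le> n"
      using x(1) by (auto simp: mock_index_def)
    then have gen: "mock.gen n x = mock_gen n i j"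
      by (simp add: mock_s_mock_gen flip: mock_s_gen)
    have "inv\<^bsub>mock_group n\<^esub> mock_gen n i j = mock_gen n i j"
      using ij by (intro mock.P.inv_equality) (auto simp: mock.s_square mock.s_closed)
    then show ?thesis
      using assms(3)[OF ij(2-4) x(2,3)] by (simp add: gen)
  qed
  show ?thesis
    using assms(1) by (rule mock.presentation_induct) (use assms(2) step in auto)
qed

text \<open>Homomorphisms, and more generally maps obeying the product rule of cloning maps, are
  determined by their values on generators, and prescribing these values only requires a check of
  the three types of relations.\<close>

lemma mock_universal_property:
  assumes "group H" "\<And>i j. \<lbrakk>1 \<le> i; i < j; j \<le> n\<rbrakk> \<Longrightarrow> f i j \<in> carrier H"
    and "\<And>i j. \<lbrakk>1 \<le> i; i < j; j \<le> n\<rbrakk> \<Longrightarrow> f i j \<otimes>\<^bsub>H\<^esub> f i j = \<one>\<^bsub>H\<^esub>"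
    and "\<And>i j k l. \<lbrakk>1 \<le> i; i < j; j < k; k < l; l \<le> n\<rbrakk> \<Longrightarrow> f i j \<otimes>\<^bsub>H\<^esub> f k l = f k l \<otimes>\<^bsub>H\<^esub> f i j"
    and "\<And>i j k l. \<lbrakk>1 \<le> k; k \<le> i; i < j; j \<le> l; l \<le> n\<rbrakk> \<Longrightarrow>
      f k l \<otimes>\<^bsub>H\<^esub> f i j = f (k + l - j) (k + l - i) \<otimes>\<^bsub>H\<^esub> f k l"
  shows "\<exists>\<phi>. \<phi> \<in> hom (mock_group n) H \<and> (\<forall>i j. 1 \<le> i \<and> i < j \<and> j \<le> n \<longrightarrow> \<phi> (mock_gen n i j) = f i j)"
proof -
  interpret H: group H by fact
  have closed: "f i j \<in> carrier H" if "(i, j) \<in> mock_index n" for i j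
    using that assms(2) by (auto simp: mock_index_def)
  have closed': "f (k + l - j) (k + l - i) \<in> carrier H"
    if "(i, j) \<in> mock_index n" "(k, l) \<in> mock_index n" "k \<le> i" "j \<le> l" for i j k l
    using that by (intro closed) (auto simp: mock_index_def)
  have "\<And>x. x \<in> mock_index n \<Longrightarrow> case_prod f x \<in> carrier H"
    using closed by auto
  moreover have "free_extension H (case_prod f) u = free_extension H (case_prod f) v"
    if "(u, v) \<in> mock_relations n" for u v
  proof -
    from that consider
        (square) i j where "u = [((i, j), True), ((i, j), True)]" "v = []" "(i, j) \<in> mock_index n"
      | (commute) i j k l where "u = [((i, j), True), ((k, l), True)]" "v = [((k, l), True), ((i, j), True)]"
          "(i, j) \<in> mock_index n" "(k, l) \<in> mock_index n" "j < k"
      | (nested) i j k l where "u = [((k, l), True), ((i, j), True)]"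
          "v = [((k + l - j, k + l - i), True), ((k, l), True)]"
          "(i, j) \<in> mock_index n" "(k, l) \<in> mock_index n" "k \<le> i" "j \<le> l"
      unfolding mock_relations_def by blast
    then show ?thesis
    proof cases
      case square
      then show ?thesis
        using assms(3)[of i j] closed[of i j] by (simp add: free_extension_def mock_index_def)
    next
      case commute
      then show ?thesis
        using assms(4)[of i j k l] closed[of i j] closed[of k l] by (simp add: free_extension_def mock_index_def)
    next
      case nested
      then show ?thesis
        using assms(5)[of k i j l] closed[of i j] closed[of k l] closed'[of i j k l]
        by (simp add: free_extension_def mock_index_def)
    qed
  qed
  ultimately obtain \<phi> where \<phi>: "\<phi> \<in> hom (mock_group n) H" "\<And>x. x \<in> mock_index n \<Longrightarrow> \<phi> (mock.gen n x) = case_prod f x"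
    using mock.universal_property[OF assms(1), of n "case_prod f"] by metis
  have gen: "mock_gen n i j = mock.gen n (i, j)" "(i, j) \<in> mock_index n" if "1 \<le> i \<and> i < j \<and> j \<le> n" for i j
    using that by (simp_all add: mock_gen_def mock_s_gen mock_index_def)
  show ?thesis
  proof (intro exI[of _ \<phi>] conjI allI impI \<phi>(1))
    show "\<phi> (mock_gen n i j) = f i j" if ij: "1 \<le> i \<and> i < j \<and> j \<le> n" for i j
      using \<phi>(2)[OF gen(2)[OF ij]] by (simp add: gen(1)[OF ij])
  qed
qed

definition mock_rho :: "nat \<Rightarrow> (nat \<times> nat) fword set \<Rightarrow> nat \<Rightarrow> nat" where
  "mock_rho n = (SOME \<phi>. \<phi> \<in> hom (mock_group n) (sym_group n) \<and>
     (\<forall>i j. 1 \<le> i \<and> i < j \<and> j \<le> n \<longrightarrow> \<phi> (mock_gen n i j) = reflect i j))"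

lemma mock_rho:
  "mock_rho n \<in> hom (mock_group n) (sym_group n)"
  "\<lbrakk>1 \<le> i; i < j; j \<le> n\<rbrakk> \<Longrightarrow> mock_rho n (mock_gen n i j) = reflect i j"
proof -
  have "\<exists>\<phi>. \<phi> \<in> hom (mock_group n) (sym_group n) \<and>
     (\<forall>i j. 1 \<le> i \<and> i < j \<and> j \<le> n \<longrightarrow> \<phi> (mock_gen n i j) = reflect i j)"
    by (rule mock_universal_property)
      (auto simp: sym_group_is_group sym_group_carrier sym_group_mult sym_group_one
        reflect_reflect reflect_nested intro: reflect_commute reflect_permutes[unfolded One_nat_def])
  from someI_ex[OF this, folded mock_rho_def]
  show "mock_rho n \<in> hom (mock_group n) (sym_group n)"
    "\<lbrakk>1 \<le> i; i < j; j \<le> n\<rbrakk> \<Longrightarrow> mock_rho n (mock_gen n i j) = reflect i j"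
    by auto
qed

lemma mock_rho_mult:
  "g \<in> carrier (mock_group n) \<Longrightarrow> h \<in> carrier (mock_group n) \<Longrightarrow>
     mock_rho n (g \<otimes>\<^bsub>mock_group n\<^esub> h) = mock_rho n g \<circ> mock_rho n h"
  using hom_mult[OF mock_rho(1), of g n h] by (simp add: sym_group_mult)

lemma mock_rho_one: "mock_rho n \<one>\<^bsub>mock_group n\<^esub> = id"
  using hom_one[OF mock_rho(1) mock.P.is_group sym_group_is_group] by (simp add: sym_group_one)

lemma mock_rho_permutes: "g \<in> carrier (mock_group n) \<Longrightarrow> mock_rho n g permutes {1..n}"
  using hom_in_carrier[OF mock_rho(1)] by (simp add: sym_group_carrier)

text \<open>The map with the product rule and the values \<open>f i j k\<close> on the generators \<open>s\<^bsub>i,j\<^esub>\<close>.\<close>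

definition mock_crossed ::
  "nat \<Rightarrow> ('h, 'b) monoid_scheme \<Rightarrow> (nat \<Rightarrow> nat \<Rightarrow> nat \<Rightarrow> 'h) \<Rightarrow> nat \<Rightarrow> (nat \<times> nat) fword set \<Rightarrow> 'h" where
  "mock_crossed n H f = (SOME \<kappa>.
     (\<forall>k. \<kappa> k \<in> carrier (mock_group n) \<rightarrow> carrier H) \<and>
     (\<forall>k. \<forall>g \<in> carrier (mock_group n). \<forall>h \<in> carrier (mock_group n).
        \<kappa> k (g \<otimes>\<^bsub>mock_group n\<^esub> h) = \<kappa> (mock_rho n h k) g \<otimes>\<^bsub>H\<^esub> \<kappa> k h) \<and>
     (\<forall>k i j. 1 \<le> i \<and> i < j \<and> j \<le> n \<longrightarrow> \<kappa> k (mock_gen n i j) = f i j k))"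

lemma mock_crossed:
  assumes "group H" "\<And>i j m. \<lbrakk>1 \<le> i; i < j; j \<le> n\<rbrakk> \<Longrightarrow> f i j m \<in> carrier H"
    and "\<And>i j m. \<lbrakk>1 \<le> i; i < j; j \<le> n\<rbrakk> \<Longrightarrow> f i j (reflect i j m) \<otimes>\<^bsub>H\<^esub> f i j m = \<one>\<^bsub>H\<^esub>"
    and "\<And>i j k l m. \<lbrakk>1 \<le> i; i < j; j < k; k < l; l \<le> n\<rbrakk> \<Longrightarrow>
      f i j (reflect k l m) \<otimes>\<^bsub>H\<^esub> f k l m = f k l (reflect i j m) \<otimes>\<^bsub>H\<^esub> f i j m"
    and "\<And>i j k l m. \<lbrakk>1 \<le> k; k \<le> i; i < j; j \<le> l; l \<le> n\<rbrakk> \<Longrightarrow>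
      f k l (reflect i j m) \<otimes>\<^bsub>H\<^esub> f i j m = f (k + l - j) (k + l - i) (reflect k l m) \<otimes>\<^bsub>H\<^esub> f k l m"
  shows "g \<in> carrier (mock_group n) \<Longrightarrow> mock_crossed n H f k g \<in> carrier H"
    and "\<lbrakk>g \<in> carrier (mock_group n); h \<in> carrier (mock_group n)\<rbrakk> \<Longrightarrow>
      mock_crossed n H f k (g \<otimes>\<^bsub>mock_group n\<^esub> h) =
        mock_crossed n H f (mock_rho n h k) g \<otimes>\<^bsub>H\<^esub> mock_crossed n H f k h"
    and "\<lbrakk>1 \<le> i; i < j; j \<le> n\<rbrakk> \<Longrightarrow> mock_crossed n H f k (mock_gen n i j) = f i j k"
proof -
  let ?W = "wreath H n"
  have W: "group ?W" by (rule group_wreath) fact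
  have "\<exists>\<phi>. \<phi> \<in> hom (mock_group n) ?W \<and>
     (\<forall>i j. 1 \<le> i \<and> i < j \<and> j \<le> n \<longrightarrow> \<phi> (mock_gen n i j) = (f i j, reflect i j))"
    by (rule mock_universal_property[OF W])
      (auto simp: wreath_simps reflect_reflect assms(2,3) reflect_nested
        intro: reflect_commute reflect_permutes[unfolded One_nat_def] ext[OF assms(4)[unfolded One_nat_def]]
          ext[OF assms(5)[unfolded One_nat_def]])
  then obtain \<phi> where \<phi>: "\<phi> \<in> hom (mock_group n) ?W"
    and gen: "\<And>i j. 1 \<le> i \<Longrightarrow> i < j \<Longrightarrow> j \<le> n \<Longrightarrow> \<phi> (mock_gen n i j) = (f i j, reflect i j)"
    by blast
  have snd: "snd (\<phi> g) = mock_rho n g" if "g \<in> carrier (mock_group n)" for g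
    using that
  proof (induction rule: mock_induct)
    case one
    then show ?case
      using hom_one[OF \<phi> mock.P.is_group W] by (simp add: wreath_simps mock_rho_one)
  next
    case (mult i j g)
    then show ?case
      using hom_mult[OF \<phi>, of "mock_gen n i j" g] gen[of i j] mock.s_closed[of i j n]
      by (cases "\<phi> g") (auto simp: wreath_simps mock_rho_mult mock_rho)
  qed
  have "\<exists>\<kappa>. (\<forall>k. \<kappa> k \<in> carrier (mock_group n) \<rightarrow> carrier H) \<and>
     (\<forall>k. \<forall>g \<in> carrier (mock_group n). \<forall>h \<in> carrier (mock_group n).
        \<kappa> k (g \<otimes>\<^bsub>mock_group n\<^esub> h) = \<kappa> (mock_rho n h k) g \<otimes>\<^bsub>H\<^esub> \<kappa> k h) \<and>
     (\<forall>k i j. 1 \<le> i \<and> i < j \<and> j \<le> n \<longrightarrow> \<kappa> k (mock_gen n i j) = f i j k)"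
  proof (intro exI[of _ "\<lambda>k g. fst (\<phi> g) k"] conjI allI ballI impI)
    show "(\<lambda>g. fst (\<phi> g) k) \<in> carrier (mock_group n) \<rightarrow> carrier H" for k
    proof
      fix g assume "g \<in> carrier (mock_group n)"
      then show "fst (\<phi> g) k \<in> carrier H"
        using hom_in_carrier[OF \<phi>, of g] by (cases "\<phi> g") (auto simp: wreath_simps)
    qed
    show "fst (\<phi> (g \<otimes>\<^bsub>mock_group n\<^esub> h)) k = fst (\<phi> g) (mock_rho n h k) \<otimes>\<^bsub>H\<^esub> fst (\<phi> h) k"
      if "g \<in> carrier (mock_group n)" "h \<in> carrier (mock_group n)" for k g h
      using that hom_mult[OF \<phi> that] snd[of h] by (cases "\<phi> g"; cases "\<phi> h") (auto simp: wreath_simps)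
    show "fst (\<phi> (mock_gen n i j)) k = f i j k" if "1 \<le> i \<and> i < j \<and> j \<le> n" for k i j
      using that gen by simp
  qed
  from someI_ex[OF this, folded mock_crossed_def]
  show "g \<in> carrier (mock_group n) \<Longrightarrow> mock_crossed n H f k g \<in> carrier H"
    and "\<lbrakk>g \<in> carrier (mock_group n); h \<in> carrier (mock_group n)\<rbrakk> \<Longrightarrow>
      mock_crossed n H f k (g \<otimes>\<^bsub>mock_group n\<^esub> h) =
        mock_crossed n H f (mock_rho n h k) g \<otimes>\<^bsub>H\<^esub> mock_crossed n H f k h"
    and "\<lbrakk>1 \<le> i; i < j; j \<le> n\<rbrakk> \<Longrightarrow> mock_crossed n H f k (mock_gen n i j) = f i j k"
    by blast+
qed

context mock_identities
begin

lemma nested: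
  "\<lbrakk>1 \<le> k; k \<le> i; i \<le> j; j \<le> l; l \<le> n; i' = k + l - j; j' = k + l - i\<rbrakk> \<Longrightarrow> s k l \<otimes> s i j = s i' j' \<otimes> s k l"
  using s_nested by simp

lemma square_cancel: "\<lbrakk>1 \<le> i; i \<le> j; j \<le> n; x \<in> carrier H\<rbrakk> \<Longrightarrow> x \<otimes> s i j \<otimes> s i j = x"
  by (simp add: m_assoc s_closed s_square)

text \<open>The values of the \<open>k\<close>-th cloning map and of the deletion of the \<open>k\<close>-th of \<open>n + 1\<close> strands on
  \<open>s\<^bsub>i,j\<^esub>\<close>.  For \<open>k > n + 1\<close> and \<open>k = 0\<close> there is no strand to delete, and the second value is set
  to \<open>\<one>\<close>, which is compatible with the product rule since permutations fix these \<open>k\<close>.\<close>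

definition clone_value :: "nat \<Rightarrow> nat \<Rightarrow> nat \<Rightarrow> 'a" where
  "clone_value i j k = (if j < k then s i j else if i \<le> k then s i (j + 1) \<otimes> s k (k + 1) else s (i + 1) (j + 1))"

definition delete_value :: "nat \<Rightarrow> nat \<Rightarrow> nat \<Rightarrow> 'a" where
  "delete_value i j k = (if k < 1 \<or> n + 1 < k then \<one> else if j < k then s i j else if i \<le> k then s i (j - 1) else s (i - 1) (j - 1))"

lemma clone_value_closed: "\<lbrakk>1 \<le> i; i < j; j < n\<rbrakk> \<Longrightarrow> clone_value i j k \<in> carrier H"
  by (auto simp: clone_value_def s_closed)

lemma clone_value_square:
  assumes "1 \<le> i" "i < j" "j < n"
  shows "clone_value i j (reflect i j m) \<otimes> clone_value i j m = \<one>"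
proof (cases "i \<le> m \<and> m \<le> j")
  case True
  define m' where "m' = i + j - m"
  have m': "i \<le> m'" "m' \<le> j" "i + j - m = m'" using True by (auto simp: m'_def)
  note [simp] = s_closed
  have "s i (j + 1) \<otimes> s m (m + 1) = s m' (m' + 1) \<otimes> s i (j + 1)"
    using True assms by (intro nested) (auto simp: m'_def)
  then have "s i (j + 1) \<otimes> s m' (m' + 1) \<otimes> (s i (j + 1) \<otimes> s m (m + 1)) =
      s i (j + 1) \<otimes> (s m' (m' + 1) \<otimes> s m' (m' + 1)) \<otimes> s i (j + 1)"
    using True assms m' by (simp add: m_assoc)
  then show ?thesis
    using True assms m' by (simp add: clone_value_def reflect_def s_square)
next
  case False
  then show ?thesis
    using assms by (auto simp: clone_value_def reflect_def s_square)
qed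

lemma clone_value_commute:
  assumes "1 \<le> i" "i < j" "j < k" "k < l" "l < n"
  shows "clone_value i j (reflect k l m) \<otimes> clone_value k l m = clone_value k l (reflect i j m) \<otimes> clone_value i j m"
proof -
  note [simp] = s_closed
  consider "m < i" | "i \<le> m" "m \<le> j" | "j < m" "m < k" | "k \<le> m" "m \<le> l" | "l < m" by linarith
  then show ?thesis
  proof cases
    case 2
    define m' where "m' = i + j - m"
    have m': "i \<le> m'" "m' \<le> j" "i + j - m = m'" using 2 by (auto simp: m'_def)
    have "s i (j + 1) \<otimes> s m (m + 1) \<otimes> s (k + 1) (l + 1) = s i (j + 1) \<otimes> (s (k + 1) (l + 1) \<otimes> s m (m + 1))"
      using 2 assms s_commute[of m "m + 1" "k + 1" "l + 1"] by (simp add: m_assoc)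
    also have "\<dots> = s (k + 1) (l + 1) \<otimes> (s i (j + 1) \<otimes> s m (m + 1))"
      using 2 assms s_commute[of i "j + 1" "k + 1" "l + 1"] by (simp flip: m_assoc)
    finally show ?thesis
      using 2 assms m' by (simp add: clone_value_def reflect_def)
  next
    case 4
    define m' where "m' = k + l - m"
    have m': "k \<le> m'" "m' \<le> l" "k + l - m = m'" using 4 by (auto simp: m'_def)
    have "s i j \<otimes> (s k (l + 1) \<otimes> s m (m + 1)) = s k (l + 1) \<otimes> (s i j \<otimes> s m (m + 1))"
      using 4 assms s_commute[of i j k "l + 1"] by (simp flip: m_assoc)
    also have "\<dots> = s k (l + 1) \<otimes> s m (m + 1) \<otimes> s i j"
      using 4 assms s_commute[of i j m "m + 1"] by (simp add: m_assoc)
    finally show ?thesis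
      using 4 assms m' by (simp add: clone_value_def reflect_def)
  qed (use assms in \<open>auto simp: clone_value_def reflect_def intro!: s_commute\<close>)
qed

text \<open>In the case \<open>i \<le> m \<le> j\<close> each side contains two factors for the copies of the cloned
  strand.  Moving one of them through the generator of the interval that contains it makes it meet
  the other one, and they cancel.\<close>

lemma clone_value_nested:
  assumes "1 \<le> k" "k \<le> i" "i < j" "j \<le> l" "l < n"
  shows "clone_value k l (reflect i j m) \<otimes> clone_value i j m =
    clone_value (k + l - j) (k + l - i) (reflect k l m) \<otimes> clone_value k l m"
proof -
  note [simp] = s_closed
  define i' j' where "i' = k + l - j" and "j' = k + l - i"
  have ij': "k \<le> i'" "i' < j'" "j' \<le> l" using assms by (auto simp: i'_def j'_def)
  have fold: "k + l - j = i'" "k + l - i = j'" by (auto simp: i'_def j'_def)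
  consider "m < k" | "k \<le> m" "m < i" | "i \<le> m" "m \<le> j" | "j < m" "m \<le> l" | "l < m" by linarith
  then show ?thesis
  proof cases
    case 1
    have "s (k + 1) (l + 1) \<otimes> s (i + 1) (j + 1) = s (i' + 1) (j' + 1) \<otimes> s (k + 1) (l + 1)"
      using assms by (intro nested) (auto simp: i'_def j'_def)
    then show ?thesis
      using 1 assms ij' by (simp add: clone_value_def reflect_def fold)
  next
    case 2
    define m' where "m' = k + l - m"
    have m': "j' < m'" "m' \<le> l" "k + l - m = m'" using 2 assms by (auto simp: m'_def j'_def)
    have "s k (l + 1) \<otimes> s m (m + 1) \<otimes> s (i + 1) (j + 1) = s k (l + 1) \<otimes> s (i + 1) (j + 1) \<otimes> s m (m + 1)"
      using 2 assms s_commute[of m "m + 1" "i + 1" "j + 1"] by (simp add: m_assoc)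
    also have "s k (l + 1) \<otimes> s (i + 1) (j + 1) = s i' j' \<otimes> s k (l + 1)"
      using 2 assms by (intro nested) (auto simp: i'_def j'_def)
    finally show ?thesis
      using 2 assms m' ij' by (simp add: clone_value_def reflect_def fold m_assoc)
  next
    case 3
    define a b where "a = i + j - m" and "b = k + l - m"
    have ab: "i \<le> a" "a \<le> j" "i' \<le> b" "b \<le> j'" "i + j - m = a" "k + l - m = b"
      using 3 assms by (auto simp: a_def b_def i'_def j'_def)
    have "s i (j + 1) \<otimes> s m (m + 1) = s a (a + 1) \<otimes> s i (j + 1)"
      using 3 assms by (intro nested) (auto simp: a_def)
    then have 1: "s k (l + 1) \<otimes> s a (a + 1) \<otimes> (s i (j + 1) \<otimes> s m (m + 1)) = s k (l + 1) \<otimes> s i (j + 1)"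
      using 3 assms ab square_cancel[of a "a + 1" "s k (l + 1)"] by (simp flip: m_assoc)
    have "s k (l + 1) \<otimes> s m (m + 1) = s b (b + 1) \<otimes> s k (l + 1)"
      using 3 assms by (intro nested) (auto simp: b_def)
    then have 2: "s i' (j' + 1) \<otimes> s b (b + 1) \<otimes> (s k (l + 1) \<otimes> s m (m + 1)) = s i' (j' + 1) \<otimes> s k (l + 1)"
      using 3 assms ab ij' square_cancel[of b "b + 1" "s i' (j' + 1)"] by (simp flip: m_assoc)
    have "s k (l + 1) \<otimes> s i (j + 1) = s i' (j' + 1) \<otimes> s k (l + 1)"
      using assms by (intro nested) (auto simp: i'_def j'_def)
    then show ?thesis
      using 1 2 3 assms ab ij' by (simp add: clone_value_def reflect_def fold)
  next
    case 4
    define m' where "m' = k + l - m"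
    have m': "k \<le> m'" "m' < i'" "k + l - m = m'" using 4 assms by (auto simp: m'_def i'_def)
    have "s k (l + 1) \<otimes> s m (m + 1) \<otimes> s i j = s k (l + 1) \<otimes> s i j \<otimes> s m (m + 1)"
      using 4 assms s_commute[of i j m "m + 1"] by (simp add: m_assoc)
    also have "s k (l + 1) \<otimes> s i j = s (i' + 1) (j' + 1) \<otimes> s k (l + 1)"
      using 4 assms by (intro nested) (auto simp: i'_def j'_def)
    finally show ?thesis
      using 4 assms m' ij' by (simp add: clone_value_def reflect_def fold m_assoc)
  next
    case 5
    have "s k l \<otimes> s i j = s i' j' \<otimes> s k l"
      using assms by (intro nested) (auto simp: i'_def j'_def)
    then show ?thesis
      using 5 assms ij' by (simp add: clone_value_def reflect_def fold)
  qed
qed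

lemma delete_value_closed: "\<lbrakk>1 \<le> i; i < j; j \<le> n + 1\<rbrakk> \<Longrightarrow> delete_value i j k \<in> carrier H"
  by (auto simp: delete_value_def s_closed)

lemma delete_value_square:
  assumes "1 \<le> i" "i < j" "j \<le> n + 1"
  shows "delete_value i j (reflect i j m) \<otimes> delete_value i j m = \<one>"
  using assms by (auto simp: delete_value_def reflect_def s_square)

lemma delete_value_commute:
  assumes "1 \<le> i" "i < j" "j < k" "k < l" "l \<le> n + 1"
  shows "delete_value i j (reflect k l m) \<otimes> delete_value k l m = delete_value k l (reflect i j m) \<otimes> delete_value i j m"
proof -
  consider "m < i" | "i \<le> m" "m \<le> j" | "j < m" "m < k" | "k \<le> m" "m \<le> l" | "l < m" by linarith
  then show ?thesis
    by cases (use assms in \<open>auto simp: delete_value_def reflect_def intro!: s_commute\<close>)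
qed

lemma delete_value_nested:
  assumes "1 \<le> k" "k \<le> i" "i < j" "j \<le> l" "l \<le> n + 1"
  shows "delete_value k l (reflect i j m) \<otimes> delete_value i j m =
    delete_value (k + l - j) (k + l - i) (reflect k l m) \<otimes> delete_value k l m"
proof -
  define i' j' where "i' = k + l - j" and "j' = k + l - i"
  have ij': "k \<le> i'" "i' < j'" "j' \<le> l" using assms by (auto simp: i'_def j'_def)
  have fold: "k + l - j = i'" "k + l - i = j'" by (auto simp: i'_def j'_def)
  consider "m < k" | "k \<le> m" "m < i" | "i \<le> m" "m \<le> j" | "j < m" "m \<le> l" | "l < m" by linarith
  then show ?thesis
  proof cases
    case 1
    show ?thesis
    proof (cases "m = 0")
      case False
      have "s (k - 1) (l - 1) \<otimes> s (i - 1) (j - 1) = s (i' - 1) (j' - 1) \<otimes> s (k - 1) (l - 1)"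
        using 1 False assms by (intro nested) (auto simp: i'_def j'_def)
      then show ?thesis
        using 1 False assms ij' by (simp add: delete_value_def reflect_def fold)
    qed (use assms in \<open>simp add: delete_value_def reflect_def\<close>)
  next
    case 2
    define m' where "m' = k + l - m"
    have m': "j' < m'" "m' \<le> l" "k + l - m = m'" using 2 assms by (auto simp: m'_def j'_def)
    have "s k (l - 1) \<otimes> s (i - 1) (j - 1) = s i' j' \<otimes> s k (l - 1)"
      using 2 assms by (intro nested) (auto simp: i'_def j'_def)
    then show ?thesis
      using 2 assms m' ij' by (simp add: delete_value_def reflect_def fold)
  next
    case 3
    define a b where "a = i + j - m" and "b = k + l - m"
    have ab: "i \<le> a" "a \<le> j" "i' \<le> b" "b \<le> j'" "i + j - m = a" "k + l - m = b"
      using 3 assms by (auto simp: a_def b_def i'_def j'_def)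
    have "s k (l - 1) \<otimes> s i (j - 1) = s i' (j' - 1) \<otimes> s k (l - 1)"
      using 3 assms by (intro nested) (auto simp: i'_def j'_def)
    then show ?thesis
      using 3 assms ab ij' by (simp add: delete_value_def reflect_def fold)
  next
    case 4
    define m' where "m' = k + l - m"
    have m': "k \<le> m'" "m' < i'" "k + l - m = m'" using 4 assms by (auto simp: m'_def i'_def)
    have "s k (l - 1) \<otimes> s i j = s (i' - 1) (j' - 1) \<otimes> s k (l - 1)"
      using 4 assms by (intro nested) (auto simp: i'_def j'_def)
    then show ?thesis
      using 4 assms m' ij' by (simp add: delete_value_def reflect_def fold)
  next
    case 5
    show ?thesis
    proof (cases "n + 1 < m")
      case False
      have "s k l \<otimes> s i j = s i' j' \<otimes> s k l"
        using 5 False assms by (intro nested) (auto simp: i'_def j'_def)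
      then show ?thesis
        using 5 False assms ij' by (simp add: delete_value_def reflect_def fold)
    qed (use assms ij' 5 in \<open>simp add: delete_value_def reflect_def\<close>)
  qed
qed

end

definition mock_incl :: "nat \<Rightarrow> nat \<Rightarrow> (nat \<times> nat) fword set \<Rightarrow> (nat \<times> nat) fword set" where
  "mock_incl m n = (SOME \<phi>. \<phi> \<in> hom (mock_group m) (mock_group n) \<and>
     (\<forall>i j. 1 \<le> i \<and> i < j \<and> j \<le> m \<longrightarrow> \<phi> (mock_gen m i j) = mock_gen n i j))"

lemma mock_incl:
  assumes "m \<le> n"
  shows "mock_incl m n \<in> hom (mock_group m) (mock_group n)"
    and "\<lbrakk>1 \<le> i; i < j; j \<le> m\<rbrakk> \<Longrightarrow> mock_incl m n (mock_gen m i j) = mock_gen n i j"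
proof -
  have "\<exists>\<phi>. \<phi> \<in> hom (mock_group m) (mock_group n) \<and>
     (\<forall>i j. 1 \<le> i \<and> i < j \<and> j \<le> m \<longrightarrow> \<phi> (mock_gen m i j) = mock_gen n i j)"
    by (rule mock_universal_property[OF mock.P.is_group];
        rule mock.s_closed mock.s_square mock.s_commute mock.s_nested; use assms in linarith)
  from someI_ex[OF this, folded mock_incl_def]
  show "mock_incl m n \<in> hom (mock_group m) (mock_group n)"
    and "\<lbrakk>1 \<le> i; i < j; j \<le> m\<rbrakk> \<Longrightarrow> mock_incl m n (mock_gen m i j) = mock_gen n i j"
    by auto
qed

lemma mock_incl_closed: "m \<le> n \<Longrightarrow> g \<in> carrier (mock_group m) \<Longrightarrow> mock_incl m n g \<in> carrier (mock_group n)"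
  using mock_incl(1) by (rule hom_in_carrier)

lemma mock_incl_mult:
  "\<lbrakk>m \<le> n; g \<in> carrier (mock_group m); h \<in> carrier (mock_group m)\<rbrakk> \<Longrightarrow>
     mock_incl m n (g \<otimes>\<^bsub>mock_group m\<^esub> h) = mock_incl m n g \<otimes>\<^bsub>mock_group n\<^esub> mock_incl m n h"
  using hom_mult[OF mock_incl(1)] by blast

lemma mock_incl_one: "m \<le> n \<Longrightarrow> mock_incl m n \<one>\<^bsub>mock_group m\<^esub> = \<one>\<^bsub>mock_group n\<^esub>"
  using hom_one[OF mock_incl(1) mock.P.is_group mock.P.is_group] by blast

definition mock_clone :: "nat \<Rightarrow> nat \<Rightarrow> (nat \<times> nat) fword set \<Rightarrow> (nat \<times> nat) fword set" where
  "mock_clone n = mock_crossed n (mock_group (Suc n)) (mock.clone_value (Suc n))"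

lemma mock_clone:
  "g \<in> carrier (mock_group n) \<Longrightarrow> mock_clone n k g \<in> carrier (mock_group (Suc n))"
  "\<lbrakk>g \<in> carrier (mock_group n); h \<in> carrier (mock_group n)\<rbrakk> \<Longrightarrow>
     mock_clone n k (g \<otimes>\<^bsub>mock_group n\<^esub> h) =
       mock_clone n (mock_rho n h k) g \<otimes>\<^bsub>mock_group (Suc n)\<^esub> mock_clone n k h"
  "\<lbrakk>1 \<le> i; i < j; j \<le> n\<rbrakk> \<Longrightarrow> mock_clone n k (mock_gen n i j) = mock.clone_value (Suc n) i j k"
  unfolding mock_clone_def
  by (rule mock_crossed[OF mock.P.is_group];
      (assumption | rule mock.clone_value_closed mock.clone_value_square mock.clone_value_commute mock.clone_value_nested; linarith))+

lemma mock_clone_one: "mock_clone n k \<one>\<^bsub>mock_group n\<^esub> = \<one>\<^bsub>mock_group (Suc n)\<^esub>"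
proof -
  have "mock_clone n k \<one>\<^bsub>mock_group n\<^esub> =
      mock_clone n k \<one>\<^bsub>mock_group n\<^esub> \<otimes>\<^bsub>mock_group (Suc n)\<^esub> mock_clone n k \<one>\<^bsub>mock_group n\<^esub>"
    using mock_clone(2)[of "\<one>\<^bsub>mock_group n\<^esub>" n "\<one>\<^bsub>mock_group n\<^esub>" k] by (simp add: mock_rho_one)
  then show ?thesis
    using mock_clone(1)[of "\<one>\<^bsub>mock_group n\<^esub>" n k] by simp
qed

text \<open>Deletion of the \<open>k\<close>-th strand obeys the same product rule.  It undoes cloning and, for the
  last strand, the inclusion, both of which are therefore injective.\<close>

definition mock_delete :: "nat \<Rightarrow> nat \<Rightarrow> (nat \<times> nat) fword set \<Rightarrow> (nat \<times> nat) fword set" where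
  "mock_delete n = mock_crossed (Suc n) (mock_group n) (mock.delete_value n)"

lemma mock_delete:
  "g \<in> carrier (mock_group (Suc n)) \<Longrightarrow> mock_delete n k g \<in> carrier (mock_group n)"
  "\<lbrakk>g \<in> carrier (mock_group (Suc n)); h \<in> carrier (mock_group (Suc n))\<rbrakk> \<Longrightarrow>
     mock_delete n k (g \<otimes>\<^bsub>mock_group (Suc n)\<^esub> h) =
       mock_delete n (mock_rho (Suc n) h k) g \<otimes>\<^bsub>mock_group n\<^esub> mock_delete n k h"
  "\<lbrakk>1 \<le> i; i < j; j \<le> Suc n\<rbrakk> \<Longrightarrow> mock_delete n k (mock_gen (Suc n) i j) = mock.delete_value n i j k"
  unfolding mock_delete_def
  by (rule mock_crossed[OF mock.P.is_group];
      (assumption | rule mock.delete_value_closed mock.delete_value_square mock.delete_value_commute mock.delete_value_nested; linarith))+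

lemma mock_delete_one: "mock_delete n k \<one>\<^bsub>mock_group (Suc n)\<^esub> = \<one>\<^bsub>mock_group n\<^esub>"
proof -
  have "mock_delete n k \<one>\<^bsub>mock_group (Suc n)\<^esub> =
      mock_delete n k \<one>\<^bsub>mock_group (Suc n)\<^esub> \<otimes>\<^bsub>mock_group n\<^esub> mock_delete n k \<one>\<^bsub>mock_group (Suc n)\<^esub>"
    using mock_delete(2)[of "\<one>\<^bsub>mock_group (Suc n)\<^esub>" n "\<one>\<^bsub>mock_group (Suc n)\<^esub>" k] by (simp add: mock_rho_one)
  then show ?thesis
    using mock_delete(1)[of "\<one>\<^bsub>mock_group (Suc n)\<^esub>" n k] by simp
qed

lemma mock_rho_incl:
  assumes "m \<le> n" "g \<in> carrier (mock_group m)"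
  shows "mock_rho n (mock_incl m n g) = mock_rho m g"
  using assms(2)
proof (induction rule: mock_induct)
  case one
  then show ?case using assms(1) by (simp add: mock_incl_one mock_rho_one)
next
  case (mult i j g)
  then show ?case
    using assms(1) by (simp add: mock_incl_mult mock_rho_mult mock.s_closed mock_incl mock_incl_closed mock_rho)
qed

lemma mock_rho_clone:
  assumes "g \<in> carrier (mock_group n)"
  shows "mock_rho (Suc n) (mock_clone n k g) = perm_clone k (mock_rho n g)"
  using assms
proof (induction arbitrary: k rule: mock_induct)
  case one
  then show ?case by (simp add: mock_clone_one mock_rho_one perm_clone_id del: id_apply)
next
  case (mult i j g)
  note gen = mock.s_closed[of i j n]
  have s: "mock_rho (Suc n) (mock.clone_value (Suc n) i j k) = perm_clone k (reflect i j)" for k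
    using mult by (auto simp: mock.clone_value_def perm_clone_reflect mock_rho_mult mock.s_closed mock_rho)
  have clone: "mock_clone n k (mock_gen n i j \<otimes>\<^bsub>mock_group n\<^esub> g) =
      mock.clone_value (Suc n) i j (mock_rho n g k) \<otimes>\<^bsub>mock_group (Suc n)\<^esub> mock_clone n k g"
    using mult gen by (simp add: mock_clone)
  have "mock_rho (Suc n) (mock_clone n k (mock_gen n i j \<otimes>\<^bsub>mock_group n\<^esub> g)) =
      perm_clone (mock_rho n g k) (reflect i j) \<circ> perm_clone k (mock_rho n g)"
    unfolding clone using mult by (subst mock_rho_mult) (simp_all add: mock.clone_value_closed mock_clone s)
  also have "\<dots> = perm_clone k (reflect i j \<circ> mock_rho n g)"
    using permutes_inj[OF reflect_permutes[of i j n]] mult by (simp only: perm_clone_comp)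
  also have "reflect i j \<circ> mock_rho n g = mock_rho n (mock_gen n i j \<otimes>\<^bsub>mock_group n\<^esub> g)"
    using mult gen by (subst mock_rho_mult) (simp_all add: mock_rho)
  finally show ?case .
qed

lemma mock_delete_clone:
  assumes "g \<in> carrier (mock_group n)" "1 \<le> k" "k \<le> n"
  shows "mock_delete n k (mock_clone n k g) = g"
  using assms
proof (induction arbitrary: k rule: mock_induct)
  case one
  then show ?case by (simp add: mock_clone_one mock_delete_one)
next
  case (mult i j g)
  define l where "l = mock_rho n g k"
  have l: "1 \<le> l" "l \<le> n"
    using permutes_in_image[OF mock_rho_permutes[OF mult(4)], of k] mult by (auto simp: l_def)
  have s: "mock_delete n l (mock.clone_value (Suc n) i j l) = mock_gen n i j"
  proof (cases "i \<le> l \<and> l \<le> j")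
    case True
    have "reflect l (l + 1) l = l + 1" by (simp add: reflect_def)
    then show ?thesis
      using True mult l
      by (auto simp: mock.clone_value_def mock_delete mock.s_closed mock_rho mock.delete_value_def mock.s_trivial)
  next
    case False
    then show ?thesis
      using mult l by (auto simp: mock.clone_value_def mock_delete mock.delete_value_def)
  qed
  have "perm_clone k (mock_rho n g) k = l"
    by (simp add: perm_clone_def l_def)
  then show ?case
    using mult s mock.s_closed[of i j n]
    by (simp add: mock_clone mock_delete mock.clone_value_closed mock_rho_clone flip: l_def)
qed

lemma mock_delete_incl:
  assumes "g \<in> carrier (mock_group n)"
  shows "mock_delete n (Suc n) (mock_incl n (Suc n) g) = g"
  using assms
proof (induction rule: mock_induct)
  case one
  then show ?case by (simp add: mock_incl_one mock_delete_one)
next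
  case (mult i j g)
  have "mock_rho n g (Suc n) = Suc n"
    using mult by (intro permutes_not_in[OF mock_rho_permutes]) auto
  then show ?case
    using mult mock.s_closed[of i j n]
    by (simp add: mock_incl_mult mock_incl mock_delete mock_incl_closed mock.s_closed mock_rho_incl mock.delete_value_def)
qed

lemma mock_incl_incl:
  assumes "m \<le> n" "n \<le> l" "g \<in> carrier (mock_group m)"
  shows "mock_incl n l (mock_incl m n g) = mock_incl m l g"
  using assms(3)
proof (induction rule: mock_induct)
  case one
  then show ?case using assms by (simp add: mock_incl_one)
next
  case (mult i j g)
  then show ?case
    using assms by (simp add: mock_incl_mult mock.s_closed mock_incl mock_incl_closed)
qed

lemma mock_incl_refl: "g \<in> carrier (mock_group n) \<Longrightarrow> mock_incl n n g = g"
proof (induction rule: mock_induct)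
  case one
  then show ?case by (simp add: mock_incl_one)
next
  case (mult i j g)
  then show ?case by (simp add: mock_incl_mult mock.s_closed mock_incl)
qed

lemma inj_on_mock_incl: "m \<le> n \<Longrightarrow> inj_on (mock_incl m n) (carrier (mock_group m))"
proof (induction n rule: dec_induct)
  case base
  show ?case by (rule inj_onI) (simp add: mock_incl_refl)
next
  case (step n)
  show ?case
  proof (rule inj_onI)
    fix g h
    assume g: "g \<in> carrier (mock_group m)" and h: "h \<in> carrier (mock_group m)"
      and "mock_incl m (Suc n) g = mock_incl m (Suc n) h"
    then have "mock_incl n (Suc n) (mock_incl m n g) = mock_incl n (Suc n) (mock_incl m n h)"
      using step by (simp add: mock_incl_incl)
    then have "mock_incl m n g = mock_incl m n h"
      using g h step.hyps(1) mock_delete_incl mock_incl_closed by metis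
    then show "g = h"
      using step.IH g h by (auto dest: inj_onD)
  qed
qed

lemma mock_clone_incl:
  assumes "m \<le> n" "g \<in> carrier (mock_group m)"
  shows "mock_clone n k (mock_incl m n g) = mock_incl (Suc m) (Suc n) (mock_clone m k g)"
  using assms(2)
proof (induction arbitrary: k rule: mock_induct)
  case one
  then show ?case using assms by (simp add: mock_incl_one mock_clone_one)
next
  case (mult i j g)
  have s: "mock.clone_value (Suc n) i j k = mock_incl (Suc m) (Suc n) (mock.clone_value (Suc m) i j k)" for k
    using mult assms(1)
    by (auto simp: mock.clone_value_def mock_incl_mult mock.s_closed mock_incl)
  show ?case
    using mult assms(1)
    by (simp add: mock_incl_mult mock_clone mock.s_closed mock_incl_closed mock_incl mock_rho_incl s
        mock.clone_value_closed)
qed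

lemma mock_clone_beyond:
  assumes "g \<in> carrier (mock_group n)" "n < k"
  shows "mock_clone n k g = mock_incl n (Suc n) g"
  using assms(1)
proof (induction rule: mock_induct)
  case one
  then show ?case by (simp add: mock_incl_one mock_clone_one)
next
  case (mult i j g)
  have "mock_rho n g k = k"
    using mult assms(2) by (intro permutes_not_in[OF mock_rho_permutes]) auto
  then show ?case
    using mult assms(2)
    by (simp add: mock_incl_mult mock_clone mock.s_closed mock_incl mock.clone_value_def)
qed

text \<open>It suffices to treat a generator \<open>s\<^bsub>i,j\<^esub>\<close>, but for all pairs of positions: in a product
  \<open>s\<^bsub>i,j\<^esub> g\<close> the generator is cloned at the images of \<open>k\<close> and \<open>l\<close> under \<open>\<rho>(g)\<close>, and if \<open>\<rho>(g)\<close>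
  reverses their order, the identity is used from right to left.\<close>

lemma mock_clone_clone:
  assumes "g \<in> carrier (mock_group n)" "k < l"
  shows "mock_clone (Suc n) k (mock_clone n l g) = mock_clone (Suc n) (l + 1) (mock_clone n k g)"
  using assms
proof (induction arbitrary: k l rule: mock_induct)
  case one
  then show ?case by (simp add: mock_clone_one)
next
  case (mult i j g)
  let ?t = "mock_gen (Suc (Suc n))"
  have s: "mock_clone (Suc n) k (mock.clone_value (Suc n) i j l) = mock_clone (Suc n) (l + 1) (mock.clone_value (Suc n) i j k)"
    if "k < l" for k l
  proof -
    from that consider "l < i" | "i \<le> l" "l \<le> j" "k < i" | "i \<le> k" "l \<le> j" | "j < l" "k < i" | "j < l" "i \<le> k" "k \<le> j" | "j < k"
      by (meson not_le)
    then show ?thesis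
    proof cases
      case 3
      have "reflect l (l + 1) k = k" "reflect k (k + 1) (l + 1) = l + 1"
        using that by (auto simp: reflect_def)
      then have "mock_clone (Suc n) k (mock.clone_value (Suc n) i j l) =
          ?t i (j + 2) \<otimes>\<^bsub>mock_group (Suc (Suc n))\<^esub> ?t k (k + 1) \<otimes>\<^bsub>mock_group (Suc (Suc n))\<^esub> ?t (l + 1) (l + 2)"
        "mock_clone (Suc n) (l + 1) (mock.clone_value (Suc n) i j k) =
          ?t i (j + 2) \<otimes>\<^bsub>mock_group (Suc (Suc n))\<^esub> ?t (l + 1) (l + 2) \<otimes>\<^bsub>mock_group (Suc (Suc n))\<^esub> ?t k (k + 1)"
        using 3 mult that by (simp_all add: mock.clone_value_def mock_clone mock.s_closed mock_rho)
      then show ?thesis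
        using 3 mult that mock.s_commute[of k "k + 1" "l + 1" "l + 2" "Suc (Suc n)"]
        by (simp add: mock.P.m_assoc mock.s_closed)
    qed (use mult that in \<open>simp_all add: mock.clone_value_def mock_clone mock.s_closed mock_rho reflect_def\<close>)
  qed
  define \<sigma> where "\<sigma> = mock_rho n g"
  have inj: "\<sigma> k \<noteq> \<sigma> l"
    using permutes_inj[OF mock_rho_permutes[OF mult(4)]] mult by (auto simp: \<sigma>_def dest: injD)
  have "mock_clone (Suc n) (perm_clone l \<sigma> k) (mock.clone_value (Suc n) i j (\<sigma> l)) =
      mock_clone (Suc n) (perm_clone k \<sigma> (l + 1)) (mock.clone_value (Suc n) i j (\<sigma> k))"
  proof (cases "\<sigma> k < \<sigma> l")
    case True
    then show ?thesis
      using s[OF True] perm_clone_less[OF \<open>k < l\<close>, of \<sigma>] by simp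
  next
    case False
    then have less: "\<sigma> l < \<sigma> k" using inj by simp
    then show ?thesis
      using s[OF less] perm_clone_less[OF \<open>k < l\<close>, of \<sigma>] by simp
  qed
  then show ?case
    using mult mock.s_closed[of i j n]
    by (simp add: mock_clone mock.clone_value_closed mock_rho_clone flip: \<sigma>_def)
qed

lemma mock_exact_cloning_system: "exact_cloning_system mock_group mock_incl mock_rho mock_clone"
proof (intro exact_cloning_system.intro cloning_system.intro exact_cloning_system_axioms.intro)
  show "group (mock_group n)" for n by (rule mock.P.is_group)
  show "mock_incl m n \<in> mon (mock_group m) (mock_group n)" if "m \<le> n" for m n
    using that by (simp add: mon_def mock_incl(1) inj_on_mock_incl)
  show "mock_rho n \<in> hom (mock_group n) (sym_group n)" for n
    by (rule mock_rho(1))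
  show "inj_on (mock_clone n k) (carrier (mock_group n))" if "1 \<le> k" "k \<le> n" for n k
    using that by (intro inj_on_inverseI[of _ "mock_delete n k"]) (simp add: mock_delete_clone)
  show "mock_clone n k (mock_incl m n g) =
      (if k \<le> m then mock_incl (m + 1) (n + 1) (mock_clone m k g) else mock_incl m (n + 1) g)"
    if "m \<le> n" "g \<in> carrier (mock_group m)" for m n k g
    using that by (simp add: mock_clone_incl mock_clone_beyond mock_incl_incl)
qed (auto simp: mock_clone mock_rho_incl mock_incl_refl mock_incl_incl mock_rho_clone mock_clone_clone)

lemma mock_generator_values_mock: "mock_generator_values mock_incl mock_rho mock_clone"
  unfolding mock_generator_values_def
  by (auto simp: mock_s_mock_gen mock_incl mock_rho mock_clone mock.clone_value_def reflect_def)

text \<open>The transposition of \<open>i\<close> and \<open>j\<close> is the product of the reflections of the intervals from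
  \<open>i\<close> to \<open>j\<close> and from \<open>i + 1\<close> to \<open>j - 1\<close>.\<close>

lemma mock_rho_surj: "mock_rho n ` carrier (mock_group n) = carrier (sym_group n)"
proof (intro equalityI subsetI)
  fix \<sigma>
  assume "\<sigma> \<in> mock_rho n ` carrier (mock_group n)"
  then show "\<sigma> \<in> carrier (sym_group n)"
    using hom_in_carrier[OF mock_rho(1)] by blast
next
  fix \<sigma>
  assume "\<sigma> \<in> carrier (sym_group n)"
  then have "\<sigma> permutes {1..n}" by (simp add: sym_group_carrier)
  moreover have "finite {1..n}" by simp
  ultimately show "\<sigma> \<in> mock_rho n ` carrier (mock_group n)"
  proof (induction rule: permutes_induct)
    case id
    then show ?case
      using mock_rho_one[of n] mock.P.one_closed[of n] by (metis image_eqI)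
  next
    case (swap a b \<sigma>)
    have transp: "\<exists>g \<in> carrier (mock_group n). mock_rho n g = transpose i j"
      if "1 \<le> i" "i < j" "j \<le> n" for i j
    proof (cases "i + 1 < j - 1")
      case True
      have "reflect i j \<circ> reflect (i + 1) (j - 1) = transpose i j"
        using that by (intro ext) (auto simp: reflect_def transpose_def)
      then show ?thesis
        using True that mock.s_closed[of i j n] mock.s_closed[of "i + 1" "j - 1" n]
        by (intro bexI[of _ "mock_gen n i j \<otimes>\<^bsub>mock_group n\<^esub> mock_gen n (i + 1) (j - 1)"])
          (auto simp: mock_rho_mult mock_rho)
    next
      case False
      then have "reflect i j = transpose i j"
        using that by (intro ext) (auto simp: reflect_def transpose_def)
      then show ?thesis
        using that mock.s_closed[of i j n] by (intro bexI[of _ "mock_gen n i j"]) (auto simp: mock_rho)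
    qed
    have "\<exists>g \<in> carrier (mock_group n). mock_rho n g = transpose a b"
      using transp[of a b] transp[of b a] swap(1-3) by (cases a b rule: linorder_cases) (auto simp: transpose_commute)
    then obtain g h where "g \<in> carrier (mock_group n)" "h \<in> carrier (mock_group n)"
        "mock_rho n g = transpose a b" "mock_rho n h = \<sigma>"
      using swap by auto
    then show ?case
      using mock_rho_mult[of g n h] by (metis image_eqI mock.P.m_closed)
  qed
qed


section \<open>Conjugates of generators in free groups\<close>

definition exponent_sum :: "'x \<Rightarrow> 'x fword \<Rightarrow> int" where
  "exponent_sum i = free_extension integer_group (\<lambda>j. if j = i then 1 else 0)"

lemma exponent_sum_hom: "exponent_sum i \<in> hom (free_group X) integer_group"
  unfolding exponent_sum_def by (rule free_extension_hom) auto

lemma exponent_sum_letter: "exponent_sum i [(j, b)] = (if j = i then if b then 1 else -1 else 0)"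
  by (simp add: exponent_sum_def free_extension_def)

lemma exponent_sum_Cons: "exponent_sum i (a # w) = exponent_sum i [a] + exponent_sum i w"
  by (cases a) (simp add: exponent_sum_def free_extension_def)

lemma foldr_push_letter_last:
  "freely_reduced w \<Longrightarrow>
     foldr push_letter w [a] = (if w \<noteq> [] \<and> last w = flip a then butlast w else w @ [a])"
proof (induction w)
  case (Cons b w)
  then have IH: "foldr push_letter w [a] = (if w \<noteq> [] \<and> last w = flip a then butlast w else w @ [a])"
    and b: "w = [] \<or> hd w \<noteq> flip b"
    by (auto simp: freely_reduced_Cons)
  show ?case
  proof (cases w)
    case Nil
    have "a = flip b \<longleftrightarrow> b = flip a"
      by (metis flip_flip(1))
    then show ?thesis
      using Nil by (simp add: push_letter_Cons)
  next
    case (Cons c v)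
    then show ?thesis
      using IH b by (cases v rule: rev_cases) (auto simp: push_letter_Cons split: if_splits)
  qed
qed simp

text \<open>An element commuting with the generator \<open>x\<^sub>i\<close> is a power of it.  If its first letter is a
  power of \<open>x\<^sub>i\<close>, it may be removed; if it is not, multiplication by \<open>x\<^sub>i\<close> on the left and on
  the right yields words with different first letters.\<close>

lemma commuting_word_letters:
  assumes "w \<in> carrier (free_group X)" "i \<in> X"
    and "[(i, True)] \<otimes>\<^bsub>free_group X\<^esub> w = w \<otimes>\<^bsub>free_group X\<^esub> [(i, True)]"
  shows "fst ` set w \<subseteq> {i}"
  using assms(1,3)
proof (induction w)
  case (Cons a w)
  interpret group "free_group X" by (rule group_free_group)
  let ?x = "[(i, True)]"
  obtain j b where a: "a = (j, b)" by fastforce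
  note w = free_group_Cons[OF Cons.prems(1)[unfolded a]]
  have x: "?x \<in> carrier (free_group X)" "[a] \<in> carrier (free_group X)"
    using assms(2) w(1) by (auto simp: letter_closed a)
  show ?case
  proof (cases "j = i")
    case True
    have commute: "?x \<otimes>\<^bsub>free_group X\<^esub> [a] = [a] \<otimes>\<^bsub>free_group X\<^esub> ?x"
      using True by (cases b) (auto simp: mult_free_group push_letter_Cons flip_def a)
    have "[a] \<otimes>\<^bsub>free_group X\<^esub> (?x \<otimes>\<^bsub>free_group X\<^esub> w) = [a] \<otimes>\<^bsub>free_group X\<^esub> (w \<otimes>\<^bsub>free_group X\<^esub> ?x)"
      using Cons.prems(2) x w commute unfolding a by (simp flip: m_assoc)
    then have "?x \<otimes>\<^bsub>free_group X\<^esub> w = w \<otimes>\<^bsub>free_group X\<^esub> ?x"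
      using x w by simp
    then show ?thesis
      using Cons.IH[OF w(2)] True a by simp
  next
    case False
    have red: "freely_reduced (a # w)"
      using Cons.prems(1) by (simp add: carrier_free_group)
    have "(i, True) # a # w = foldr push_letter (a # w) ?x"
      using Cons.prems(2) False by (simp add: mult_free_group push_letter_Cons flip_def a)
    then have "(i, True) # a # w = a # w @ ?x \<or> (i, True) # a # w = butlast (a # w)"
      unfolding foldr_push_letter_last[OF red] by (auto split: if_splits)
    moreover have "length ((i, True) # a # w) \<noteq> length (butlast (a # w))"
      by simp
    ultimately show ?thesis
      using False a by auto
  qed
qed simp

lemma word_in_one_letter:
  assumes "freely_reduced w" "fst ` set w \<subseteq> {i}" "exponent_sum i w = 0"
  shows "w = []"
proof (rule ccontr)
  assume "w \<noteq> []"
  have "set w \<subseteq> {(i, snd (hd w))} \<and> exponent_sum i w = (if snd (hd w) then int (length w) else - int (length w))"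
    if "w \<noteq> []" "freely_reduced w" "fst ` set w \<subseteq> {i}" for w
    using that
  proof (induction w)
    case (Cons a w)
    obtain b where a: "a = (i, b)"
      using Cons.prems by (cases a) auto
    show ?case
    proof (cases w)
      case Nil
      then show ?thesis by (simp add: a exponent_sum_letter)
    next
      case (Cons c v)
      obtain d where c: "c = (i, d)"
        using Cons.prems Cons by (cases c) auto
      have "d = b"
        using Cons.prems Cons by (auto simp: freely_reduced_Cons flip_def a c)
      then show ?thesis
        using Cons.IH Cons.prems Cons
        by (subst exponent_sum_Cons) (auto simp: freely_reduced_Cons a c exponent_sum_letter)
    qed
  qed simp
  from this[OF \<open>w \<noteq> []\<close> assms(1,2)] show False
    using assms(3) \<open>w \<noteq> []\<close> by (auto split: if_splits)
qed

text \<open>The sets \<open>{1..n}\<close> in the definition of free groups of finite rank are hidden from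
  simplification.\<close>

definition F :: "nat \<Rightarrow> nat fword monoid" where
  "F n = free_rank n"

interpretation F: group "F n" for n
  unfolding F_def by (rule group_free_group)

lemma free_gen_closed [simp]: "0 < i \<Longrightarrow> i \<le> n \<Longrightarrow> free_gen i \<in> carrier (F n)"
  unfolding F_def by (rule letter_closed) simp

lemma F_hom_eq:
  assumes "f \<in> hom (F n) (F m)" "f' \<in> hom (F n) (F m)"
    and "\<And>i. 0 < i \<Longrightarrow> i \<le> n \<Longrightarrow> f (free_gen i) = f' (free_gen i)" and "w \<in> carrier (F n)"
  shows "f w = f' w"
  by (rule hom_free_group_eq[OF _ assms(1)[unfolded F_def[of n]] assms(2)[unfolded F_def[of n]]])
    (use assms in \<open>auto simp: F_def[of n] F.is_group\<close>)

lemma F_extension: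
  assumes "\<And>i. 0 < i \<Longrightarrow> i \<le> n \<Longrightarrow> f i \<in> carrier (F m)"
  shows "free_extension (F m) f \<in> hom (F n) (F m)"
    and "0 < i \<Longrightarrow> i \<le> n \<Longrightarrow> free_extension (F m) f (free_gen i) = f i"
  using free_extension_hom[OF F.is_group, of "{1..n}" f m] assms by (auto simp: F_def[of n])

lemma exponent_sum_mult:
  "u \<in> carrier (F n) \<Longrightarrow> v \<in> carrier (F n) \<Longrightarrow> exponent_sum i (u \<otimes>\<^bsub>F n\<^esub> v) = exponent_sum i u + exponent_sum i v"
  using hom_mult[OF exponent_sum_hom, of u "{1..n}" v i] by (simp add: F_def)

lemma exponent_sum_one: "exponent_sum i \<one>\<^bsub>F n\<^esub> = 0"
  using hom_one[OF exponent_sum_hom group_free_group group_integer_group, of i "{1..n}"] by (simp add: F_def)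

lemma exponent_sum_inv: "u \<in> carrier (F n) \<Longrightarrow> exponent_sum i (inv\<^bsub>F n\<^esub> u) = - exponent_sum i u"
  using exponent_sum_mult[of u n "inv\<^bsub>F n\<^esub> u" i] by (simp add: exponent_sum_one)

lemma F_hom_exponent_sum_eq:
  assumes "f \<in> hom (F n) (F m)" "w \<in> carrier (F n)"
    and "\<And>j. 0 < j \<Longrightarrow> j \<le> n \<Longrightarrow> exponent_sum i (f (free_gen j)) = exponent_sum i' (free_gen j)"
  shows "exponent_sum i (f w) = exponent_sum i' w"
proof -
  have "(\<lambda>w. exponent_sum i (f w)) \<in> hom (free_group {1..n}) integer_group"
    using hom_compose[OF assms(1) exponent_sum_hom[of i "{1..m}", folded F_def]]
    by (simp add: comp_def F_def[of n])
  from hom_free_group_eq[OF group_integer_group this exponent_sum_hom[of i']] show ?thesis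
    using assms(2,3) by (simp add: F_def[of n])
qed

abbreviation conjugate :: "nat \<Rightarrow> nat fword \<Rightarrow> nat \<Rightarrow> nat fword" where
  "conjugate n w i \<equiv> inv\<^bsub>F n\<^esub> w \<otimes>\<^bsub>F n\<^esub> free_gen i \<otimes>\<^bsub>F n\<^esub> w"

lemma exponent_sum_conj:
  "w \<in> carrier (F n) \<Longrightarrow> 0 < i \<Longrightarrow> i \<le> n \<Longrightarrow> exponent_sum j (conjugate n w i) = (if i = j then 1 else 0)"
  by (simp add: exponent_sum_mult exponent_sum_inv exponent_sum_letter)

lemma conj_conj:
  "\<lbrakk>u \<in> carrier (F n); w \<in> carrier (F n); 0 < i; i \<le> n\<rbrakk> \<Longrightarrow>
     inv\<^bsub>F n\<^esub> u \<otimes>\<^bsub>F n\<^esub> conjugate n w i \<otimes>\<^bsub>F n\<^esub> u = conjugate n (w \<otimes>\<^bsub>F n\<^esub> u) i"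
  by (simp add: F.m_assoc F.inv_mult_group)

text \<open>Two elements that conjugate \<open>x\<^sub>i\<close> to the same element differ by a factor in the centraliser of
  \<open>x\<^sub>i\<close>, a power of \<open>x\<^sub>i\<close>, which is detected by the exponent sum.\<close>

lemma conj_inject:
  assumes "conjugate n u i = conjugate n v i" "exponent_sum i u = exponent_sum i v"
    and [simp]: "u \<in> carrier (F n)" "v \<in> carrier (F n)" "0 < i" "i \<le> n"
  shows "u = v"
proof -
  define w where "w = u \<otimes>\<^bsub>F n\<^esub> inv\<^bsub>F n\<^esub> v"
  have w [simp]: "w \<in> carrier (F n)" by (simp add: w_def)
  have "u \<otimes>\<^bsub>F n\<^esub> conjugate n u i \<otimes>\<^bsub>F n\<^esub> inv\<^bsub>F n\<^esub> v = u \<otimes>\<^bsub>F n\<^esub> conjugate n v i \<otimes>\<^bsub>F n\<^esub> inv\<^bsub>F n\<^esub> v"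
    unfolding assms(1) ..
  moreover have "u \<otimes>\<^bsub>F n\<^esub> conjugate n u i \<otimes>\<^bsub>F n\<^esub> inv\<^bsub>F n\<^esub> v = free_gen i \<otimes>\<^bsub>F n\<^esub> w"
  proof -
    have "u \<otimes>\<^bsub>F n\<^esub> conjugate n u i = free_gen i \<otimes>\<^bsub>F n\<^esub> u"
      by (simp flip: F.m_assoc)
    then show ?thesis by (simp add: w_def F.m_assoc)
  qed
  moreover have "u \<otimes>\<^bsub>F n\<^esub> conjugate n v i \<otimes>\<^bsub>F n\<^esub> inv\<^bsub>F n\<^esub> v = w \<otimes>\<^bsub>F n\<^esub> free_gen i"
    by (simp add: w_def F.m_assoc)
  ultimately have "free_gen i \<otimes>\<^bsub>F n\<^esub> w = w \<otimes>\<^bsub>F n\<^esub> free_gen i"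
    by simp
  then have "fst ` set w \<subseteq> {i}"
    using w commuting_word_letters[of w "{1..n}" i] by (simp add: F_def Suc_leI)
  moreover have "freely_reduced w"
    using w by (simp add: F_def carrier_free_group)
  moreover have "exponent_sum i w = 0"
    using assms(2) by (simp add: w_def exponent_sum_mult exponent_sum_inv)
  ultimately have "w = []"
    by (intro word_in_one_letter)
  then have "w = \<one>\<^bsub>F n\<^esub>"
    by (simp add: F_def one_free_group)
  then have "inv\<^bsub>F n\<^esub> (inv\<^bsub>F n\<^esub> v) = u"
    unfolding w_def by (intro F.inv_equality) auto
  then show ?thesis by simp
qed

lemma conj_normalise:
  assumes "w \<in> carrier (F n)" "0 < i" "i \<le> n"
  shows "\<exists>v \<in> carrier (F n). exponent_sum i v = 0 \<and> conjugate n v i = conjugate n w i"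
  using assms(1)
proof (induction "nat \<bar>exponent_sum i w\<bar>" arbitrary: w rule: less_induct)
  case less
  note [simp] = less.prems assms(2,3)
  have shift: "conjugate n (inv\<^bsub>F n\<^esub> free_gen i \<otimes>\<^bsub>F n\<^esub> w) i = conjugate n w i" "conjugate n (free_gen i \<otimes>\<^bsub>F n\<^esub> w) i = conjugate n w i"
    by (simp_all add: F.inv_mult_group F.m_assoc) (simp_all flip: F.m_assoc)
  consider "exponent_sum i w = 0" | "exponent_sum i w > 0" | "exponent_sum i w < 0" by linarith
  then show ?case
  proof cases
    case 1
    then show ?thesis by (intro bexI[of _ w]) auto
  next
    case 2
    let ?v = "inv\<^bsub>F n\<^esub> free_gen i \<otimes>\<^bsub>F n\<^esub> w"
    have "nat \<bar>exponent_sum i ?v\<bar> < nat \<bar>exponent_sum i w\<bar>"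
      using 2 by (simp add: exponent_sum_mult exponent_sum_inv exponent_sum_letter)
    from less.hyps[OF this] show ?thesis by (simp add: shift)
  next
    case 3
    let ?v = "free_gen i \<otimes>\<^bsub>F n\<^esub> w"
    have "nat \<bar>exponent_sum i ?v\<bar> < nat \<bar>exponent_sum i w\<bar>"
      using 3 by (simp add: exponent_sum_mult exponent_sum_letter)
    from less.hyps[OF this] show ?thesis by (simp add: shift)
  qed
qed


section \<open>Loop braid groups\<close>

text \<open>An endomorphism \<open>x\<^sub>i \<mapsto> w\<^sub>i\<inverse> x\<^bsub>p i\<^esub> w\<^sub>i\<close> with a permutation \<open>p\<close> determines \<open>w\<^sub>i\<close> up to
  powers of \<open>x\<^bsub>p i\<^esub>\<close> on the left, and uniquely if the exponent sum of \<open>x\<^bsub>p i\<^esub>\<close> in \<open>w\<^sub>i\<close> is to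
  vanish.  This normalisation is stable under composition, which is what makes a definition of the
  cloning maps in terms of the \<open>w\<^sub>i\<close> obey the product rule.\<close>

definition conj_endo :: "nat \<Rightarrow> (nat fword \<Rightarrow> nat fword) \<Rightarrow> (nat \<Rightarrow> nat) \<Rightarrow> (nat \<Rightarrow> nat fword) \<Rightarrow> bool" where
  "conj_endo n g p w \<longleftrightarrow> g \<in> hom (F n) (F n) \<and> g \<in> extensional (carrier (F n)) \<and>
     p \<in> carrier (sym_group n) \<and>
     (\<forall>i. 0 < i \<and> i \<le> n \<longrightarrow> w i \<in> carrier (F n) \<and> exponent_sum (p i) (w i) = 0 \<and>
        g (free_gen i) = conjugate n (w i) (p i))"

lemma sym_range: "p \<in> carrier (sym_group n) \<Longrightarrow> 0 < p i \<and> p i \<le> n \<longleftrightarrow> 0 < i \<and> i \<le> n"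
  using permutes_in_image[of p "{1..n}" i] by (auto simp: sym_group_carrier Suc_le_eq)

lemma sym_eq_iff: "p \<in> carrier (sym_group n) \<Longrightarrow> p i = p j \<longleftrightarrow> i = j"
  using permutes_inj[of p "{1..n}"] by (auto simp: sym_group_carrier dest: injD)

lemma sym_fix: "p \<in> carrier (sym_group n) \<Longrightarrow> n < i \<Longrightarrow> p i = i"
  using permutes_not_in[of p "{1..n}" i] by (simp add: sym_group_carrier)

lemma sym_inv:
  assumes "p \<in> carrier (sym_group n)"
  shows "inv' p \<in> carrier (sym_group n)" "p (inv' p i) = i" "inv' p (p i) = i" "inv' (inv' p) = p"
  using assms by (auto simp: sym_group_carrier permutes_inv permutes_inverses permutes_inv_inv)

lemma conj_endoD:
  assumes "conj_endo n g p w"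
  shows "g \<in> hom (F n) (F n)" "g \<in> extensional (carrier (F n))" "p \<in> carrier (sym_group n)"
    "0 < i \<Longrightarrow> i \<le> n \<Longrightarrow> w i \<in> carrier (F n)"
    "0 < i \<Longrightarrow> i \<le> n \<Longrightarrow> exponent_sum (p i) (w i) = 0"
    "0 < i \<Longrightarrow> i \<le> n \<Longrightarrow> g (free_gen i) = conjugate n (w i) (p i)"
    "0 < i \<Longrightarrow> i \<le> n \<Longrightarrow> 0 < p i" "0 < i \<Longrightarrow> i \<le> n \<Longrightarrow> p i \<le> n"
    "u \<in> carrier (F n) \<Longrightarrow> g u \<in> carrier (F n)"
  using assms sym_range[of p n i] by (auto simp: conj_endo_def dest: hom_in_carrier)

lemma conj_endo_apply:
  assumes "conj_endo n g p w" "u \<in> carrier (F n)" "0 < i" "i \<le> n"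
  shows "g (conjugate n u i) = conjugate n (w i \<otimes>\<^bsub>F n\<^esub> g u) (p i)"
proof -
  note D = conj_endoD[OF assms(1)]
  interpret g: group_hom "F n" "F n" g
    using D(1) by unfold_locales
  have "g (conjugate n u i) = inv\<^bsub>F n\<^esub> g u \<otimes>\<^bsub>F n\<^esub> g (free_gen i) \<otimes>\<^bsub>F n\<^esub> g u"
    using assms by simp
  then show ?thesis
    using assms D by (simp add: conj_conj)
qed

text \<open>Up to conjugation \<open>g\<close> permutes the generators, so it permutes the exponent sums.\<close>

lemma exponent_sum_conj_endo:
  assumes "conj_endo n g p w" "u \<in> carrier (F n)" "0 < i" "i \<le> n"
  shows "exponent_sum (p i) (g u) = exponent_sum i u"
proof (rule F_hom_exponent_sum_eq)
  note D = conj_endoD[OF assms(1)]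
  show "g \<in> hom (F n) (F n)" by (rule D)
  show "exponent_sum (p i) (g (free_gen j)) = exponent_sum i (free_gen j)" if "0 < j" "j \<le> n" for j
    using that D sym_eq_iff[OF D(3)] by (simp add: exponent_sum_conj exponent_sum_letter)
qed fact

lemma conj_endo_compose:
  assumes "conj_endo n g p w" "conj_endo n h r v"
  shows "conj_endo n (compose (carrier (F n)) h g) (r \<circ> p) (\<lambda>i. v (p i) \<otimes>\<^bsub>F n\<^esub> h (w i))"
proof -
  note D = conj_endoD[OF assms(1)] and E = conj_endoD[OF assms(2)]
  have "r \<circ> p \<in> carrier (sym_group n)"
    using group.is_monoid[OF sym_group_is_group] monoid.m_closed D(3) E(3) by (metis sym_group_mult)
  moreover have "compose (carrier (F n)) h g \<in> hom (F n) (F n)"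
    using D(1,9) E(1) F.hom_compose by blast
  ultimately show ?thesis
    unfolding conj_endo_def
    using D E by (auto simp: compose_eq conj_endo_apply[OF assms(2)] exponent_sum_mult
        exponent_sum_conj_endo[OF assms(2)] compose_extensional)
qed

lemma conj_endo_unique:
  assumes "conj_endo n g p w" "conj_endo n g p' w'"
  shows "p = p'" and "0 < i \<Longrightarrow> i \<le> n \<Longrightarrow> w i = w' i"
proof -
  note D = conj_endoD[OF assms(1)] and E = conj_endoD[OF assms(2)]
  have p: "p i = p' i" if "0 < i" "i \<le> n" for i
  proof -
    have "exponent_sum (p i) (conjugate n (w i) (p i)) = exponent_sum (p i) (conjugate n (w' i) (p' i))"
      using that D(6) E(6) by metis
    then show ?thesis
      using that D(4,7,8) E(4,7,8) by (simp add: exponent_sum_conj split: if_splits)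
  qed
  show "p = p'"
  proof
    fix i
    show "p i = p' i"
      using p[of i] permutes_not_in[of p "{1..n}" i] permutes_not_in[of p' "{1..n}" i] D(3) E(3)
      by (cases "0 < i \<and> i \<le> n") (auto simp: sym_group_carrier)
  qed
  show "w i = w' i" if "0 < i" "i \<le> n"
    using that p[OF that] D(4-8)[OF that] E(4-6)[OF that] by (intro conj_inject[of n "w i" "p i" "w' i"]) simp_all
qed

lemma conj_endo_eqI:
  assumes "conj_endo n g p w" "conj_endo n g' p' w'" "p = p'" "\<And>i. 0 < i \<Longrightarrow> i \<le> n \<Longrightarrow> w i = w' i"
  shows "g = g'"
proof (rule extensionalityI)
  note D = conj_endoD[OF assms(1)] and E = conj_endoD[OF assms(2)]
  show "g \<in> extensional (carrier (F n))" "g' \<in> extensional (carrier (F n))"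
    by (rule D E)+
  show "g u = g' u" if "u \<in> carrier (F n)" for u
    using D(1) E(1) by (rule F_hom_eq) (use that assms(3,4) D(6) E(6) in auto)
qed

lemma free_endo_hom:
  assumes "\<And>i. 0 < i \<Longrightarrow> i \<le> n \<Longrightarrow> f i \<in> carrier (F n)"
  shows "free_endo n f \<in> hom (F n) (F n)" "free_endo n f \<in> extensional (carrier (F n))"
    and "0 < i \<Longrightarrow> i \<le> n \<Longrightarrow> free_endo n f (free_gen i) = f i"
proof -
  note e = F_extension[of n f n, OF assms]
  show "free_endo n f \<in> hom (F n) (F n)"
    using e(1) unfolding free_endo_def F_def[symmetric]
    by (auto simp: hom_def Pi_def)
  show "free_endo n f \<in> extensional (carrier (F n))"
    unfolding free_endo_def F_def[symmetric] by simp
  show "0 < i \<Longrightarrow> i \<le> n \<Longrightarrow> free_endo n f (free_gen i) = f i"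
    using e(2) unfolding free_endo_def F_def[symmetric] by simp
qed

lemma conj_endo_free_endo:
  assumes "p \<in> carrier (sym_group n)"
    and "\<And>i. 0 < i \<Longrightarrow> i \<le> n \<Longrightarrow> w i \<in> carrier (F n) \<and> exponent_sum (p i) (w i) = 0"
    and "\<And>i. 0 < i \<Longrightarrow> i \<le> n \<Longrightarrow> f i = conjugate n (w i) (p i)"
  shows "conj_endo n (free_endo n f) p w"
proof -
  have "f i \<in> carrier (F n)" if "0 < i" "i \<le> n" for i
    using that assms(2,3) sym_range[OF assms(1), of i] by simp
  from free_endo_hom[of n f, OF this] show ?thesis
    unfolding conj_endo_def using assms by simp
qed

lemma conj_endo_id: "conj_endo n (\<lambda>u \<in> carrier (F n). u) id (\<lambda>i. \<one>\<^bsub>F n\<^esub>)"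
  unfolding conj_endo_def
  by (auto simp: hom_def sym_group_carrier permutes_id exponent_sum_one)

lemma AutoGroup_mult:
  "g \<in> carrier (AutoGroup (F n)) \<Longrightarrow> h \<in> carrier (AutoGroup (F n)) \<Longrightarrow>
     g \<otimes>\<^bsub>AutoGroup (F n)\<^esub> h = compose (carrier (F n)) g h"
  by (simp add: AutoGroup_def BijGroup_def auto_def)

lemma LB_carrier_auto: "g \<in> carrier (LB n) \<Longrightarrow> g \<in> carrier (AutoGroup (F n))"
  by (simp add: LB_def F_def)

lemma LB_iff:
  "g \<in> carrier (LB n) \<longleftrightarrow> g \<in> carrier (AutoGroup (F n)) \<and>
     (\<forall>i. 0 < i \<and> i \<le> n \<longrightarrow> (\<exists>j w. 0 < j \<and> j \<le> n \<and> w \<in> carrier (F n) \<and> g (free_gen i) = conjugate n w j))"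
proof -
  have "(\<forall>i \<in> {1..n}. \<exists>j \<in> {1..n}. P i j) \<longleftrightarrow> (\<forall>i. 0 < i \<and> i \<le> n \<longrightarrow> (\<exists>j. 0 < j \<and> j \<le> n \<and> P i j))"
    for P :: "nat \<Rightarrow> nat \<Rightarrow> bool"
    by (auto simp: Suc_le_eq Ball_def Bex_def)
  then show ?thesis
    unfolding LB_def F_def[symmetric] by (simp add: Bex_def conj_assoc)
qed

lemma LB_mult:
  "g \<in> carrier (LB n) \<Longrightarrow> h \<in> carrier (LB n) \<Longrightarrow> g \<otimes>\<^bsub>LB n\<^esub> h = compose (carrier (F n)) h g"
  using AutoGroup_mult[of h n g] LB_carrier_auto[of g n] LB_carrier_auto[of h n] unfolding LB_def F_def by simp

lemma LB_one: "\<one>\<^bsub>LB n\<^esub> = (\<lambda>u \<in> carrier (F n). u)"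
  by (simp add: LB_def AutoGroup_def BijGroup_def F_def)

text \<open>Surjectivity of \<open>g\<close> implies that the generators are permuted up to conjugation.\<close>

lemma LB_conj_endo:
  assumes "g \<in> carrier (LB n)"
  shows "\<exists>p w. conj_endo n g p w"
proof -
  have g: "g \<in> hom (F n) (F n)" "g \<in> extensional (carrier (F n))" "g ` carrier (F n) = carrier (F n)"
    using LB_carrier_auto[OF assms] by (auto simp: AutoGroup_def auto_def Bij_def bij_betw_def)
  have "\<exists>j w. 0 < j \<and> j \<le> n \<and> w \<in> carrier (F n) \<and> exponent_sum j w = 0 \<and> g (free_gen i) = conjugate n w j"
    if i: "0 < i" "i \<le> n" for i
  proof -
    obtain j w where "0 < j" "j \<le> n" "w \<in> carrier (F n)" "g (free_gen i) = conjugate n w j"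
      using assms i unfolding LB_iff by blast
    then show ?thesis
      using conj_normalise[of w n j] by metis
  qed
  then obtain q w where q: "\<And>i. 0 < i \<Longrightarrow> i \<le> n \<Longrightarrow> 0 < q i \<and> q i \<le> n \<and> w i \<in> carrier (F n) \<and>
      exponent_sum (q i) (w i) = 0 \<and> g (free_gen i) = conjugate n (w i) (q i)"
    by metis
  define p where "p i = (if 0 < i \<and> i \<le> n then q i else i)" for i
  \<comment> \<open>If no generator were sent to a conjugate of \<open>x\<^sub>j\<close>, then the exponent sum of \<open>x\<^sub>j\<close> would
    vanish on the image of \<open>g\<close>.\<close>
  have "{1..n} \<subseteq> p ` {1..n}"
  proof
    fix j
    assume j: "j \<in> {1..n}"
    then obtain u where u: "u \<in> carrier (F n)" "free_gen j = g u"
      using g(3) free_gen_closed[of j n] by (metis atLeastAtMost_iff imageE less_eq_Suc_le One_nat_def)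
    show "j \<in> p ` {1..n}"
    proof (rule ccontr)
      assume *: "j \<notin> p ` {1..n}"
      have "exponent_sum j (g u) = exponent_sum 0 u"
      proof (rule F_hom_exponent_sum_eq[OF g(1) u(1)])
        fix i
        assume i: "0 < i" "i \<le> n"
        then have "q i \<noteq> j"
          using * by (auto simp: p_def image_iff Suc_le_eq)
        then show "exponent_sum j (g (free_gen i)) = exponent_sum 0 (free_gen i)"
          using q[OF i] i by (simp add: exponent_sum_conj exponent_sum_letter)
      qed
      moreover have "exponent_sum 0 u = 0"
        using u(1)
      proof -
        have "exponent_sum 0 ((\<lambda>u. \<one>\<^bsub>F n\<^esub>) u) = exponent_sum 0 u"
          by (rule F_hom_exponent_sum_eq[OF _ u(1)]) (auto simp: hom_def exponent_sum_one exponent_sum_letter)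
        then show ?thesis by (simp add: exponent_sum_one)
      qed
      ultimately show False
        using u(2) by (metis exponent_sum_letter zero_neq_one)
    qed
  qed
  moreover have "p ` {1..n} \<subseteq> {1..n}"
    using q by (auto simp: p_def Suc_le_eq)
  ultimately have img: "p ` {1..n} = {1..n}" by blast
  then have "inj_on p {1..n}"
    by (simp add: eq_card_imp_inj_on)
  then have "p permutes {1..n}"
    using img by (intro bij_imp_permutes) (auto simp: bij_betw_def p_def)
  then have "conj_endo n g p w"
    unfolding conj_endo_def using g(1,2) q by (simp add: sym_group_carrier p_def)
  then show ?thesis by blast
qed

lemma conj_endo_LB:
  assumes "conj_endo n g p w" "conj_endo n h r v"
    and "compose (carrier (F n)) h g = (\<lambda>u \<in> carrier (F n). u)"
    and "compose (carrier (F n)) g h = (\<lambda>u \<in> carrier (F n). u)"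
  shows "g \<in> carrier (LB n)"
proof -
  note D = conj_endoD[OF assms(1)] and E = conj_endoD[OF assms(2)]
  have hg: "h (g u) = u" and gh: "g (h u) = u" if "u \<in> carrier (F n)" for u
    using fun_cong[OF assms(3), of u] fun_cong[OF assms(4), of u] that by (simp_all add: compose_eq)
  have "bij_betw g (carrier (F n)) (carrier (F n))"
    by (rule bij_betw_byWitness[where f' = h]) (use hg gh D(9) E(9) in auto)
  then have "g \<in> carrier (AutoGroup (F n))"
    using D(1,2) by (simp add: AutoGroup_def auto_def Bij_def)
  then show ?thesis
    using D(4,6-8) unfolding LB_iff by blast
qed

lemma LB_one_closed: "(\<lambda>u \<in> carrier (F n). u) \<in> carrier (LB n)"
  by (rule conj_endo_LB[OF conj_endo_id conj_endo_id]) (auto simp: compose_def)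

text \<open>If \<open>g\<close> sends \<open>x\<^sub>j\<close> to \<open>w\<inverse> x\<^sub>i w\<close>, then its inverse \<open>h\<close> sends \<open>x\<^sub>i\<close> to \<open>h(w) x\<^sub>j h(w)\<inverse>\<close>.\<close>

lemma LB_inverse:
  assumes "g \<in> carrier (LB n)"
  shows "\<exists>h \<in> carrier (LB n). compose (carrier (F n)) h g = (\<lambda>u \<in> carrier (F n). u) \<and>
    compose (carrier (F n)) g h = (\<lambda>u \<in> carrier (F n). u)"
proof -
  interpret A: group "AutoGroup (F n)" by (rule F.AutoGroup)
  have g: "g \<in> carrier (AutoGroup (F n))" by (rule LB_carrier_auto) fact
  define h where "h = inv\<^bsub>AutoGroup (F n)\<^esub> g"
  have h: "h \<in> carrier (AutoGroup (F n))" using g by (simp add: h_def)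
  have one: "\<one>\<^bsub>AutoGroup (F n)\<^esub> = (\<lambda>u \<in> carrier (F n). u)"
    by (simp add: AutoGroup_def BijGroup_def)
  have hg: "compose (carrier (F n)) h g = (\<lambda>u \<in> carrier (F n). u)"
    and gh: "compose (carrier (F n)) g h = (\<lambda>u \<in> carrier (F n). u)"
    using g h A.l_inv[OF g] A.r_inv[OF g] by (simp_all add: AutoGroup_mult one flip: h_def)
  obtain p w where c: "conj_endo n g p w" using LB_conj_endo[OF assms] by blast
  note D = conj_endoD[OF c]
  have h_hom: "h \<in> hom (F n) (F n)" "h \<in> extensional (carrier (F n))"
    using h by (auto simp: AutoGroup_def auto_def Bij_def)
  interpret h: group_hom "F n" "F n" h using h_hom(1) by unfold_locales
  have "h \<in> carrier (LB n)"
    unfolding LB_iff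
  proof (intro conjI allI impI h)
    fix i
    assume "0 < i \<and> i \<le> n"
    then have i: "0 < i" "i \<le> n" by auto
    define j where "j = inv' p i"
    have j: "0 < j" "j \<le> n" "p j = i"
      using i sym_range[OF sym_inv(1)[OF D(3)], of i] sym_inv(2)[OF D(3)] by (auto simp: j_def)
    have w: "w j \<in> carrier (F n)" using D(4) j by blast
    have "h (g (free_gen j)) = free_gen j"
      using fun_cong[OF hg, of "free_gen j"] j by (simp add: compose_eq)
    then have eq: "inv\<^bsub>F n\<^esub> h (w j) \<otimes>\<^bsub>F n\<^esub> h (free_gen i) \<otimes>\<^bsub>F n\<^esub> h (w j) = free_gen j"
      using D(6)[OF j(1,2)] j w i by simp
    have "h (free_gen i) = conjugate n (inv\<^bsub>F n\<^esub> h (w j)) j"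
      unfolding eq[symmetric] using w i by (simp add: F.m_assoc)  (simp flip: F.m_assoc)
    moreover have "inv\<^bsub>F n\<^esub> h (w j) \<in> carrier (F n)"
      using w by simp
    ultimately show "\<exists>j u. 0 < j \<and> j \<le> n \<and> u \<in> carrier (F n) \<and> h (free_gen i) = conjugate n u j"
      using j by blast
  qed
  then show ?thesis using hg gh by blast
qed

lemma LB_mult_closed:
  assumes "g \<in> carrier (LB n)" "h \<in> carrier (LB n)"
  shows "compose (carrier (F n)) h g \<in> carrier (LB n)"
proof -
  obtain p w r v where "conj_endo n g p w" "conj_endo n h r v"
    using LB_conj_endo assms by metis
  note c = conj_endoD(4,6-8)[OF conj_endo_compose[OF this]]
  interpret A: group "AutoGroup (F n)" by (rule F.AutoGroup)
  have "compose (carrier (F n)) h g \<in> carrier (AutoGroup (F n))"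
    using A.m_closed[of h g] assms[THEN LB_carrier_auto] by (simp add: AutoGroup_mult)
  then show ?thesis
    using c unfolding LB_iff by blast
qed

lemma LB_range: "g \<in> carrier (LB n) \<Longrightarrow> u \<in> carrier (F n) \<Longrightarrow> g u \<in> carrier (F n)"
  using LB_conj_endo conj_endoD(9) by blast

lemma group_LB: "group (LB n)"
proof (rule groupI)
  fix g h f
  assume g: "g \<in> carrier (LB n)" and h: "h \<in> carrier (LB n)"
  then show "g \<otimes>\<^bsub>LB n\<^esub> h \<in> carrier (LB n)"
    by (simp add: LB_mult LB_mult_closed)
  assume f: "f \<in> carrier (LB n)"
  show "g \<otimes>\<^bsub>LB n\<^esub> h \<otimes>\<^bsub>LB n\<^esub> f = g \<otimes>\<^bsub>LB n\<^esub> (h \<otimes>\<^bsub>LB n\<^esub> f)"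
    using f g h by (simp add: LB_mult LB_mult_closed) (auto simp: compose_def LB_range intro!: ext)
next
  show "\<one>\<^bsub>LB n\<^esub> \<in> carrier (LB n)"
    unfolding LB_one by (rule LB_one_closed)
next
  fix g
  assume g: "g \<in> carrier (LB n)"
  have "g \<in> extensional (carrier (F n))"
    using LB_conj_endo[OF g] conj_endoD(2) by blast
  then show "\<one>\<^bsub>LB n\<^esub> \<otimes>\<^bsub>LB n\<^esub> g = g"
    using g LB_one_closed[of n] by (auto simp: LB_one LB_mult compose_def extensional_def restrict_def)
  obtain h where "h \<in> carrier (LB n)" "compose (carrier (F n)) g h = (\<lambda>u \<in> carrier (F n). u)"
    using LB_inverse[OF g] by blast
  then show "\<exists>h \<in> carrier (LB n). h \<otimes>\<^bsub>LB n\<^esub> g = \<one>\<^bsub>LB n\<^esub>"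
    using g by (intro bexI[of _ h]) (auto simp: LB_mult LB_one)
qed

interpretation LB: group "LB n" for n
  by (rule group_LB)

lemma conj_endo_LB_mult:
  assumes "g \<in> carrier (LB n)" "h \<in> carrier (LB n)" "conj_endo n g p w" "conj_endo n h r v"
  shows "conj_endo n (g \<otimes>\<^bsub>LB n\<^esub> h) (r \<circ> p) (\<lambda>i. v (p i) \<otimes>\<^bsub>F n\<^esub> h (w i))"
  using conj_endo_compose[OF assms(3,4)] assms(1,2) by (simp add: LB_mult)


section \<open>Doubling a generator\<close>

text \<open>The homomorphism \<open>d\<^sub>k\<close> with \<open>x\<^sub>k \<mapsto> x\<^sub>k x\<^bsub>k+1\<^esub>\<close> that shifts all generators after \<open>x\<^sub>k\<close>.\<close>

definition doubling :: "nat \<Rightarrow> nat \<Rightarrow> nat fword \<Rightarrow> nat fword" where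
  "doubling n k = free_extension (F (Suc n)) (\<lambda>j. if j < k then free_gen j
     else if j = k then free_gen k \<otimes>\<^bsub>F (Suc n)\<^esub> free_gen (Suc k) else free_gen (Suc j))"

text \<open>The map that identifies the two copies \<open>k\<close> and \<open>k + 1\<close> of \<open>k\<close>.\<close>

definition collapse :: "nat \<Rightarrow> nat \<Rightarrow> nat" where
  "collapse k i = (if i \<le> k then i else i - 1)"

lemma doubling_hom: "doubling n k \<in> hom (F n) (F (Suc n))"
  unfolding doubling_def by (rule F_extension) auto

lemma doubling_gen:
  "0 < j \<Longrightarrow> j \<le> n \<Longrightarrow> doubling n k (free_gen j) = (if j < k then free_gen j
     else if j = k then free_gen k \<otimes>\<^bsub>F (Suc n)\<^esub> free_gen (Suc k) else free_gen (Suc j))"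
  unfolding doubling_def by (subst F_extension(2)[of n]) auto

interpretation doubling: group_hom "F n" "F (Suc n)" "doubling n k" for n k
  using doubling_hom by unfold_locales

lemma collapse_range: "\<lbrakk>0 < q; q \<le> n; 0 < i; i \<le> Suc n\<rbrakk> \<Longrightarrow> 0 < collapse q i \<and> collapse q i \<le> n"
  by (auto simp: collapse_def)

lemma collapse_perm_clone: "collapse (\<sigma> k) (perm_clone k \<sigma> i) = \<sigma> (collapse k i)"
  by (auto simp: collapse_def perm_clone_def)

lemma collapse_collapse: "a < b \<Longrightarrow> collapse b (collapse a i) = collapse a (collapse (Suc b) i)"
  by (auto simp: collapse_def)

lemma exponent_sum_doubling:
  assumes "u \<in> carrier (F n)" "0 < k"
  shows "exponent_sum i (doubling n k u) = exponent_sum (collapse k i) u"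
proof (rule F_hom_exponent_sum_eq[OF doubling_hom assms(1)])
  fix j
  assume "0 < j" "j \<le> n"
  then show "exponent_sum i (doubling n k (free_gen j)) = exponent_sum (collapse k i) (free_gen j)"
    using assms(2) by (auto simp: doubling_gen exponent_sum_mult exponent_sum_letter collapse_def)
qed

lemma F_mono: "u \<in> carrier (F m) \<Longrightarrow> m \<le> n \<Longrightarrow> u \<in> carrier (F n)"
  by (fastforce simp: F_def carrier_free_group)

lemma F_mult_eq: "u \<otimes>\<^bsub>F m\<^esub> v = u \<otimes>\<^bsub>F n\<^esub> v"
  by (simp add: F_def mult_free_group)

lemma F_one_eq: "\<one>\<^bsub>F m\<^esub> = \<one>\<^bsub>F n\<^esub>"
  by (simp add: F_def one_free_group)

lemma F_inclusion: "m \<le> n \<Longrightarrow> (\<lambda>u. u) \<in> hom (F m) (F n)"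
  by (intro homI) (auto simp: F_mono F_mult_eq[of m _ _ n])

lemma F_inv_eq: "u \<in> carrier (F m) \<Longrightarrow> m \<le> n \<Longrightarrow> inv\<^bsub>F m\<^esub> u = inv\<^bsub>F n\<^esub> u"
  using F.l_inv[of u m] F_mono[OF F.inv_closed, of u m n]
  by (intro F.inv_equality[symmetric]) (auto simp: F_mono F_mult_eq[of n _ _ m] F_one_eq[of n m])

lemma conjugate_mono: "u \<in> carrier (F m) \<Longrightarrow> m \<le> n \<Longrightarrow> conjugate m u i = conjugate n u i"
  by (simp add: F_inv_eq F_mult_eq[of m _ _ n])

lemma hom_F_restrict: "f \<in> hom (F n) (F l) \<Longrightarrow> m \<le> n \<Longrightarrow> f \<in> hom (F m) (F l)"
  using F_mono[of _ m n] by (auto simp: hom_def F_mult_eq[of m _ _ n])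

lemma hom_F_extend: "f \<in> hom (F m) (F n) \<Longrightarrow> n \<le> l \<Longrightarrow> f \<in> hom (F m) (F l)"
  using F_mono[of _ n l] by (auto simp: hom_def F_mult_eq[of n _ _ l])

lemma doubling_mono:
  assumes "u \<in> carrier (F m)" "m \<le> n"
  shows "doubling n k u = doubling m k u"
proof (rule F_hom_eq[OF _ _ _ assms(1)])
  show "doubling n k \<in> hom (F m) (F (Suc n))"
    using doubling_hom assms(2) by (rule hom_F_restrict)
  show "doubling m k \<in> hom (F m) (F (Suc n))"
    using doubling_hom by (rule hom_F_extend) (use assms(2) in simp)
  show "doubling n k (free_gen i) = doubling m k (free_gen i)" if "0 < i" "i \<le> m" for i
    using that assms(2) by (simp add: doubling_gen F_mult_eq[of "Suc n" _ _ "Suc m"])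
qed

lemma doubling_below:
  assumes "u \<in> carrier (F m)" "m < k" "m \<le> n"
  shows "doubling n k u = u"
proof (rule F_hom_eq[OF _ _ _ assms(1)])
  show "doubling n k \<in> hom (F m) (F (Suc n))"
    using doubling_hom assms(3) by (rule hom_F_restrict)
  show "(\<lambda>u. u) \<in> hom (F m) (F (Suc n))"
    using assms(3) by (intro F_inclusion) simp
  show "doubling n k (free_gen i) = free_gen i" if "0 < i" "i \<le> m" for i
    using that assms by (simp add: doubling_gen)
qed

lemma doubling_doubling:
  assumes "u \<in> carrier (F n)" "0 < k" "k < l"
  shows "doubling (Suc n) k (doubling n l u) = doubling (Suc n) (Suc l) (doubling n k u)"
proof (rule F_hom_eq[OF _ _ _ assms(1)])
  show "(\<lambda>u. doubling (Suc n) k (doubling n l u)) \<in> hom (F n) (F (Suc (Suc n)))"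
    "(\<lambda>u. doubling (Suc n) (Suc l) (doubling n k u)) \<in> hom (F n) (F (Suc (Suc n)))"
    using hom_compose[OF doubling_hom doubling_hom] by (simp_all add: comp_def)
  fix i
  assume i: "0 < i" "i \<le> n"
  consider "i < k" | "i = k" | "k < i" "i < l" | "i = l" | "l < i" by linarith
  then show "doubling (Suc n) k (doubling n l (free_gen i)) = doubling (Suc n) (Suc l) (doubling n k (free_gen i))"
    by cases (use i assms(2,3) in \<open>simp_all add: doubling_gen\<close>)
qed

lemma doubling_eq_one:
  assumes "u \<in> carrier (F n)" "k \<le> n" "doubling n k u = \<one>\<^bsub>F (Suc n)\<^esub>"
  shows "u = \<one>\<^bsub>F n\<^esub>"
proof -
  \<comment> \<open>The left inverse of the doubling map kills the second copy of the doubled generator.\<close>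
  let ?d = "\<lambda>j. if j \<le> k then free_gen j else if j = Suc k then \<one>\<^bsub>F n\<^esub> else free_gen (j - 1)"
  have closed: "?d j \<in> carrier (F n)" if "0 < j" "j \<le> Suc n" for j
    using that assms(2) by auto
  note e = F_extension[of "Suc n" ?d n, OF closed]
  interpret e: group_hom "F (Suc n)" "F n" "free_extension (F n) ?d"
    using e(1) by unfold_locales
  have "free_extension (F n) ?d (doubling n k u) = u"
  proof (rule F_hom_eq[OF _ _ _ assms(1)])
    show "(\<lambda>u. free_extension (F n) ?d (doubling n k u)) \<in> hom (F n) (F n)"
      using hom_compose[OF doubling_hom e(1)] by (simp add: comp_def)
    show "(\<lambda>u. u) \<in> hom (F n) (F n)" by (rule F_inclusion) simp
    show "free_extension (F n) ?d (doubling n k (free_gen i)) = free_gen i" if "0 < i" "i \<le> n" for i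
      using that e(2) by (auto simp: doubling_gen)
  qed
  then show ?thesis
    using e.hom_one unfolding assms(3) by simp
qed


section \<open>Cloning of loop braids\<close>

definition loop_perm :: "nat \<Rightarrow> (nat fword \<Rightarrow> nat fword) \<Rightarrow> nat \<Rightarrow> nat" where
  "loop_perm n g = (SOME p. \<exists>w. conj_endo n g p w)"

definition loop_conjugators :: "nat \<Rightarrow> (nat fword \<Rightarrow> nat fword) \<Rightarrow> nat \<Rightarrow> nat fword" where
  "loop_conjugators n g = (SOME w. conj_endo n g (loop_perm n g) w)"

text \<open>The inverse is due to loop braids being composed from left to right and permutations from
  right to left.\<close>

definition loop_rho :: "nat \<Rightarrow> (nat fword \<Rightarrow> nat fword) \<Rightarrow> nat \<Rightarrow> nat" where
  "loop_rho n g = inv' (loop_perm n g)"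

text \<open>The generator of the target that is doubled is \<open>x\<^sub>k\<close>, and the generator that is sent to a
  conjugate of it is doubled in the source.\<close>

definition loop_clone :: "nat \<Rightarrow> nat \<Rightarrow> (nat fword \<Rightarrow> nat fword) \<Rightarrow> nat fword \<Rightarrow> nat fword" where
  "loop_clone n k g = (let q = loop_rho n g k in free_endo (Suc n) (\<lambda>i.
     conjugate (Suc n) (doubling n k (loop_conjugators n g (collapse q i))) (perm_clone q (loop_perm n g) i)))"

lemma loop_data:
  assumes "conj_endo n g p w"
  shows "loop_perm n g = p" "loop_rho n g = inv' p" "0 < i \<Longrightarrow> i \<le> n \<Longrightarrow> loop_conjugators n g i = w i"
proof -
  have "\<exists>p w. conj_endo n g p w"
    using assms by blast
  then have "\<exists>w. conj_endo n g (loop_perm n g) w"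
    unfolding loop_perm_def by (rule someI_ex)
  then have "conj_endo n g (loop_perm n g) (loop_conjugators n g)"
    unfolding loop_conjugators_def by (rule someI_ex)
  from conj_endo_unique[OF this assms]
  show "loop_perm n g = p" "loop_rho n g = inv' p" "0 < i \<Longrightarrow> i \<le> n \<Longrightarrow> loop_conjugators n g i = w i"
    by (simp_all add: loop_rho_def)
qed

lemma inv_range: "p \<in> carrier (sym_group n) \<Longrightarrow> 0 < inv' p k \<and> inv' p k \<le> n \<longleftrightarrow> 0 < k \<and> k \<le> n"
  using sym_range[OF sym_inv(1)] by blast

lemma perm_clone_sym: "p \<in> carrier (sym_group n) \<Longrightarrow> 0 < q \<Longrightarrow> q \<le> n \<Longrightarrow> perm_clone q p \<in> carrier (sym_group (Suc n))"
  using perm_clone_permutes[of p n q] by (simp add: sym_group_carrier)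

lemma conj_endo_clone:
  assumes "conj_endo n g p w" "0 < k" "k \<le> n"
  shows "conj_endo (Suc n) (loop_clone n k g) (perm_clone (inv' p k) p)
    (\<lambda>i. doubling n k (w (collapse (inv' p k) i)))"
proof -
  note D = conj_endoD[OF assms(1)] and L = loop_data[OF assms(1)]
  define q where "q = inv' p k"
  have q: "0 < q" "q \<le> n" "p q = k"
    using inv_range[OF D(3), of k] assms sym_inv(2)[OF D(3)] by (auto simp: q_def)
  show ?thesis
    unfolding loop_clone_def Let_def L(1,2) q_def[symmetric]
  proof (rule conj_endo_free_endo)
    show "perm_clone q p \<in> carrier (sym_group (Suc n))"
      using D(3) q by (intro perm_clone_sym)
    fix i
    assume i: "0 < i" "i \<le> Suc n"
    then have c: "0 < collapse q i" "collapse q i \<le> n"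
      using collapse_range[OF q(1,2)] by auto
    show "doubling n k (w (collapse q i)) \<in> carrier (F (Suc n)) \<and>
        exponent_sum (perm_clone q p i) (doubling n k (w (collapse q i))) = 0"
      using c D(4,5) assms collapse_perm_clone[of p q i] by (simp add: exponent_sum_doubling q)
    show "conjugate (Suc n) (doubling n k (loop_conjugators n g (collapse q i))) (perm_clone q p i) =
        conjugate (Suc n) (doubling n k (w (collapse q i))) (perm_clone q p i)"
      using L(3)[OF c] by simp
  qed
qed

text \<open>The two copies of the doubled generator of the source are conjugated by the same element, so their
  product is sent to a conjugate of \<open>x\<^sub>k x\<^bsub>k+1\<^esub>\<close>.  Thus the cloned automorphism extends the
  original one along the doubling maps of source and target.\<close>

lemma loop_clone_doubling:
  assumes "conj_endo n h r v" "0 < k" "k \<le> n" "u \<in> carrier (F n)"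
  shows "loop_clone n k h (doubling n (inv' r k) u) = doubling n k (h u)"
proof (rule F_hom_eq[OF _ _ _ assms(4)])
  note D = conj_endoD[OF assms(1)]
  define q where "q = inv' r k"
  note c = conj_endo_clone[OF assms(1-3), folded q_def]
  note C = conj_endoD[OF c]
  interpret h: group_hom "F (Suc n)" "F (Suc n)" "loop_clone n k h"
    using C(1) by unfold_locales
  have q: "0 < q" "q \<le> n" "r q = k"
    using inv_range[OF D(3), of k] assms sym_inv(2)[OF D(3)] by (auto simp: q_def)
  show "(\<lambda>u. loop_clone n k h (doubling n (inv' r k) u)) \<in> hom (F n) (F (Suc n))"
    using hom_compose[OF doubling_hom C(1)] by (simp add: comp_def)
  show "(\<lambda>u. doubling n k (h u)) \<in> hom (F n) (F (Suc n))"
    using hom_compose[OF D(1) doubling_hom] by (simp add: comp_def)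
  fix j
  assume j: "0 < j" "j \<le> n"
  have r: "0 < r j" "r j \<le> n" "r j = k \<longleftrightarrow> j = q"
    using D(7,8)[OF j] sym_eq_iff[OF D(3), of j q] q by auto
  let ?d = "doubling n k (v j)"
  have v: "v j \<in> carrier (F n)" using D(4) j by blast
  then have d: "?d \<in> carrier (F (Suc n))" by simp
  have R: "doubling n k (h (free_gen j)) = inv\<^bsub>F (Suc n)\<^esub> ?d \<otimes>\<^bsub>F (Suc n)\<^esub> doubling n k (free_gen (r j)) \<otimes>\<^bsub>F (Suc n)\<^esub> ?d"
    using D(6)[OF j] v r by simp
  consider "j < q" | "j = q" | "q < j" by linarith
  then show "loop_clone n k h (doubling n (inv' r k) (free_gen j)) = doubling n k (h (free_gen j))"
    unfolding R q_def[symmetric]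
  proof cases
    case 1
    then show "loop_clone n k h (doubling n q (free_gen j)) =
        inv\<^bsub>F (Suc n)\<^esub> ?d \<otimes>\<^bsub>F (Suc n)\<^esub> doubling n k (free_gen (r j)) \<otimes>\<^bsub>F (Suc n)\<^esub> ?d"
      using j r C(6)[of j] by (auto simp: doubling_gen collapse_def perm_clone_def q)
  next
    case 2
    have "loop_clone n k h (free_gen q) = conjugate (Suc n) ?d k"
      "loop_clone n k h (free_gen (Suc q)) = conjugate (Suc n) ?d (Suc k)"
      using 2 q C(6)[of q] C(6)[of "Suc q"] by (simp_all add: collapse_def perm_clone_def)
    moreover have "inv\<^bsub>F (Suc n)\<^esub> ?d \<otimes>\<^bsub>F (Suc n)\<^esub> (free_gen k \<otimes>\<^bsub>F (Suc n)\<^esub> free_gen (Suc k)) \<otimes>\<^bsub>F (Suc n)\<^esub> ?d =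
        conjugate (Suc n) ?d k \<otimes>\<^bsub>F (Suc n)\<^esub> conjugate (Suc n) ?d (Suc k)"
    proof -
      have "?d \<otimes>\<^bsub>F (Suc n)\<^esub> (inv\<^bsub>F (Suc n)\<^esub> ?d \<otimes>\<^bsub>F (Suc n)\<^esub> (free_gen (Suc k) \<otimes>\<^bsub>F (Suc n)\<^esub> ?d)) =
          free_gen (Suc k) \<otimes>\<^bsub>F (Suc n)\<^esub> ?d"
        using d assms(2,3) by (simp flip: F.m_assoc)
      then show ?thesis
        using d assms(2,3) by (simp add: F.m_assoc)
    qed
    ultimately show "loop_clone n k h (doubling n q (free_gen j)) =
        inv\<^bsub>F (Suc n)\<^esub> ?d \<otimes>\<^bsub>F (Suc n)\<^esub> doubling n k (free_gen (r j)) \<otimes>\<^bsub>F (Suc n)\<^esub> ?d"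
      using 2 j q assms(2,3) by (simp add: doubling_gen)
  next
    case 3
    then show "loop_clone n k h (doubling n q (free_gen j)) =
        inv\<^bsub>F (Suc n)\<^esub> ?d \<otimes>\<^bsub>F (Suc n)\<^esub> doubling n k (free_gen (r j)) \<otimes>\<^bsub>F (Suc n)\<^esub> ?d"
      using j r C(6)[of "Suc j"] by (auto simp: doubling_gen collapse_def perm_clone_def q)
  qed
qed

lemma inv_comp: "p \<in> carrier (sym_group n) \<Longrightarrow> r \<in> carrier (sym_group n) \<Longrightarrow> inv' (r \<circ> p) = inv' p \<circ> inv' r"
  using permutes_bij by (intro o_inv_distrib) (auto simp: sym_group_carrier)

text \<open>The conjugating elements of a composition involve images under the second map, and for the
  cloned maps these images are the doubled images.\<close>

lemma loop_clone_compose: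
  assumes "conj_endo n g p w" "conj_endo n h r v" "0 < k" "k \<le> n"
  shows "compose (carrier (F (Suc n))) (loop_clone n k h) (loop_clone n (inv' r k) g) =
    loop_clone n k (compose (carrier (F n)) h g)"
proof -
  note D = conj_endoD[OF assms(1)] and E = conj_endoD[OF assms(2)]
  define s q where "s = inv' r k" and "q = inv' p s"
  have s: "0 < s" "s \<le> n" "r s = k" "0 < q" "q \<le> n" "p q = s"
    using inv_range[OF E(3), of k] inv_range[OF D(3), of s] assms(3,4) sym_inv(2)[OF D(3)] sym_inv(2)[OF E(3)]
    by (auto simp: s_def q_def)
  have q: "inv' (r \<circ> p) k = q"
    using inv_comp[OF D(3) E(3)] by (simp add: q_def s_def)
  have A: "conj_endo (Suc n) (loop_clone n s g) (perm_clone q p) (\<lambda>i. doubling n s (w (collapse q i)))"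
    using conj_endo_clone[OF assms(1) s(1,2)] by (simp add: q_def)
  have B: "conj_endo (Suc n) (loop_clone n k h) (perm_clone s r) (\<lambda>i. doubling n k (v (collapse s i)))"
    using conj_endo_clone[OF assms(2-4)] by (simp add: s_def)
  have C: "conj_endo (Suc n) (loop_clone n k (compose (carrier (F n)) h g)) (perm_clone q (r \<circ> p))
      (\<lambda>i. doubling n k (v (p (collapse q i)) \<otimes>\<^bsub>F n\<^esub> h (w (collapse q i))))"
    using conj_endo_clone[OF conj_endo_compose[OF assms(1,2)] assms(3,4)] unfolding q .
  show ?thesis
    unfolding s_def[symmetric]
  proof (rule conj_endo_eqI[OF conj_endo_compose[OF A B] C])
    have "inj r"
      using permutes_inj E(3) by (auto simp: sym_group_carrier)
    then show "perm_clone s r \<circ> perm_clone q p = perm_clone q (r \<circ> p)"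
      using s by (simp add: perm_clone_comp)
    fix i
    assume "0 < i" "i \<le> Suc n"
    then have c: "0 < collapse q i" "collapse q i \<le> n"
      using collapse_range[OF s(4,5)] by auto
    have "collapse s (perm_clone q p i) = p (collapse q i)"
      using collapse_perm_clone[of p q i] s by simp
    moreover have "loop_clone n k h (doubling n s (w (collapse q i))) = doubling n k (h (w (collapse q i)))"
      using loop_clone_doubling[OF assms(2-4), of "w (collapse q i)"] D(4)[OF c] by (simp add: s_def)
    ultimately show "doubling n k (v (collapse s (perm_clone q p i))) \<otimes>\<^bsub>F (Suc n)\<^esub>
        loop_clone n k h (doubling n s (w (collapse q i))) =
        doubling n k (v (p (collapse q i)) \<otimes>\<^bsub>F n\<^esub> h (w (collapse q i)))"
      using D(4)[OF c] E(9)[OF D(4)[OF c]] E(4)[OF D(7,8)[OF c]] by simp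
  qed
qed

lemma loop_clone_id:
  assumes "0 < k" "k \<le> n"
  shows "loop_clone n k (\<lambda>u \<in> carrier (F n). u) = (\<lambda>u \<in> carrier (F (Suc n)). u)"
  by (rule conj_endo_eqI[OF conj_endo_clone[OF conj_endo_id assms] conj_endo_id]) (simp_all add: inv_id perm_clone_id)

text \<open>By the product rule, the clones of an automorphism and of its inverse at matching positions are
  inverse to each other.\<close>

lemma loop_clone_closed:
  assumes "g \<in> carrier (LB n)" "0 < k" "k \<le> n"
  shows "loop_clone n k g \<in> carrier (LB (Suc n))"
proof -
  obtain h where h: "h \<in> carrier (LB n)" "compose (carrier (F n)) h g = (\<lambda>u \<in> carrier (F n). u)"
      "compose (carrier (F n)) g h = (\<lambda>u \<in> carrier (F n). u)"
    using LB_inverse[OF assms(1)] by blast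
  obtain p w r v where g: "conj_endo n g p w" and h': "conj_endo n h r v"
    using LB_conj_endo assms(1) h(1) by metis
  note D = conj_endoD[OF g] and E = conj_endoD[OF h']
  have "r \<circ> p = id"
    using conj_endo_unique(1)[OF conj_endo_compose[OF g h'], unfolded h(2), OF conj_endo_id] .
  then have rp: "r (p i) = i" for i
    by (metis comp_apply id_apply)
  have s: "inv' r (r k) = k" "inv' p k = r k" "0 < r k" "r k \<le> n"
    by (rule sym_inv(3)[OF E(3)], rule rp[of "inv' p k", unfolded sym_inv(2)[OF D(3)], symmetric],
        rule E(7)[OF assms(2,3)], rule E(8)[OF assms(2,3)])
  have 1: "compose (carrier (F (Suc n))) (loop_clone n (r k) h) (loop_clone n k g) = (\<lambda>u \<in> carrier (F (Suc n)). u)"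
    using loop_clone_compose[OF g h' s(3,4)] s loop_clone_id[OF s(3,4)] by (simp add: h(2))
  have 2: "compose (carrier (F (Suc n))) (loop_clone n k g) (loop_clone n (r k) h) = (\<lambda>u \<in> carrier (F (Suc n)). u)"
    using loop_clone_compose[OF h' g assms(2,3)] s loop_clone_id[OF assms(2,3)] by (simp add: h(3))
  show ?thesis
    by (rule conj_endo_LB[OF conj_endo_clone[OF g assms(2,3)] conj_endo_clone[OF h' s(3,4)] 1 2])
qed

lemma loop_rho_mult:
  assumes "g \<in> carrier (LB n)" "h \<in> carrier (LB n)"
  shows "loop_rho n (g \<otimes>\<^bsub>LB n\<^esub> h) = loop_rho n g \<circ> loop_rho n h"
proof -
  obtain p w r v where g: "conj_endo n g p w" and h: "conj_endo n h r v"
    using LB_conj_endo assms by metis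
  show ?thesis
    using loop_data(2)[OF conj_endo_LB_mult[OF assms g h]] loop_data(2)[OF g] loop_data(2)[OF h]
      inv_comp conj_endoD(3)[OF g] conj_endoD(3)[OF h] by simp
qed

lemma loop_rho_hom: "loop_rho n \<in> hom (LB n) (sym_group n)"
proof (rule homI)
  fix g
  assume "g \<in> carrier (LB n)"
  then obtain p w where g: "conj_endo n g p w" using LB_conj_endo by blast
  show "loop_rho n g \<in> carrier (sym_group n)"
    using loop_data(2)[OF g] sym_inv(1)[OF conj_endoD(3)[OF g]] by simp
next
  show "loop_rho n (g \<otimes>\<^bsub>LB n\<^esub> h) = loop_rho n g \<otimes>\<^bsub>sym_group n\<^esub> loop_rho n h"
    if "g \<in> carrier (LB n)" "h \<in> carrier (LB n)" for g h
    unfolding sym_group_mult using that by (rule loop_rho_mult)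
qed

lemma inv_perm_clone:
  assumes "p \<in> carrier (sym_group n)"
  shows "inv' (perm_clone (inv' p k) p) = perm_clone k (inv' p)"
proof -
  have inj: "inj p" "inj (inv' p)"
    using permutes_inj assms sym_inv(1)[OF assms] by (auto simp: sym_group_carrier)
  have "inv' p \<circ> p = id" "p \<circ> inv' p = id"
    using sym_inv[OF assms] by (auto simp: fun_eq_iff)
  then have "perm_clone k (inv' p) \<circ> perm_clone (inv' p k) p = id" "perm_clone (inv' p k) p \<circ> perm_clone k (inv' p) = id"
    using perm_clone_comp[OF inj(2), of "inv' p k" p] perm_clone_comp[OF inj(1), of k "inv' p"] sym_inv(2)[OF assms]
    by (auto simp del: id_apply)
  then show ?thesis
    by (intro inv_unique_comp)
qed

lemma loop_rho_clone:
  assumes "g \<in> carrier (LB n)" "0 < k" "k \<le> n"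
  shows "loop_rho (Suc n) (loop_clone n k g) = perm_clone k (loop_rho n g)"
proof -
  obtain p w where g: "conj_endo n g p w" using LB_conj_endo assms by blast
  show ?thesis
    using loop_data(2)[OF conj_endo_clone[OF g assms(2,3)]] loop_data(2)[OF g] inv_perm_clone[OF conj_endoD(3)[OF g]]
    by simp
qed

lemma loop_rho_range: "g \<in> carrier (LB n) \<Longrightarrow> 0 < k \<Longrightarrow> k \<le> n \<Longrightarrow> 0 < loop_rho n g k \<and> loop_rho n g k \<le> n"
  using sym_range[OF hom_in_carrier[OF loop_rho_hom]] by blast

lemma loop_clone_mult:
  assumes "g \<in> carrier (LB n)" "h \<in> carrier (LB n)" "0 < k" "k \<le> n"
  shows "loop_clone n k (g \<otimes>\<^bsub>LB n\<^esub> h) = loop_clone n (loop_rho n h k) g \<otimes>\<^bsub>LB (Suc n)\<^esub> loop_clone n k h"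
proof -
  obtain p w r v where g: "conj_endo n g p w" and h: "conj_endo n h r v"
    using LB_conj_endo assms by metis
  show ?thesis
    using loop_clone_compose[OF g h assms(3,4)] loop_data(2)[OF h] assms loop_rho_range[OF assms(2-4)]
    by (simp add: LB_mult loop_clone_closed)
qed

text \<open>If the clone of \<open>g\<close> is trivial, then so are its permutation and all its conjugating elements,
  and hence those of \<open>g\<close>, since doubling is injective.\<close>

lemma inj_on_loop_clone:
  assumes "0 < k" "k \<le> n"
  shows "inj_on (loop_clone n k) (carrier (LB n))"
proof (rule inj_on_crossed_hom[where K = "{k. 0 < k \<and> k \<le> n}" and r = "loop_rho n" and H = "LB (Suc n)"])
  fix k g
  assume k: "k \<in> {k. 0 < k \<and> k \<le> n}" and g: "g \<in> carrier (LB n)" "loop_clone n k g = \<one>\<^bsub>LB (Suc n)\<^esub>"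
  obtain p w where c: "conj_endo n g p w" using LB_conj_endo g(1) by blast
  define q where "q = inv' p k"
  have "conj_endo (Suc n) (loop_clone n k g) (perm_clone q p) (\<lambda>i. doubling n k (w (collapse q i)))"
    unfolding q_def using conj_endo_clone[OF c] k by blast
  from conj_endo_unique[OF this conj_endo_id[of "Suc n", folded LB_one g(2)]]
  have *: "perm_clone q p = id" "\<And>i. 0 < i \<Longrightarrow> i \<le> Suc n \<Longrightarrow> doubling n k (w (collapse q i)) = \<one>\<^bsub>F (Suc n)\<^esub>"
    by auto
  have "p = id"
    using *(1) by (rule perm_clone_eq_id)
  have "w i = \<one>\<^bsub>F n\<^esub>" if i: "0 < i" "i \<le> n" for i
  proof -
    have "\<exists>j. 0 < j \<and> j \<le> Suc n \<and> collapse q j = i"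
      using i by (intro exI[of _ "if i \<le> q then i else Suc i"]) (auto simp: collapse_def)
    then show ?thesis
      using *(2) doubling_eq_one[OF conj_endoD(4)[OF c i], of k] k by auto
  qed
  with \<open>p = id\<close> have "g = (\<lambda>u \<in> carrier (F n). u)"
    by (intro conj_endo_eqI[OF c conj_endo_id])
  then show "g = \<one>\<^bsub>LB n\<^esub>" by (simp add: LB_one)
qed (use assms loop_rho_range in \<open>auto simp: group_LB loop_clone_mult loop_clone_closed\<close>)

lemma loop_clone_clone:
  assumes "g \<in> carrier (LB n)" "0 < k" "k < l" "l \<le> n"
  shows "loop_clone (Suc n) k (loop_clone n l g) = loop_clone (Suc n) (Suc l) (loop_clone n k g)"
proof -
  obtain p w where g: "conj_endo n g p w" using LB_conj_endo assms by blast
  note D = conj_endoD[OF g]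
  define \<sigma> where "\<sigma> = inv' p"
  have \<sigma>: "\<sigma> \<in> carrier (sym_group n)" "inj \<sigma>"
    using sym_inv(1)[OF D(3)] permutes_inj by (auto simp: \<sigma>_def sym_group_carrier)
  have "conj_endo (Suc n) (loop_clone n l g) (perm_clone (\<sigma> l) p) (\<lambda>i. doubling n l (w (collapse (\<sigma> l) i)))"
    unfolding \<sigma>_def by (rule conj_endo_clone[OF g]) (use assms in auto)
  from conj_endo_clone[OF this, of k]
  have A: "conj_endo (Suc (Suc n)) (loop_clone (Suc n) k (loop_clone n l g))
      (perm_clone (perm_clone l \<sigma> k) (perm_clone (\<sigma> l) p))
      (\<lambda>i. doubling (Suc n) k (doubling n l (w (collapse (\<sigma> l) (collapse (perm_clone l \<sigma> k) i)))))"
    using assms inv_perm_clone[OF D(3), of l] by (simp add: \<sigma>_def)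
  have "conj_endo (Suc n) (loop_clone n k g) (perm_clone (\<sigma> k) p) (\<lambda>i. doubling n k (w (collapse (\<sigma> k) i)))"
    unfolding \<sigma>_def by (rule conj_endo_clone[OF g]) (use assms in auto)
  from conj_endo_clone[OF this, of "Suc l"]
  have B: "conj_endo (Suc (Suc n)) (loop_clone (Suc n) (Suc l) (loop_clone n k g))
      (perm_clone (perm_clone k \<sigma> (Suc l)) (perm_clone (\<sigma> k) p))
      (\<lambda>i. doubling (Suc n) (Suc l) (doubling n k (w (collapse (\<sigma> k) (collapse (perm_clone k \<sigma> (Suc l)) i)))))"
    using assms inv_perm_clone[OF D(3), of k] by (simp add: \<sigma>_def)
  have ne: "\<sigma> k \<noteq> \<sigma> l"
    using \<sigma>(2) assms(3) by (auto dest: injD)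
  have pc: "perm_clone l \<sigma> k = (if \<sigma> k \<le> \<sigma> l then \<sigma> k else \<sigma> k + 1)"
    "perm_clone k \<sigma> (Suc l) = (if \<sigma> l < \<sigma> k then \<sigma> l else \<sigma> l + 1)"
    using perm_clone_less[OF assms(3), of \<sigma>] by auto
  show ?thesis
  proof (rule conj_endo_eqI[OF A B])
    have "inj p" using permutes_inj D(3) by (auto simp: sym_group_carrier)
    then show "perm_clone (perm_clone l \<sigma> k) (perm_clone (\<sigma> l) p) =
        perm_clone (perm_clone k \<sigma> (Suc l)) (perm_clone (\<sigma> k) p)"
      using ne perm_clone_perm_clone[of "\<sigma> k" "\<sigma> l" p] perm_clone_perm_clone[of "\<sigma> l" "\<sigma> k" p]
      by (cases "\<sigma> k" "\<sigma> l" rule: linorder_cases) (auto simp: pc)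
    fix i
    assume i: "0 < i" "i \<le> Suc (Suc n)"
    have c: "collapse (\<sigma> l) (collapse (perm_clone l \<sigma> k) i) = collapse (\<sigma> k) (collapse (perm_clone k \<sigma> (Suc l)) i)"
      using ne collapse_collapse[of "\<sigma> k" "\<sigma> l" i] collapse_collapse[of "\<sigma> l" "\<sigma> k" i]
      by (cases "\<sigma> k" "\<sigma> l" rule: linorder_cases) (auto simp: pc)
    have "perm_clone k \<sigma> (Suc l) \<le> Suc n" "0 < perm_clone k \<sigma> (Suc l)" "0 < \<sigma> k" "\<sigma> k \<le> n"
      using sym_range[OF \<sigma>(1), of k] sym_range[OF \<sigma>(1), of l] assms by (auto simp: pc)
    then have "0 < collapse (\<sigma> k) (collapse (perm_clone k \<sigma> (Suc l)) i)" "collapse (\<sigma> k) (collapse (perm_clone k \<sigma> (Suc l)) i) \<le> n"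
      using i collapse_range[of "perm_clone k \<sigma> (Suc l)" "Suc n" i] collapse_range[of "\<sigma> k" n] by auto
    then show "doubling (Suc n) k (doubling n l (w (collapse (\<sigma> l) (collapse (perm_clone l \<sigma> k) i)))) =
        doubling (Suc n) (Suc l) (doubling n k (w (collapse (\<sigma> k) (collapse (perm_clone k \<sigma> (Suc l)) i))))"
      unfolding c using D(4) assms by (intro doubling_doubling) auto
  qed
qed

lemma sym_mono: "p \<in> carrier (sym_group m) \<Longrightarrow> m \<le> n \<Longrightarrow> p \<in> carrier (sym_group n)"
  using permutes_subset[of p "{1..m}" "{1..n}"] by (simp add: sym_group_carrier)

lemma conj_endo_incl:
  assumes "conj_endo m g p w" "m \<le> n"
  shows "conj_endo n (loop_incl m n g) p (\<lambda>i. if i \<le> m then w i else \<one>\<^bsub>F n\<^esub>)"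
proof -
  note D = conj_endoD[OF assms(1)]
  show ?thesis
    unfolding loop_incl_def
  proof (rule conj_endo_free_endo)
    show "p \<in> carrier (sym_group n)" using D(3) assms(2) by (rule sym_mono)
    fix i
    assume i: "0 < i" "i \<le> n"
    show "(if i \<le> m then w i else \<one>\<^bsub>F n\<^esub>) \<in> carrier (F n) \<and> exponent_sum (p i) (if i \<le> m then w i else \<one>\<^bsub>F n\<^esub>) = 0"
      using D(4,5) F_mono[of "w i" m n] i assms(2) by (simp add: exponent_sum_one)
    show "(if i \<le> m then g (free_gen i) else free_gen i) = conjugate n (if i \<le> m then w i else \<one>\<^bsub>F n\<^esub>) (p i)"
      using D(4,6) conjugate_mono[of "w i" m n "p i"] i assms(2) sym_fix[OF D(3), of i] by simp
  qed
qed

lemma loop_incl_apply: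
  assumes "conj_endo m g p w" "m \<le> n" "u \<in> carrier (F m)"
  shows "loop_incl m n g u = g u"
proof (rule F_hom_eq[OF _ _ _ assms(3)])
  note D = conj_endoD[OF assms(1)] and E = conj_endoD[OF conj_endo_incl[OF assms(1,2)]]
  show "loop_incl m n g \<in> hom (F m) (F n)"
    using E(1) assms(2) by (rule hom_F_restrict)
  show "g \<in> hom (F m) (F n)"
    using D(1) assms(2) by (rule hom_F_extend)
  show "loop_incl m n g (free_gen i) = g (free_gen i)" if "0 < i" "i \<le> m" for i
    using that D(4,6)[OF that] E(6)[of i] assms(2) conjugate_mono[of "w i" m n "p i"] by simp
qed

lemma loop_incl_compose:
  assumes "conj_endo m g p w" "conj_endo m h r v" "m \<le> n"
  shows "compose (carrier (F n)) (loop_incl m n h) (loop_incl m n g) = loop_incl m n (compose (carrier (F m)) h g)"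
proof (rule conj_endo_eqI[OF conj_endo_compose[OF conj_endo_incl conj_endo_incl] conj_endo_incl[OF conj_endo_compose]])
  show "conj_endo m g p w" "conj_endo m h r v" "conj_endo m g p w" "conj_endo m h r v" "m \<le> n" "m \<le> n" "m \<le> n"
    by (rule assms)+
  note D = conj_endoD[OF assms(1)] and E = conj_endoD[OF assms(2)] and I = conj_endoD[OF conj_endo_incl[OF assms(2,3)]]
  interpret h: group_hom "F n" "F n" "loop_incl m n h" using I(1) by unfold_locales
  fix i
  assume i: "0 < i" "i \<le> n"
  show "(if p i \<le> m then v (p i) else \<one>\<^bsub>F n\<^esub>) \<otimes>\<^bsub>F n\<^esub> loop_incl m n h (if i \<le> m then w i else \<one>\<^bsub>F n\<^esub>) =
      (if i \<le> m then v (p i) \<otimes>\<^bsub>F m\<^esub> h (w i) else \<one>\<^bsub>F n\<^esub>)"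
    using i D(4,7,8)[of i] sym_fix[OF D(3), of i] loop_incl_apply[OF assms(2,3), of "w i"] F_mult_eq[of m _ _ n]
    by simp
qed simp

lemma loop_incl_id: "m \<le> n \<Longrightarrow> loop_incl m n (\<lambda>u \<in> carrier (F m). u) = (\<lambda>u \<in> carrier (F n). u)"
  by (rule conj_endo_eqI[OF conj_endo_incl[OF conj_endo_id] conj_endo_id]) (simp_all add: F_one_eq[of m n])

lemma loop_incl_closed:
  assumes "g \<in> carrier (LB m)" "m \<le> n"
  shows "loop_incl m n g \<in> carrier (LB n)"
proof -
  obtain h where h: "h \<in> carrier (LB m)" "compose (carrier (F m)) h g = (\<lambda>u \<in> carrier (F m). u)"
      "compose (carrier (F m)) g h = (\<lambda>u \<in> carrier (F m). u)"
    using LB_inverse[OF assms(1)] by blast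
  obtain p w r v where c: "conj_endo m g p w" "conj_endo m h r v"
    using LB_conj_endo assms(1) h(1) by metis
  show ?thesis
    by (rule conj_endo_LB[OF conj_endo_incl[OF c(1) assms(2)] conj_endo_incl[OF c(2) assms(2)]])
      (simp_all add: loop_incl_compose[OF c assms(2)] loop_incl_compose[OF c(2,1) assms(2)] h loop_incl_id assms(2))
qed

lemma loop_incl_mon:
  assumes "m \<le> n"
  shows "loop_incl m n \<in> mon (LB m) (LB n)"
  unfolding mon_def
proof (intro CollectI conjI homI inj_onI)
  fix g h
  assume g: "g \<in> carrier (LB m)" and h: "h \<in> carrier (LB m)"
  obtain p w r v where c: "conj_endo m g p w" "conj_endo m h r v"
    using LB_conj_endo g h by metis
  show "loop_incl m n g \<in> carrier (LB n)"
    using g assms by (rule loop_incl_closed)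
  show "loop_incl m n (g \<otimes>\<^bsub>LB m\<^esub> h) = loop_incl m n g \<otimes>\<^bsub>LB n\<^esub> loop_incl m n h"
    using loop_incl_compose[OF c assms] g h assms by (simp add: LB_mult loop_incl_closed)
  show "g = h" if "loop_incl m n g = loop_incl m n h"
  proof (rule extensionalityI)
    show "g \<in> extensional (carrier (F m))" "h \<in> extensional (carrier (F m))"
      using c conj_endoD(2) by blast+
    show "g u = h u" if "u \<in> carrier (F m)" for u
      using loop_incl_apply[OF c(1) assms that] loop_incl_apply[OF c(2) assms that] \<open>loop_incl m n g = _\<close> by simp
  qed
qed

lemma loop_rho_incl:
  assumes "g \<in> carrier (LB m)" "m \<le> n"
  shows "loop_rho n (loop_incl m n g) = loop_rho m g"
proof -
  obtain p w where g: "conj_endo m g p w" using LB_conj_endo assms by blast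
  show ?thesis
    using loop_data(2)[OF conj_endo_incl[OF g assms(2)]] loop_data(2)[OF g] by simp
qed

lemma loop_incl_incl:
  assumes "g \<in> carrier (LB m)" "m \<le> n" "n \<le> l"
  shows "loop_incl n l (loop_incl m n g) = loop_incl m l g"
proof -
  obtain p w where g: "conj_endo m g p w" using LB_conj_endo assms by blast
  show ?thesis
    by (rule conj_endo_eqI[OF conj_endo_incl[OF conj_endo_incl[OF g]] conj_endo_incl[OF g]])
      (use assms in \<open>auto simp: F_one_eq[of n l]\<close>)
qed

lemma loop_incl_refl: "g \<in> carrier (LB n) \<Longrightarrow> loop_incl n n g = g"
proof -
  assume "g \<in> carrier (LB n)"
  then obtain p w where g: "conj_endo n g p w" using LB_conj_endo by blast
  show ?thesis
    by (rule conj_endo_eqI[OF conj_endo_incl[OF g] g]) auto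
qed

lemma loop_clone_incl:
  assumes "g \<in> carrier (LB m)" "m \<le> n" "0 < k" "k \<le> n"
  shows "loop_clone n k (loop_incl m n g) =
    (if k \<le> m then loop_incl (Suc m) (Suc n) (loop_clone m k g) else loop_incl m (Suc n) g)"
proof -
  obtain p w where g: "conj_endo m g p w" using LB_conj_endo assms by blast
  note D = conj_endoD[OF g]
  note A = conj_endo_clone[OF conj_endo_incl[OF g assms(2)] assms(3,4)]
  show ?thesis
  proof (cases "k \<le> m")
    case True
    define q where "q = inv' p k"
    have q: "0 < q" "q \<le> m"
      using inv_range[OF D(3), of k] assms(3) True by (auto simp: q_def)
    note B = conj_endo_incl[OF conj_endo_clone[OF g assms(3) True], of "Suc n"]
    have "loop_clone n k (loop_incl m n g) = loop_incl (Suc m) (Suc n) (loop_clone m k g)"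
    proof (rule conj_endo_eqI[OF A B])
      fix i
      assume i: "0 < i" "i \<le> Suc n"
      have "w (collapse q i) \<in> carrier (F m)" if "i \<le> Suc m"
        using collapse_range[OF q i(1) that] D(4) by blast
      moreover have "collapse q i \<le> m \<longleftrightarrow> i \<le> Suc m"
        using q by (auto simp: collapse_def)
      ultimately show "doubling n k (if collapse (inv' p k) i \<le> m then w (collapse (inv' p k) i) else \<one>\<^bsub>F n\<^esub>) =
          (if i \<le> Suc m then doubling m k (w (collapse (inv' p k) i)) else \<one>\<^bsub>F (Suc n)\<^esub>)"
        using assms(2) by (simp add: doubling_mono flip: q_def)
    qed (use assms in simp_all)
    then show ?thesis using True by simp
  next
    case False
    have "inv' p k = k"
      using sym_fix[OF sym_inv(1)[OF D(3)], of k] False by simp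
    note A = A[unfolded this]
    have "loop_clone n k (loop_incl m n g) = loop_incl m (Suc n) g"
    proof (rule conj_endo_eqI[OF A conj_endo_incl[OF g]])
      show "perm_clone k p = p"
        using perm_clone_beyond[of p m k] D(3) False by (simp add: sym_group_carrier)
      fix i
      assume i: "0 < i" "i \<le> Suc n"
      have "collapse k i \<le> m \<longleftrightarrow> i \<le> m" "i \<le> m \<Longrightarrow> collapse k i = i"
        using False by (auto simp: collapse_def)
      then show "doubling n k (if collapse k i \<le> m then w (collapse k i) else \<one>\<^bsub>F n\<^esub>) = (if i \<le> m then w i else \<one>\<^bsub>F (Suc n)\<^esub>)"
        using i D(4)[of i] assms(2) False doubling_below[of "w i" m k n] by simp
    qed (use assms in simp)
    then show ?thesis using False by simp
  qed
qed

theorem LB_exact_cloning_system: "exact_cloning_system LB loop_incl loop_rho loop_clone"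
proof (intro exact_cloning_system.intro cloning_system.intro exact_cloning_system_axioms.intro)
  show "loop_clone n k (g \<otimes>\<^bsub>LB n\<^esub> h) = loop_clone n (loop_rho n h k) g \<otimes>\<^bsub>LB (n + 1)\<^esub> loop_clone n k h"
    if "1 \<le> k" "k \<le> n" "g \<in> carrier (LB n)" "h \<in> carrier (LB n)" for n k g h
    using that by (simp add: loop_clone_mult)
qed (auto simp: group_LB loop_incl_mon loop_incl_refl loop_incl_incl loop_rho_hom loop_rho_incl loop_clone_closed
    inj_on_loop_clone loop_clone_incl loop_clone_clone loop_rho_clone)


text \<open>A permutation is induced by the automorphism that permutes the generators by its inverse.\<close>

lemma loop_rho_surj: "loop_rho n ` carrier (LB n) = carrier (sym_group n)"
proof (intro equalityI subsetI)
  fix \<sigma>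
  assume "\<sigma> \<in> loop_rho n ` carrier (LB n)"
  then show "\<sigma> \<in> carrier (sym_group n)"
    using hom_in_carrier[OF loop_rho_hom] by blast
next
  fix \<sigma>
  assume \<sigma>: "\<sigma> \<in> carrier (sym_group n)"
  have c: "conj_endo n (free_endo n (\<lambda>i. free_gen (p i))) p (\<lambda>i. \<one>\<^bsub>F n\<^esub>)"
    if "p \<in> carrier (sym_group n)" for p
  proof (rule conj_endo_free_endo[OF that])
    fix i
    assume "0 < i" "i \<le> n"
    then have "0 < p i" "p i \<le> n" using sym_range[OF that, of i] by auto
    then show "free_gen (p i) = conjugate n \<one>\<^bsub>F n\<^esub> (p i)" by simp
  qed (simp add: exponent_sum_one)
  note \<sigma>' = sym_inv[OF \<sigma>]
  note c1 = c[OF \<sigma>] and c2 = c[OF \<sigma>'(1)]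
  interpret f1: group_hom "F n" "F n" "free_endo n (\<lambda>i. free_gen (\<sigma> i))"
    using conj_endoD(1)[OF c1] by unfold_locales
  interpret f2: group_hom "F n" "F n" "free_endo n (\<lambda>i. free_gen (inv' \<sigma> i))"
    using conj_endoD(1)[OF c2] by unfold_locales
  have "free_endo n (\<lambda>i. free_gen (inv' \<sigma> i)) \<in> carrier (LB n)"
  proof (rule conj_endo_LB[OF c2 c1])
    show "compose (carrier (F n)) (free_endo n (\<lambda>i. free_gen (\<sigma> i))) (free_endo n (\<lambda>i. free_gen (inv' \<sigma> i))) = (\<lambda>u \<in> carrier (F n). u)"
      by (rule conj_endo_eqI[OF conj_endo_compose[OF c2 c1] conj_endo_id]) (use \<sigma>' in \<open>auto simp: fun_eq_iff\<close>)
    show "compose (carrier (F n)) (free_endo n (\<lambda>i. free_gen (inv' \<sigma> i))) (free_endo n (\<lambda>i. free_gen (\<sigma> i))) = (\<lambda>u \<in> carrier (F n). u)"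
      by (rule conj_endo_eqI[OF conj_endo_compose[OF c1 c2] conj_endo_id]) (use \<sigma>' in \<open>auto simp: fun_eq_iff\<close>)
  qed
  moreover have "loop_rho n (free_endo n (\<lambda>i. free_gen (inv' \<sigma> i))) = \<sigma>"
    using loop_data(2)[OF c2] \<sigma>' by simp
  ultimately show "\<sigma> \<in> loop_rho n ` carrier (LB n)"
    by (metis image_eqI)
qed


section \<open>Generators of the loop braid groups\<close>

lemma transpose_sym: "0 < i \<Longrightarrow> Suc i \<le> n \<Longrightarrow> transpose i (Suc i) \<in> carrier (sym_group n)"
  unfolding sym_group_carrier by (intro permutes_swap_id) auto

lemma inv_transpose: "inv' (transpose i j) = transpose i j"
  by (rule inv_unique_comp) simp_all

lemma perm_clone_transpose:
  fixes i k :: nat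
  defines "s \<equiv> transpose i (Suc i)" and "t \<equiv> transpose (Suc i) (Suc (Suc i))"
  shows "k < i \<Longrightarrow> perm_clone (s k) s = t" and "perm_clone (s i) s = t \<circ> s"
    and "perm_clone (s (Suc i)) s = s \<circ> t" and "Suc i < k \<Longrightarrow> perm_clone (s k) s = s"
proof -
  show "perm_clone (s k) s = t" if "k < i"
    unfolding s_def t_def using that by (intro ext) (auto simp: perm_clone_def transpose_def)
  show "perm_clone (s i) s = t \<circ> s"
    unfolding s_def t_def by (intro ext) (auto simp: perm_clone_def transpose_def)
  show "perm_clone (s (Suc i)) s = s \<circ> t"
    unfolding s_def t_def by (intro ext) (auto simp: perm_clone_def transpose_def)
  show "perm_clone (s k) s = s" if "Suc i < k"
    unfolding s_def t_def using that by (intro ext) (auto simp: perm_clone_def transpose_def)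
qed

lemma conj_endo_sigma:
  assumes "0 < i" "Suc i \<le> n"
  shows "conj_endo n (loop_sigma n i) (transpose i (Suc i)) (\<lambda>j. \<one>\<^bsub>F n\<^esub>)"
  unfolding loop_sigma_def
proof (rule conj_endo_free_endo)
  show "transpose i (Suc i) \<in> carrier (sym_group n)"
    using assms by (rule transpose_sym)
  fix j
  assume j: "0 < j" "j \<le> n"
  show "\<one>\<^bsub>F n\<^esub> \<in> carrier (F n) \<and> exponent_sum (transpose i (Suc i) j) \<one>\<^bsub>F n\<^esub> = 0"
    by (simp add: exponent_sum_one)
  show "(if j = i then free_gen (i + 1) else if j = i + 1 then free_gen i else free_gen j) =
      conjugate n \<one>\<^bsub>F n\<^esub> (transpose i (Suc i) j)"
    using j assms by (auto simp: transpose_def)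
qed

lemma conj_endo_beta:
  assumes "0 < i" "Suc i \<le> n"
  shows "conj_endo n (loop_beta n i) (transpose i (Suc i)) (\<lambda>j. if j = Suc i then free_gen (Suc i) else \<one>\<^bsub>F n\<^esub>)"
  unfolding loop_beta_def F_def[symmetric]
proof (rule conj_endo_free_endo)
  show "transpose i (Suc i) \<in> carrier (sym_group n)"
    using assms by (rule transpose_sym)
  fix j
  assume j: "0 < j" "j \<le> n"
  show "(if j = Suc i then free_gen (Suc i) else \<one>\<^bsub>F n\<^esub>) \<in> carrier (F n) \<and>
      exponent_sum (transpose i (Suc i) j) (if j = Suc i then free_gen (Suc i) else \<one>\<^bsub>F n\<^esub>) = 0"
    using assms by (simp add: exponent_sum_one exponent_sum_letter)
  show "(if j = i then free_gen (i + 1)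
      else if j = i + 1 then inv\<^bsub>F n\<^esub> free_gen (i + 1) \<otimes>\<^bsub>F n\<^esub> free_gen i \<otimes>\<^bsub>F n\<^esub> free_gen (i + 1)
      else free_gen j) =
      conjugate n (if j = Suc i then free_gen (Suc i) else \<one>\<^bsub>F n\<^esub>) (transpose i (Suc i) j)"
    using j assms by (auto simp: transpose_def)
qed

lemma loop_sigma_closed:
  assumes "0 < i" "Suc i \<le> n"
  shows "loop_sigma n i \<in> carrier (LB n)"
proof -
  note c = conj_endo_sigma[OF assms]
  interpret s: group_hom "F n" "F n" "loop_sigma n i"
    using conj_endoD(1)[OF c] by unfold_locales
  have "compose (carrier (F n)) (loop_sigma n i) (loop_sigma n i) = (\<lambda>u \<in> carrier (F n). u)"
    by (rule conj_endo_eqI[OF conj_endo_compose[OF c c] conj_endo_id]) simp_all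
  then show ?thesis
    using conj_endo_LB[OF c c] by blast
qed

lemma loop_beta_closed:
  assumes "0 < i" "Suc i \<le> n"
  shows "loop_beta n i \<in> carrier (LB n)"
proof -
  \<comment> \<open>The inverse sends \<open>x\<^sub>i\<close> to \<open>x\<^sub>i x\<^bsub>i+1\<^esub> x\<^sub>i\<inverse>\<close> and \<open>x\<^bsub>i+1\<^esub>\<close> to \<open>x\<^sub>i\<close>.\<close>
  let ?w = "\<lambda>j. if j = i then inv\<^bsub>F n\<^esub> free_gen i else \<one>\<^bsub>F n\<^esub>"
  define b where "b = free_endo n (\<lambda>j. conjugate n (?w j) (transpose i (Suc i) j))"
  note c = conj_endo_beta[OF assms]
  have b: "conj_endo n b (transpose i (Suc i)) ?w"
    unfolding b_def
    by (rule conj_endo_free_endo[OF transpose_sym[OF assms]])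
      (use assms in \<open>auto simp: exponent_sum_one exponent_sum_inv exponent_sum_letter\<close>)
  interpret beta: group_hom "F n" "F n" "loop_beta n i"
    using conj_endoD(1)[OF c] by unfold_locales
  interpret b: group_hom "F n" "F n" b
    using conj_endoD(1)[OF b] by unfold_locales
  have beta_i: "loop_beta n i (free_gen i) = free_gen (Suc i)"
    using conj_endoD(6)[OF c, of i] assms by simp
  have b_i: "b (free_gen (Suc i)) = free_gen i"
    using conj_endoD(6)[OF b, of "Suc i"] assms by simp
  show ?thesis
  proof (rule conj_endo_LB[OF c b])
    show "compose (carrier (F n)) b (loop_beta n i) = (\<lambda>u \<in> carrier (F n). u)"
      by (rule conj_endo_eqI[OF conj_endo_compose[OF c b] conj_endo_id])
        (use assms in \<open>auto simp: transpose_def b_i split: if_splits\<close>)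
    show "compose (carrier (F n)) (loop_beta n i) b = (\<lambda>u \<in> carrier (F n). u)"
      by (rule conj_endo_eqI[OF conj_endo_compose[OF b c] conj_endo_id])
        (use assms in \<open>auto simp: transpose_def beta_i split: if_splits\<close>)
  qed
qed

lemma loop_rho_generators:
  assumes "0 < i" "Suc i \<le> n"
  shows "loop_rho n (loop_sigma n i) = transpose i (Suc i)" "loop_rho n (loop_beta n i) = transpose i (Suc i)"
  using loop_data(2)[OF conj_endo_sigma[OF assms]] loop_data(2)[OF conj_endo_beta[OF assms]]
  by (simp_all add: inv_transpose)

lemma loop_clone_sigma:
  assumes "0 < i" "Suc i \<le> n" "0 < k" "k \<le> n"
  shows "loop_clone n k (loop_sigma n i) =
    (if k < i then loop_sigma (Suc n) (Suc i)
     else if k = i then loop_sigma (Suc n) i \<otimes>\<^bsub>LB (Suc n)\<^esub> loop_sigma (Suc n) (Suc i)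
     else if k = Suc i then loop_sigma (Suc n) (Suc i) \<otimes>\<^bsub>LB (Suc n)\<^esub> loop_sigma (Suc n) i
     else loop_sigma (Suc n) i)"
proof -
  note A = conj_endo_clone[OF conj_endo_sigma[OF assms(1,2)] assms(3,4), unfolded inv_transpose]
  have i: "0 < i" "Suc i \<le> Suc n" "0 < Suc i" "Suc (Suc i) \<le> Suc n" using assms by auto
  note S = conj_endo_sigma[OF i(1,2)] and T = conj_endo_sigma[OF i(3,4)]
  note S' = loop_sigma_closed[OF i(1,2)] and T' = loop_sigma_closed[OF i(3,4)]
  interpret S: group_hom "F (Suc n)" "F (Suc n)" "loop_sigma (Suc n) i"
    using conj_endoD(1)[OF S] by unfold_locales
  interpret T: group_hom "F (Suc n)" "F (Suc n)" "loop_sigma (Suc n) (Suc i)"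
    using conj_endoD(1)[OF T] by unfold_locales
  consider "k < i" | "k = i" | "k = Suc i" | "Suc i < k" by linarith
  then show ?thesis
  proof cases
    case 1
    then have "loop_clone n k (loop_sigma n i) = loop_sigma (Suc n) (Suc i)"
      using perm_clone_transpose(1)[OF 1] by (intro conj_endo_eqI[OF A T]) simp_all
    then show ?thesis using 1 by simp
  next
    case 2
    then have "loop_clone n k (loop_sigma n i) = loop_sigma (Suc n) i \<otimes>\<^bsub>LB (Suc n)\<^esub> loop_sigma (Suc n) (Suc i)"
      by (intro conj_endo_eqI[OF A conj_endo_LB_mult[OF S' T' S T]])
        (simp_all add: perm_clone_transpose(2) del: transpose_apply_first)
    then show ?thesis using 2 by simp
  next
    case 3
    then have "loop_clone n k (loop_sigma n i) = loop_sigma (Suc n) (Suc i) \<otimes>\<^bsub>LB (Suc n)\<^esub> loop_sigma (Suc n) i"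
      by (intro conj_endo_eqI[OF A conj_endo_LB_mult[OF T' S' T S]])
        (simp_all add: perm_clone_transpose(3) del: transpose_apply_second)
    then show ?thesis using 3 by simp
  next
    case 4
    then have "loop_clone n k (loop_sigma n i) = loop_sigma (Suc n) i"
      using perm_clone_transpose(4)[OF 4] by (intro conj_endo_eqI[OF A S]) simp_all
    then show ?thesis using 4 by simp
  qed
qed

lemma loop_clone_beta:
  assumes "0 < i" "Suc i \<le> n" "0 < k" "k \<le> n"
  shows "loop_clone n k (loop_beta n i) =
    (if k < i then loop_beta (Suc n) (Suc i)
     else if k = i then loop_beta (Suc n) i \<otimes>\<^bsub>LB (Suc n)\<^esub> loop_beta (Suc n) (Suc i)
     else if k = Suc i then loop_beta (Suc n) (Suc i) \<otimes>\<^bsub>LB (Suc n)\<^esub> loop_beta (Suc n) i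
     else loop_beta (Suc n) i)"
proof -
  note A = conj_endo_clone[OF conj_endo_beta[OF assms(1,2)] assms(3,4), unfolded inv_transpose]
  have i: "0 < i" "Suc i \<le> Suc n" "0 < Suc i" "Suc (Suc i) \<le> Suc n" using assms by auto
  note S = conj_endo_beta[OF i(1,2)] and T = conj_endo_beta[OF i(3,4)]
  note S' = loop_beta_closed[OF i(1,2)] and T' = loop_beta_closed[OF i(3,4)]
  interpret S: group_hom "F (Suc n)" "F (Suc n)" "loop_beta (Suc n) i"
    using conj_endoD(1)[OF S] by unfold_locales
  interpret T: group_hom "F (Suc n)" "F (Suc n)" "loop_beta (Suc n) (Suc i)"
    using conj_endoD(1)[OF T] by unfold_locales
  have S_gen: "loop_beta (Suc n) i (free_gen (Suc (Suc i))) = free_gen (Suc (Suc i))"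
    using conj_endoD(6)[OF S, of "Suc (Suc i)"] assms by simp
  have T_gen: "loop_beta (Suc n) (Suc i) (free_gen (Suc i)) = free_gen (Suc (Suc i))"
    using conj_endoD(6)[OF T, of "Suc i"] assms by simp
  consider "k < i" | "k = i" | "k = Suc i" | "Suc i < k" by linarith
  then show ?thesis
  proof cases
    case 1
    then have "loop_clone n k (loop_beta n i) = loop_beta (Suc n) (Suc i)"
      using assms perm_clone_transpose(1)[OF 1] by (intro conj_endo_eqI[OF A T]) (auto simp: collapse_def doubling_gen)
    then show ?thesis using 1 by simp
  next
    case 2
    have "loop_clone n k (loop_beta n i) = loop_beta (Suc n) i \<otimes>\<^bsub>LB (Suc n)\<^esub> loop_beta (Suc n) (Suc i)"
    proof (rule conj_endo_eqI[OF A conj_endo_LB_mult[OF S' T' S T]])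
      show "perm_clone (transpose i (Suc i) k) (transpose i (Suc i)) = transpose (Suc i) (Suc (Suc i)) \<circ> transpose i (Suc i)"
        unfolding 2 by (rule perm_clone_transpose)
    qed (use 2 assms in \<open>auto simp: collapse_def doubling_gen transpose_def T_gen\<close>)
    then show ?thesis using 2 by simp
  next
    case 3
    have "loop_clone n k (loop_beta n i) = loop_beta (Suc n) (Suc i) \<otimes>\<^bsub>LB (Suc n)\<^esub> loop_beta (Suc n) i"
    proof (rule conj_endo_eqI[OF A conj_endo_LB_mult[OF T' S' T S]])
      show "perm_clone (transpose i (Suc i) k) (transpose i (Suc i)) = transpose i (Suc i) \<circ> transpose (Suc i) (Suc (Suc i))"
        unfolding 3 by (rule perm_clone_transpose)
    qed (use 3 assms in \<open>auto simp: collapse_def doubling_gen transpose_def S_gen\<close>)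
    then show ?thesis using 3 by simp
  next
    case 4
    then have "loop_clone n k (loop_beta n i) = loop_beta (Suc n) i"
      using assms perm_clone_transpose(4)[OF 4] by (intro conj_endo_eqI[OF A S]) (auto simp: collapse_def doubling_gen)
    then show ?thesis using 4 by simp
  qed
qed

text \<open>The product rule for \<open>g g\<inverse>\<close> determines the clones of inverses.\<close>

lemma loop_clone_inv:
  assumes "g \<in> carrier (LB n)" "0 < k" "k \<le> n"
  shows "loop_clone n k (inv\<^bsub>LB n\<^esub> g) = inv\<^bsub>LB (Suc n)\<^esub> loop_clone n (loop_rho n (inv\<^bsub>LB n\<^esub> g) k) g"
proof -
  have g': "inv\<^bsub>LB n\<^esub> g \<in> carrier (LB n)" using assms(1) by simp
  define l where "l = loop_rho n (inv\<^bsub>LB n\<^esub> g) k"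
  have l: "0 < l" "l \<le> n"
    using loop_rho_range[OF g' assms(2,3)] by (auto simp: l_def)
  have "loop_clone n l g \<otimes>\<^bsub>LB (Suc n)\<^esub> loop_clone n k (inv\<^bsub>LB n\<^esub> g) = \<one>\<^bsub>LB (Suc n)\<^esub>"
    using loop_clone_mult[OF assms(1) g' assms(2,3)] loop_clone_id[OF assms(2,3)] assms(1)
    by (simp add: l_def LB_one)
  then have "inv\<^bsub>LB (Suc n)\<^esub> loop_clone n k (inv\<^bsub>LB n\<^esub> g) = loop_clone n l g"
    using loop_clone_closed[OF assms(1) l] loop_clone_closed[OF g' assms(2,3)] by (intro LB.inv_equality)
  then show ?thesis
    using loop_clone_closed[OF g' assms(2,3)] by (metis LB.inv_inv l_def)
qed

lemma loop_rho_inv_beta: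
  assumes "0 < i" "Suc i \<le> n"
  shows "loop_rho n (inv\<^bsub>LB n\<^esub> loop_beta n i) = transpose i (Suc i)"
proof -
  interpret rho: group_hom "LB n" "sym_group n" "loop_rho n"
    using loop_rho_hom by (intro group_hom.intro group_LB sym_group_is_group group_hom_axioms.intro)
  have "loop_rho n (inv\<^bsub>LB n\<^esub> loop_beta n i) = inv\<^bsub>sym_group n\<^esub> transpose i (Suc i)"
    using loop_beta_closed[OF assms] loop_rho_generators[OF assms] by simp
  also have "\<dots> = transpose i (Suc i)"
    using transpose_sym[OF assms] by (intro rho.H.inv_equality) (simp_all add: sym_group_mult sym_group_one)
  finally show ?thesis .
qed

lemma loop_clone_inv_beta:
  assumes "0 < i" "Suc i \<le> n" "0 < k" "k \<le> n"
  shows "loop_clone n k (inv\<^bsub>LB n\<^esub> loop_beta n i) =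
    (if k < i then inv\<^bsub>LB (Suc n)\<^esub> loop_beta (Suc n) (Suc i)
     else if k = i then inv\<^bsub>LB (Suc n)\<^esub> loop_beta (Suc n) i \<otimes>\<^bsub>LB (Suc n)\<^esub> inv\<^bsub>LB (Suc n)\<^esub> loop_beta (Suc n) (Suc i)
     else if k = Suc i then inv\<^bsub>LB (Suc n)\<^esub> loop_beta (Suc n) (Suc i) \<otimes>\<^bsub>LB (Suc n)\<^esub> inv\<^bsub>LB (Suc n)\<^esub> loop_beta (Suc n) i
     else inv\<^bsub>LB (Suc n)\<^esub> loop_beta (Suc n) i)"
proof -
  have closed: "loop_beta (Suc n) i \<in> carrier (LB (Suc n))" "loop_beta (Suc n) (Suc i) \<in> carrier (LB (Suc n))"
    using assms by (auto intro: loop_beta_closed)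
  have eq: "loop_clone n k (inv\<^bsub>LB n\<^esub> loop_beta n i) =
      inv\<^bsub>LB (Suc n)\<^esub> loop_clone n (transpose i (Suc i) k) (loop_beta n i)"
    using loop_clone_inv[OF loop_beta_closed assms(3,4)] loop_rho_inv_beta assms by simp
  have "0 < transpose i (Suc i) k" "transpose i (Suc i) k \<le> n"
    using assms by (auto simp: transpose_def)
  from loop_clone_beta[OF assms(1,2) this] show ?thesis
    unfolding eq using closed by (auto simp: transpose_def LB.inv_mult_group)
qed

lemma loop_generator_values_loop: "loop_generator_values loop_rho loop_clone"
  unfolding loop_generator_values_def
  by (simp add: loop_rho_generators loop_clone_beta loop_clone_inv_beta loop_clone_sigma Suc_le_eq)


section \<open>Pure loop braid groups\<close>

lemma (in exact_cloning_system) exact_cloning_subsystem: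
  assumes "\<And>n. 1 \<le> n \<Longrightarrow> subgroup (K n) (G n)"
    and incl: "\<And>m n g. \<lbrakk>1 \<le> m; m \<le> n; g \<in> K m\<rbrakk> \<Longrightarrow> \<iota> m n g \<in> K n"
    and clone: "\<And>n k g. \<lbrakk>1 \<le> k; k \<le> n; g \<in> K n\<rbrakk> \<Longrightarrow> \<kappa> n k g \<in> K (n + 1)"
  shows "exact_cloning_system (\<lambda>n. G n\<lparr>carrier := K n\<rparr>) \<iota> \<rho> \<kappa>"
proof -
  have sub: "g \<in> carrier (G n)" if "1 \<le> n" "g \<in> K n" for n g
    using assms(1)[OF that(1)] that(2) by (rule subgroup.mem_carrier)
  show ?thesis
  proof (intro exact_cloning_system.intro cloning_system.intro exact_cloning_system_axioms.intro)
    show "group (G n\<lparr>carrier := K n\<rparr>)" if "1 \<le> n" for n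
      using subgroup.subgroup_is_group[OF assms(1)[OF that] group[OF that]] .
    show "\<iota> m n \<in> mon (G m\<lparr>carrier := K m\<rparr>) (G n\<lparr>carrier := K n\<rparr>)" if "1 \<le> m" "m \<le> n" for m n
      unfolding mon_def
    proof (intro CollectI conjI homI)
      show "inj_on (\<iota> m n) (carrier (G m\<lparr>carrier := K m\<rparr>))"
        using incl_mon[OF that] sub[OF that(1)] by (auto simp: mon_def intro: inj_on_subset)
    qed (use that incl sub in \<open>auto simp: incl_mult\<close>)
    show "\<rho> n \<in> hom (G n\<lparr>carrier := K n\<rparr>) (sym_group n)" if "1 \<le> n" for n
      using rho_hom[OF that] sub[OF that] by (auto simp: hom_def)
    show "inj_on (\<kappa> n k) (carrier (G n\<lparr>carrier := K n\<rparr>))" if "1 \<le> k" "k \<le> n" for n k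
      using cloning_system.clone_inj[OF cloning_system_axioms that] sub[of n] that by (auto intro: inj_on_subset)
  qed (use sub incl_refl incl_trans rho_incl clone clone_incl clone_mult clone_clone rho_clone rho_clone_exact in auto)
qed

lemma carrier_PLB: "carrier (PLB n) = {g \<in> carrier (LB n). loop_rho n g = id}"
proof -
  have eq: "(\<forall>i \<in> {1..n}. \<exists>w \<in> carrier (F n). g (free_gen i) = conjugate n w i) \<longleftrightarrow> loop_rho n g = id"
    if g: "g \<in> carrier (LB n)" for g
  proof
    obtain p w where c: "conj_endo n g p w" using LB_conj_endo[OF g] by blast
    note D = conj_endoD[OF c]
    show "loop_rho n g = id" if pure: "\<forall>i \<in> {1..n}. \<exists>w \<in> carrier (F n). g (free_gen i) = conjugate n w i"
    proof -
      have "p i = i" for i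
      proof (cases "0 < i \<and> i \<le> n")
        case True
        then have "i \<in> {1..n}" by simp
        with pure obtain u where u: "u \<in> carrier (F n)" "g (free_gen i) = conjugate n u i"
          by blast
        have "conjugate n u i = conjugate n (w i) (p i)"
          unfolding u(2)[symmetric] using D(6)[of i] True by blast
        from arg_cong[OF this, of "exponent_sum i"] show ?thesis
          using True u(1) D(4,7,8)[of i] by (simp add: exponent_sum_conj split: if_splits)
      next
        case False
        then show ?thesis
          using permutes_not_in[of p "{1..n}" i] D(3) by (auto simp: sym_group_carrier)
      qed
      then have "p = id" by auto
      then show ?thesis using loop_data(2)[OF c] by (simp add: inv_id)
    qed
    assume "loop_rho n g = id"
    then have "p = id"
      using loop_data(2)[OF c] sym_inv(4)[OF D(3)] by (simp add: inv_id)
    then show "\<forall>i \<in> {1..n}. \<exists>w \<in> carrier (F n). g (free_gen i) = conjugate n w i"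
      using D(4,6) by (auto simp: Suc_le_eq)
  qed
  have "carrier (PLB n) =
      {g \<in> carrier (LB n). \<forall>i \<in> {1..n}. \<exists>w \<in> carrier (F n). g (free_gen i) = conjugate n w i}"
    unfolding PLB_def F_def by simp
  also have "\<dots> = {g \<in> carrier (LB n). loop_rho n g = id}"
    by (rule Collect_cong) (simp only: eq cong: conj_cong)
  finally show ?thesis .
qed

lemma carrier_PLB_kernel: "carrier (PLB n) = kernel (LB n) (sym_group n) (loop_rho n)"
  by (simp add: carrier_PLB kernel_def sym_group_one)

theorem PLB_exact_cloning_system: "exact_cloning_system PLB loop_incl loop_rho loop_clone"
proof -
  interpret exact_cloning_system LB loop_incl loop_rho loop_clone
    by (rule LB_exact_cloning_system)
  have "exact_cloning_system (\<lambda>n. LB n\<lparr>carrier := carrier (PLB n)\<rparr>) loop_incl loop_rho loop_clone"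
  proof (rule exact_cloning_subsystem)
    fix n :: nat
    interpret rho: group_hom "LB n" "sym_group n" "loop_rho n"
      using loop_rho_hom by (intro group_hom.intro group_LB sym_group_is_group group_hom_axioms.intro)
    show "subgroup (carrier (PLB n)) (LB n)"
      unfolding carrier_PLB_kernel by (rule rho.subgroup_kernel)
  next
    show "loop_incl m n g \<in> carrier (PLB n)" if "m \<le> n" "g \<in> carrier (PLB m)" for m n g
      using that by (auto simp: carrier_PLB loop_incl_closed loop_rho_incl)
    show "loop_clone n k g \<in> carrier (PLB (n + 1))" if "1 \<le> k" "k \<le> n" "g \<in> carrier (PLB n)" for n k g
      using that by (auto simp: carrier_PLB loop_clone_closed loop_rho_clone perm_clone_id)
  qed
  moreover have "(\<lambda>n. LB n\<lparr>carrier := carrier (PLB n)\<rparr>) = PLB"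
    by (rule ext) (simp add: PLB_def)
  ultimately show ?thesis by simp
qed


section \<open>The groups \<open>V\<^sub>m\<^sub>o\<^sub>c\<^sub>k\<close>, \<open>V\<^sub>l\<^sub>o\<^sub>o\<^sub>p\<close> and \<open>F\<^sub>l\<^sub>o\<^sub>o\<^sub>p\<close>\<close>

theorem theorem9p2:
  shows
    "(\<exists>\<iota> \<rho> \<kappa>.
        cloning_system mock_group \<iota> \<rho> \<kappa> \<and> mock_generator_values \<iota> \<rho> \<kappa> \<and>
        group (right_fractions (bzs_monoid mock_group \<iota> \<rho> \<kappa>)) \<and>
        subgroup (carrier (thompson_group mock_group \<iota> \<rho> \<kappa>))
          (right_fractions (bzs_monoid mock_group \<iota> \<rho> \<kappa>)) \<and>
        (\<forall>n \<ge> 1. \<exists>f. f \<in> mon (mock_group n) (thompson_group mock_group \<iota> \<rho> \<kappa>)) \<and>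
        (\<exists>f. f \<in> epi (thompson_group mock_group \<iota> \<rho> \<kappa>) thompson_V))
     \<and>
     (\<exists>\<rho> \<kappa>.
        cloning_system LB loop_incl \<rho> \<kappa> \<and> loop_generator_values \<rho> \<kappa> \<and>
        group (right_fractions (bzs_monoid LB loop_incl \<rho> \<kappa>)) \<and>
        subgroup (carrier (thompson_group LB loop_incl \<rho> \<kappa>))
          (right_fractions (bzs_monoid LB loop_incl \<rho> \<kappa>)) \<and>
        (\<forall>n \<ge> 1. \<exists>f. f \<in> mon (LB n) (thompson_group LB loop_incl \<rho> \<kappa>)) \<and>
        (\<exists>f. f \<in> epi (thompson_group LB loop_incl \<rho> \<kappa>) thompson_V) \<and>
        (\<forall>n \<ge> 1. carrier (PLB n) = kernel (LB n) (sym_group n) (\<rho> n)) \<and>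
        cloning_system PLB loop_incl \<rho> \<kappa> \<and>
        group (right_fractions (bzs_monoid PLB loop_incl \<rho> \<kappa>)) \<and>
        subgroup (carrier (thompson_group PLB loop_incl \<rho> \<kappa>))
          (right_fractions (bzs_monoid PLB loop_incl \<rho> \<kappa>)) \<and>
        (\<forall>n \<ge> 1. \<exists>f. f \<in> mon (PLB n) (thompson_group PLB loop_incl \<rho> \<kappa>)) \<and>
        (\<exists>f. f \<in> epi (thompson_group PLB loop_incl \<rho> \<kappa>) thompson_F))"
proof -
  interpret mock: exact_cloning_system mock_group mock_incl mock_rho mock_clone
    by (rule mock_exact_cloning_system)
  interpret LB: exact_cloning_system LB loop_incl loop_rho loop_clone
    by (rule LB_exact_cloning_system)
  interpret PLB: exact_cloning_system PLB loop_incl loop_rho loop_clone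
    by (rule PLB_exact_cloning_system)
  show ?thesis
  proof (rule conjI, goal_cases)
    case 1
    show ?case
    proof (rule exI[of _ mock_incl], rule exI[of _ mock_rho], rule exI[of _ mock_clone], intro conjI allI impI)
      show "\<exists>f. f \<in> epi (thompson_group mock_group mock_incl mock_rho mock_clone) thompson_V"
        by (rule mock.thompson_epi_V) (rule mock_rho_surj)
    qed (rule mock.cloning_system_axioms mock_generator_values_mock mock.group_fractions
        mock.subgroup_thompson exI mock.mon_thompson | assumption)+
  next
    case 2
    show ?case
    proof (rule exI[of _ loop_rho], rule exI[of _ loop_clone], intro conjI allI impI)
      show "\<exists>f. f \<in> epi (thompson_group LB loop_incl loop_rho loop_clone) thompson_V"
        by (rule LB.thompson_epi_V) (rule loop_rho_surj)
      show "\<exists>f. f \<in> epi (thompson_group PLB loop_incl loop_rho loop_clone) thompson_F"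
        by (rule PLB.thompson_epi_F) (simp add: carrier_PLB)
    qed (rule LB.cloning_system_axioms PLB.cloning_system_axioms loop_generator_values_loop
        LB.group_fractions PLB.group_fractions LB.subgroup_thompson PLB.subgroup_thompson
        carrier_PLB_kernel exI LB.mon_thompson PLB.mon_thompson | assumption)+
  qed
qed

end
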